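(* Let $(u,v)$, $v=\partial_tu$, be the exact solution of the peridynamic equation $\ddot u(t)=\mathcal L^\epsilon(u(t))+b(t)$ on $[0,T]$ with $u(0)=u_0$, $\partial_tu(0)=v_0$ and $u=0$ on $\partial D$. Let $0<\Delta t<1$, $t^k=k\Delta t$, and let $(u^k_h,v^k_h)\in V_h\times V_h$ be the finite element solution of the central difference scheme with initial data $u^0_h=r_h(u_0)$, $v^0_h=r_h(v_0)$: for $k\ge1$ and all $\tilde u\in V_h$, $$\Big(\frac{u^{k+1}_h-u^k_h}{\Delta t},\tilde u\Big)=(v^{k+1}_h,\tilde u),\qquad \Big(\frac{v^{k+1}_h-v^k_h}{\Delta t},\tilde u\Big)=(\mathcal L^\epsilon(u^k_h),\tilde u)+(b^k_h,\tilde u),$$ which combine to the central difference equation, for $k\ge1$ and all $\tilde u\in V_h$, $$\Big(\frac{u^{k+1}_h-2u^k_h+u^{k-1}_h}{\Delta t^2},\tilde u\Big)=(\mathcal L^\epsilon(u^k_h),\tilde u)+(b^k_h,\tilde u),$$ while for $k=0$ and all $\tilde u\in V_h$, $$\Big(\frac{u^1_h-u^0_h}{\Delta t^2},\tilde u\Big)=\frac12(\mathcal L^\epsilon(u^0_h),\tilde u)+\frac1{\Delta t}(v^0_h,\tilde u)+\frac12(b^0_h,\tilde u),$$ where $b^k_h=r_h(b(t^k))$. If $u,v\in C^2([0,T];W)$, then the scheme is consistent, i.e. $\tau\le C_t\Delta t+C_s\frac{h^2}{\epsilon^2}$, and the error $E^k=\|u^k_h-u(t^k)\|+\|v^k_h-v(t^k)\|$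 satisfies $$\sup_{k\le T/\Delta t}E^k\le C_ph^2+\exp\!\Big[T(1+L/\epsilon^2)\Big(\frac1{1-\Delta t}\Big)\Big]\Big[e^0+\Big(\frac{T}{1-\Delta t}\Big)\Big(C_t\Delta t+C_s\frac{h^2}{\epsilon^2}\Big)\Big].$$ If the error in the initial data is zero, then $E^k$ is of the order of $C_t\Delta t+C_sh^2/\epsilon^2$.
   Context: Let $d\in\{2,3\}$ and let $D\subset\mathbb R^d$ (the material domain) be an open set with $C^1$ boundary. $\epsilon>0$ is the (fixed) horizon, $H_\epsilon(x)=\{y\in\mathbb R^d:|y-x|<\epsilon\}$, and $\omega_d$ is the volume of the unit ball in $\mathbb R^d$. The density is $\rho=1$, and $b$ is the body force. $(\cdot,\cdot)$ and $\|\cdot\|$ are the $L^2(D;\mathbb R^d)$ inner product and norm; $\|u\|_2=\|u\|+\|\nabla u\|+\|\nabla^2u\|$; $W=H^2(D;\mathbb R^d)\cap H^1_0(D;\mathbb R^d)$. Displacements are extended by zero outside $D$. Influence function: $J^\epsilon(r)=J(r/\epsilon)$, $0\le J(r)\le M$ for $r<1$, $J(r)=0$ for $r\ge1$; $\bar J_\alpha=\frac1{\omega_d}\int_{H_1(0)}J(|\xi|)|\xi|^{-\alpha}d\xi$. Boundary function: $\omega:D\to[0,1]$ equals $1$ in the interior and decays smoothly to $0$ as $x$ approaches $\partial D$, with $\sup|\nabla\omega|<\infty$ and $\sup|\nabla^2\omega|<\infty$; it is taken to be zero outside $D$. Strains: with $e_{y-x}=\frac{y-x}{|y-x|}$, $S(y,x;u)=\frac{u(y)-u(x)}{|y-x|}\cdot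 e_{y-x}$ and $\theta(x;u)=\frac1{\epsilon^d\omega_d}\int_{H_\epsilon(x)}\omega(y)J^\epsilon(|y-x|)S(y,x;u)|y-x|\,dy$. Potentials: $f$ is at least four times differentiable, convex for small strains and concave for larger ones (inflection points $r^-<0<r^+$, well at $0$), with $C^f_0=\sup_r|f(r)|<\infty$ and $C^f_i=\sup_r|f^{(i)}(r)|<\infty$, $i=1,\dots,4$. $g$ is either quadratic ($g(r)=\beta r^2/2$, with one well at $0$) or of convex-concave type with the same regularity, with finite constants $C^g_i$ defined analogously. Force: $\mathcal L^\epsilon=\mathcal L^\epsilon_T+\mathcal L^\epsilon_D$ with $$\mathcal L^\epsilon_T(u)(x)=\frac{2}{\epsilon^{d+1}\omega_d}\int_{H_\epsilon(x)}\omega(x)\omega(y)\frac{J^\epsilon(|y-x|)}{\sqrt{|y-x|}}f'\big(\sqrt{|y-x|}S(y,x;u)\big)e_{y-x}\,dy,$$ $$\mathcal L^\epsilon_D(u)(x)=\frac1{\epsilon^d\omega_d}\int_{H_\epsilon(x)}\omega(x)\omega(y)\frac{J^\epsilon(|y-x|)}{\epsilon^2}\big[g'(\theta(y;u))+g'(\theta(x;u))\big]e_{y-x}\,dy.$$ $L/\epsilon^2$ is the Lipschitz constant of $\mathcal L^\epsilon$ in $L^2$, i.e. $\|\mathcal L^\epsilon(u)-\mathcal L^\epsilon(v)\|\le\frac L{\epsilon^2}\|u-v\|$, where $L=4(C^f_2\bar J_1+C^g_2\bar J_0^2)$ if $g$ is convex-concave and $L=4(C^f_2\bar J_1+g''(0)\bar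 J_0^2)$ if $g$ is quadratic. Finite elements: $V_h\subset H^1_0(D;\mathbb R^d)$ is the space of continuous piecewise linear functions on a conforming, shape regular mesh of triangles/tetrahedra of size $h$. $r_h$ is the $L^2$ projection onto $V_h$: $(r_h(w),\tilde u)=(w,\tilde u)$ for all $\tilde u\in V_h$. The constant $c$, independent of $h$, is that of the projection estimate $\|w-r_h(w)\|\le ch^2\|w\|_2$ for all $w\in W$. Notation: $u^k=u(t^k)$, $v^k=v(t^k)$, $e^k=\|r_h(u^k)-u^k_h\|+\|r_h(v^k)-v^k_h\|$ (so $e^0$ is the error in the initial data), $$C_p=c\Big[\sup_t\|u(t)\|_2+\sup_t\|\partial_tu(t)\|_2\Big],\quad C_t=\sup_t\|\partial^2_{tt}u(t)\|+\sup_t\|\partial^2_{tt}v(t)\|,\quad C_s=Lc\sup_t\|u(t)\|_2,$$ suprema over $t\in[0,T]$. The consistency error is $\tau=\sup_k\big(\|\tau^k_h(u)\|+\|\tau^k_h(v)\|+\|\sigma^k_h(u)\|\big)$, where $$\tau^k_h(u)=\partial_tu^{k+1}-\frac{u^{k+1}-u^k}{\Delta t},\quad \tau^k_h(v)=\partial_tv^k-\frac{v^{k+1}-v^k}{\Delta t},\quad \sigma^k_h(u)=\mathcal L^\epsilon(r_h(u^k))-\mathcal L^\epsilon(u^k).$$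
   Formalization: The halved first step makes a one-off O(Δt) velocity error, so the bound fails for small T: for T<1 with this start, T/(1-Δt) becomes 1/(1-Δt) (T is kept if the velocity equation holds at k=0). The position equation is also used at k=0; the order claim assumes L>0, being false for L=0. *)

theory Defs
  imports "HOL-Analysis.Analysis"
begin

section \<open>Function spaces\<close>

text \<open>Fields on \<open>D\<close> are functions on the whole space that vanish outside \<open>D\<close>, so that the
  extension by zero is built in. Elements of \<open>L\<^sup>2\<close> are represented by Borel functions; all norms
  below ignore null sets.\<close>

type_synonym 'd field = "real ^ 'd \<Rightarrow> real ^ 'd"

definition L2_space :: "(real ^ 'd) set \<Rightarrow> ('d::finite) field set" where
  "L2_space D = {w. w \<in> borel_measurable borel \<and> (\<forall>x. x \<notin> D \<longrightarrow> w x = 0) \<and>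
                    integrable lborel (\<lambda>x. (norm (w x))\<^sup>2)}"

definition L2_inner :: "(real ^ 'd) set \<Rightarrow> ('d::finite) field \<Rightarrow> 'd field \<Rightarrow> real" where
  "L2_inner D w z = (LINT x:D|lborel. w x \<bullet> z x)"

definition L2_norm :: "(real ^ 'd) set \<Rightarrow> ('d::finite) field \<Rightarrow> real" where
  "L2_norm D w = sqrt (L2_inner D w w)"

definition partial :: "'d \<Rightarrow> (real ^ 'd \<Rightarrow> 'b) \<Rightarrow> real ^ 'd \<Rightarrow> 'b::real_normed_vector"
  where "partial i \<phi> x = frechet_derivative \<phi> (at x) (axis i 1)"

text \<open>Iterated partial derivative along a list of coordinate directions.\<close>

definition partials :: "('d::finite) list \<Rightarrow> (real ^ 'd \<Rightarrow> 'b) \<Rightarrow> real ^ 'd \<Rightarrow> 'b::real_normed_vector"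
  where "partials is \<phi> = fold partial is \<phi>"

definition test_function :: "(real ^ ('d::finite)) set \<Rightarrow> (real ^ 'd \<Rightarrow> 'b::real_normed_vector) \<Rightarrow> bool"
  where "test_function D \<phi> \<longleftrightarrow>
    (\<forall>is x. partials is \<phi> differentiable (at x)) \<and>
    (\<exists>K. compact K \<and> K \<subseteq> D \<and> (\<forall>x. x \<notin> K \<longrightarrow> \<phi> x = 0))"

definition weak_derivative ::
  "(real ^ 'd) set \<Rightarrow> ('d::finite) list \<Rightarrow> 'd field \<Rightarrow> 'd field \<Rightarrow> bool" where
  "weak_derivative D is w z \<longleftrightarrow>
    (\<forall>\<phi> :: real ^ 'd \<Rightarrow> real. test_function D \<phi> \<longrightarrow>
       (LINT x:D|lborel. partials is \<phi> x *\<^sub>R w x) =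
       (- 1) ^ length is *\<^sub>R (LINT x:D|lborel. \<phi> x *\<^sub>R z x))"

definition Sobolev_space :: "nat \<Rightarrow> (real ^ 'd) set \<Rightarrow> ('d::finite) field set" where
  "Sobolev_space m D = {w \<in> L2_space D.
     \<forall>is. length is \<le> m \<longrightarrow> (\<exists>z \<in> L2_space D. weak_derivative D is w z)}"

text \<open>The norm of the tensor of all weak derivatives of order \<open>m\<close>. Weak derivatives are determined
  only up to null sets and all versions have the same norm; the infimum merely selects this common
  value.\<close>

definition weak_norm :: "nat \<Rightarrow> (real ^ 'd) set \<Rightarrow> ('d::finite) field \<Rightarrow> real" where
  "weak_norm m D w = Inf {sqrt (\<Sum>is | length is = m. (L2_norm D (G is))\<^sup>2) | G.
     \<forall>is. length is = m \<longrightarrow> G is \<in> L2_space D \<and> weak_derivative D is w (G is)}"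

definition H2_norm :: "(real ^ 'd) set \<Rightarrow> ('d::finite) field \<Rightarrow> real" where
  "H2_norm D w = L2_norm D w + weak_norm 1 D w + weak_norm 2 D w"

definition H10_space :: "(real ^ 'd) set \<Rightarrow> ('d::finite) field set" where
  "H10_space D = {w \<in> Sobolev_space 1 D. \<exists>\<phi> :: nat \<Rightarrow> 'd field. (\<forall>n. test_function D (\<phi> n)) \<and>
     (\<lambda>n. L2_norm D (\<lambda>x. w x - \<phi> n x) + weak_norm 1 D (\<lambda>x. w x - \<phi> n x)) \<longlonglongrightarrow> 0}"

definition W_space :: "(real ^ 'd) set \<Rightarrow> ('d::finite) field set" where
  "W_space D = Sobolev_space 2 D \<inter> H10_space D"

text \<open>\<open>z\<close> is the time derivative of the curve \<open>w\<close> on \<open>[0, T]\<close> with respect to the \<open>H\<^sup>2\<close> norm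
  (one-sided at the end points).\<close>

definition has_time_derivative ::
  "(real ^ 'd) set \<Rightarrow> real \<Rightarrow> (real \<Rightarrow> ('d::finite) field) \<Rightarrow> (real \<Rightarrow> 'd field) \<Rightarrow> bool" where
  "has_time_derivative D T w z \<longleftrightarrow> (\<forall>t\<in>{0..T}.
     ((\<lambda>s. H2_norm D (\<lambda>x. (w s x - w t x) /\<^sub>R (s - t) - z t x)) \<longlongrightarrow> 0) (at t within {0..T}))"

definition time_continuous ::
  "(real ^ 'd) set \<Rightarrow> real \<Rightarrow> (real \<Rightarrow> ('d::finite) field) \<Rightarrow> bool" where
  "time_continuous D T w \<longleftrightarrow> (\<forall>t\<in>{0..T}.
     ((\<lambda>s. H2_norm D (\<lambda>x. w s x - w t x)) \<longlongrightarrow> 0) (at t within {0..T}))"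

text \<open>\<open>w\<close> belongs to \<open>C\<^sup>2([0, T]; W)\<close> and has first and second time derivatives \<open>w1\<close> and \<open>w2\<close>.\<close>

definition C2_curve ::
  "(real ^ 'd) set \<Rightarrow> real \<Rightarrow> (real \<Rightarrow> ('d::finite) field) \<Rightarrow> (real \<Rightarrow> 'd field) \<Rightarrow> (real \<Rightarrow> 'd field) \<Rightarrow> bool"
  where "C2_curve D T w w1 w2 \<longleftrightarrow>
    (\<forall>t\<in>{0..T}. w t \<in> W_space D \<and> w1 t \<in> W_space D \<and> w2 t \<in> W_space D) \<and>
    has_time_derivative D T w w1 \<and> has_time_derivative D T w1 w2 \<and> time_continuous D T w2"

section \<open>The peridynamic model\<close>

text \<open>Locally, \<open>D\<close> lies above the graph of a \<open>C\<^sup>1\<close> function: \<open>\<nu>\<close> is the vertical direction, and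
  \<open>\<gamma>\<close> depends only on the components orthogonal to it.\<close>

definition C1_boundary :: "(real ^ ('d::finite)) set \<Rightarrow> bool" where
  "C1_boundary D \<longleftrightarrow> (\<forall>p \<in> frontier D. \<exists>r>0. \<exists>\<nu> \<gamma>. norm \<nu> = 1 \<and>
     (\<forall>x. \<gamma> differentiable (at x)) \<and> (\<forall>i. continuous_on UNIV (partial i \<gamma>)) \<and>
     (\<forall>x s. \<gamma> (x + s *\<^sub>R \<nu>) = \<gamma> x) \<and>
     D \<inter> ball p r = {x \<in> ball p r. x \<bullet> \<nu> > (\<gamma> x :: real)})"

definition influence_function :: "real \<Rightarrow> (real \<Rightarrow> real) \<Rightarrow> bool" where
  "influence_function M J \<longleftrightarrow> J \<in> borel_measurable borel \<and>
     (\<forall>r. 0 \<le> r \<and> r < 1 \<longrightarrow> 0 \<le> J r \<and> J r \<le> M) \<and> (\<forall>r\<ge>1. J r = 0)"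

text \<open>Being 1 in the interior means being 1 at all points whose distance to the boundary is at
  least some \<open>\<delta> > 0\<close>. Continuity on the whole space expresses the decay to 0 at the boundary.\<close>

definition boundary_function :: "(real ^ ('d::finite)) set \<Rightarrow> (real ^ 'd \<Rightarrow> real) \<Rightarrow> bool" where
  "boundary_function D \<omega> \<longleftrightarrow>
     (\<forall>x. 0 \<le> \<omega> x \<and> \<omega> x \<le> 1) \<and> (\<forall>x. x \<notin> D \<longrightarrow> \<omega> x = 0) \<and>
     (\<exists>\<delta>>0. \<forall>x\<in>D. (\<forall>p\<in>frontier D. \<delta> \<le> dist x p) \<longrightarrow> \<omega> x = 1) \<and>
     continuous_on UNIV \<omega> \<and>
     (\<forall>x\<in>D. \<omega> differentiable (at x)) \<and> (\<forall>i. \<forall>x\<in>D. partial i \<omega> differentiable (at x)) \<and>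
     (\<forall>i j. continuous_on D (partials [i, j] \<omega>)) \<and>
     (\<forall>i. bounded (partial i \<omega> ` D)) \<and> (\<forall>i j. bounded (partials [i, j] \<omega> ` D))"

definition convex_concave_potential :: "(real \<Rightarrow> real) \<Rightarrow> bool" where
  "convex_concave_potential f \<longleftrightarrow>
     (\<forall>i<4. \<forall>r. (deriv ^^ i) f differentiable (at r)) \<and>
     (\<forall>i\<le>4. bounded (range ((deriv ^^ i) f))) \<and>
     (\<forall>r. f 0 \<le> f r) \<and>
     (\<exists>r1 r2. r1 < 0 \<and> 0 < r2 \<and>
        convex_on {r1..r2} f \<and> concave_on {..r1} f \<and> concave_on {r2..} f)"

definition quadratic_potential :: "(real \<Rightarrow> real) \<Rightarrow> bool" where
  "quadratic_potential g \<longleftrightarrow> (\<exists>\<beta>>0. g = (\<lambda>r. \<beta> * r\<^sup>2 / 2))"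

definition potential_const :: "nat \<Rightarrow> (real \<Rightarrow> real) \<Rightarrow> real" where
  "potential_const i f = (SUP r. \<bar>(deriv ^^ i) f r\<bar>)"

definition unit_ball_volume :: "('d::finite) itself \<Rightarrow> real" where
  "unit_ball_volume _ = measure lborel (ball (0 :: real ^ 'd) 1)"

definition J_bar :: "('d::finite) itself \<Rightarrow> (real \<Rightarrow> real) \<Rightarrow> real \<Rightarrow> real" where
  "J_bar d J \<alpha> = 1 / unit_ball_volume d *
     (LINT \<xi>:ball (0 :: real ^ 'd) 1|lborel. J (norm \<xi>) * norm \<xi> powr (- \<alpha>))"

definition lipschitz_const ::
  "('d::finite) itself \<Rightarrow> (real \<Rightarrow> real) \<Rightarrow> (real \<Rightarrow> real) \<Rightarrow> (real \<Rightarrow> real) \<Rightarrow> real" where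
  "lipschitz_const d J f g = 4 * (potential_const 2 f * J_bar d J 1 +
     (if quadratic_potential g then deriv (deriv g) 0 else potential_const 2 g) * (J_bar d J 0)\<^sup>2)"

definition strain :: "real ^ ('d::finite) \<Rightarrow> real ^ 'd \<Rightarrow> 'd field \<Rightarrow> real" where
  "strain y x u = ((u y - u x) /\<^sub>R norm (y - x)) \<bullet> sgn (y - x)"

definition dilatation ::
  "real \<Rightarrow> (real ^ ('d::finite) \<Rightarrow> real) \<Rightarrow> (real \<Rightarrow> real) \<Rightarrow> 'd field \<Rightarrow> real ^ 'd \<Rightarrow> real" where
  "dilatation \<epsilon> \<omega> J u x = 1 / (\<epsilon> ^ CARD('d) * unit_ball_volume TYPE('d)) *
     (LINT y:ball x \<epsilon>|lborel. \<omega> y * J (norm (y - x) / \<epsilon>) * strain y x u * norm (y - x))"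

definition tensile_force :: "real \<Rightarrow> (real ^ ('d::finite) \<Rightarrow> real) \<Rightarrow> (real \<Rightarrow> real) \<Rightarrow>
    (real \<Rightarrow> real) \<Rightarrow> 'd field \<Rightarrow> 'd field" where
  "tensile_force \<epsilon> \<omega> J f u x = (2 / (\<epsilon> ^ (CARD('d) + 1) * unit_ball_volume TYPE('d))) *\<^sub>R
     (LINT y:ball x \<epsilon>|lborel.
        (\<omega> x * \<omega> y * (J (norm (y - x) / \<epsilon>) / sqrt (norm (y - x))) *
         deriv f (sqrt (norm (y - x)) * strain y x u)) *\<^sub>R sgn (y - x))"

definition dilatational_force :: "real \<Rightarrow> (real ^ ('d::finite) \<Rightarrow> real) \<Rightarrow> (real \<Rightarrow> real) \<Rightarrow>
    (real \<Rightarrow> real) \<Rightarrow> 'd field \<Rightarrow> 'd field" where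
  "dilatational_force \<epsilon> \<omega> J g u x = (1 / (\<epsilon> ^ CARD('d) * unit_ball_volume TYPE('d))) *\<^sub>R
     (LINT y:ball x \<epsilon>|lborel.
        (\<omega> x * \<omega> y * (J (norm (y - x) / \<epsilon>) / \<epsilon>\<^sup>2) *
         (deriv g (dilatation \<epsilon> \<omega> J u y) + deriv g (dilatation \<epsilon> \<omega> J u x))) *\<^sub>R sgn (y - x))"

definition peridynamic_force :: "real \<Rightarrow> (real ^ ('d::finite) \<Rightarrow> real) \<Rightarrow> (real \<Rightarrow> real) \<Rightarrow>
    (real \<Rightarrow> real) \<Rightarrow> (real \<Rightarrow> real) \<Rightarrow> 'd field \<Rightarrow> 'd field" where
  "peridynamic_force \<epsilon> \<omega> J f g u x =
     tensile_force \<epsilon> \<omega> J f u x + dilatational_force \<epsilon> \<omega> J g u x"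

section \<open>Finite elements\<close>

text \<open>The library's \<^const>\<open>triangulation\<close> supplies finiteness and conformity. The simplices cover a
  polyhedron inside the closure of \<open>D\<close> and need not fill it: a bounded nonempty domain with
  \<open>C\<^sup>1\<close> boundary is never a polyhedron. How well they fill \<open>D\<close> enters through the projection
  estimate.\<close>

definition conforming_mesh :: "(real ^ ('d::finite)) set \<Rightarrow> (real ^ 'd) set set \<Rightarrow> bool" where
  "conforming_mesh D \<T> \<longleftrightarrow> \<T> \<noteq> {} \<and> triangulation \<T> \<and>
     (\<forall>K\<in>\<T>. int CARD('d) simplex K) \<and> \<Union>\<T> \<subseteq> closure D"

definition mesh_size :: "(real ^ ('d::finite)) set set \<Rightarrow> real" where
  "mesh_size \<T> = Max (diameter ` \<T>)"

definition shape_regular :: "real \<Rightarrow> (real ^ ('d::finite)) set set \<Rightarrow> bool" where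
  "shape_regular \<kappa> \<T> \<longleftrightarrow> (\<forall>K\<in>\<T>. \<exists>x. cball x (diameter K / \<kappa>) \<subseteq> K)"

definition fe_space :: "(real ^ 'd) set \<Rightarrow> (real ^ 'd) set set \<Rightarrow> ('d::finite) field set" where
  "fe_space D \<T> = {w \<in> H10_space D. continuous_on UNIV w \<and> (\<forall>x. x \<notin> \<Union>\<T> \<longrightarrow> w x = 0) \<and>
     (\<forall>K\<in>\<T>. \<exists>A a. linear A \<and> (\<forall>x\<in>K. w x = A x + a))}"

definition L2_projection ::
  "(real ^ 'd) set \<Rightarrow> ('d::finite) field set \<Rightarrow> ('d field \<Rightarrow> 'd field) \<Rightarrow> bool" where
  "L2_projection D V r \<longleftrightarrow> (\<forall>w \<in> L2_space D. r w \<in> V \<and> (\<forall>z\<in>V. L2_inner D (r w) z = L2_inner D w z))"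

section \<open>The central difference scheme\<close>

definition position_eq ::
  "(real ^ 'd) set \<Rightarrow> ('d::finite) field set \<Rightarrow> real \<Rightarrow> (nat \<Rightarrow> 'd field) \<Rightarrow> (nat \<Rightarrow> 'd field) \<Rightarrow> nat \<Rightarrow> bool"
  where "position_eq D V dt uh vh k \<longleftrightarrow> (\<forall>z\<in>V.
     L2_inner D (\<lambda>x. (uh (k + 1) x - uh k x) /\<^sub>R dt) z = L2_inner D (vh (k + 1)) z)"

definition velocity_eq :: "(real ^ 'd) set \<Rightarrow> ('d::finite) field set \<Rightarrow> ('d field \<Rightarrow> 'd field) \<Rightarrow>
    (nat \<Rightarrow> 'd field) \<Rightarrow> real \<Rightarrow> (nat \<Rightarrow> 'd field) \<Rightarrow> (nat \<Rightarrow> 'd field) \<Rightarrow> nat \<Rightarrow> bool"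
  where "velocity_eq D V F bh dt uh vh k \<longleftrightarrow> (\<forall>z\<in>V.
     L2_inner D (\<lambda>x. (vh (k + 1) x - vh k x) /\<^sub>R dt) z =
     L2_inner D (F (uh k)) z + L2_inner D (bh k) z)"

definition central_difference_eq :: "(real ^ 'd) set \<Rightarrow> ('d::finite) field set \<Rightarrow>
    ('d field \<Rightarrow> 'd field) \<Rightarrow> (nat \<Rightarrow> 'd field) \<Rightarrow> real \<Rightarrow> (nat \<Rightarrow> 'd field) \<Rightarrow> nat \<Rightarrow> bool"
  where "central_difference_eq D V F bh dt uh k \<longleftrightarrow> (\<forall>z\<in>V.
     L2_inner D (\<lambda>x. (uh (k + 1) x - 2 *\<^sub>R uh k x + uh (k - 1) x) /\<^sub>R dt\<^sup>2) z =
     L2_inner D (F (uh k)) z + L2_inner D (bh k) z)"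

definition starting_eq :: "(real ^ 'd) set \<Rightarrow> ('d::finite) field set \<Rightarrow> ('d field \<Rightarrow> 'd field) \<Rightarrow>
    (nat \<Rightarrow> 'd field) \<Rightarrow> real \<Rightarrow> (nat \<Rightarrow> 'd field) \<Rightarrow> (nat \<Rightarrow> 'd field) \<Rightarrow> bool"
  where "starting_eq D V F bh dt uh vh \<longleftrightarrow> (\<forall>z\<in>V.
     L2_inner D (\<lambda>x. (uh 1 x - uh 0 x) /\<^sub>R dt\<^sup>2) z =
     1 / 2 * L2_inner D (F (uh 0)) z + 1 / dt * L2_inner D (vh 0) z + 1 / 2 * L2_inner D (bh 0) z)"

text \<open>The steps are those that stay within \<open>[0, T]\<close>, where the body force is given. Combining the
  two equations into the central difference equation at \<open>k = 1\<close> uses the position equation at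
  \<open>k = 0\<close>, which therefore belongs to the scheme; it also determines \<open>vh 1\<close> from the starting
  equation. The velocity equation at \<open>k = 0\<close> is an alternative to the starting equation: the two
  differ by the factor \<open>1 / 2\<close> in the load and are incompatible unless that load vanishes. Starting with the halved load causes a single
  velocity error of order \<open>dt\<close> in the first step; it is not weighted by another \<open>dt\<close>, so that
  it does not become small with \<open>T\<close>.\<close>

definition fe_solution :: "(real ^ 'd) set \<Rightarrow> ('d::finite) field set \<Rightarrow> ('d field \<Rightarrow> 'd field) \<Rightarrow>
    (nat \<Rightarrow> 'd field) \<Rightarrow> real \<Rightarrow> real \<Rightarrow> 'd field \<Rightarrow> 'd field \<Rightarrow>
    (nat \<Rightarrow> 'd field) \<Rightarrow> (nat \<Rightarrow> 'd field) \<Rightarrow> bool"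
  where "fe_solution D V F bh T dt uh0 vh0 uh vh \<longleftrightarrow>
     (\<forall>k. real k * dt \<le> T \<longrightarrow> uh k \<in> V \<and> vh k \<in> V) \<and>
     uh 0 = uh0 \<and> vh 0 = vh0 \<and>
     (\<forall>k. real (k + 1) * dt \<le> T \<longrightarrow> position_eq D V dt uh vh k) \<and>
     (\<forall>k\<ge>1. real (k + 1) * dt \<le> T \<longrightarrow> velocity_eq D V F bh dt uh vh k) \<and>
     (dt \<le> T \<longrightarrow> starting_eq D V F bh dt uh vh \<or> velocity_eq D V F bh dt uh vh 0)"

text \<open>Here \<open>v\<close> and \<open>a\<close> are the first and second time derivatives of \<open>u\<close>.\<close>

definition consistency_error :: "(real ^ 'd) set \<Rightarrow> (('d::finite) field \<Rightarrow> 'd field) \<Rightarrow>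
    ('d field \<Rightarrow> 'd field) \<Rightarrow> real \<Rightarrow> real \<Rightarrow>
    (real \<Rightarrow> 'd field) \<Rightarrow> (real \<Rightarrow> 'd field) \<Rightarrow> (real \<Rightarrow> 'd field) \<Rightarrow> real"
  where "consistency_error D F r T dt u v a =
    (let t = (\<lambda>k::nat. real k * dt) in
     SUP k\<in>{k. t (k + 1) \<le> T}.
       L2_norm D (\<lambda>x. v (t (k + 1)) x - (u (t (k + 1)) x - u (t k) x) /\<^sub>R dt) +
       L2_norm D (\<lambda>x. a (t k) x - (v (t (k + 1)) x - v (t k) x) /\<^sub>R dt) +
       L2_norm D (\<lambda>x. F (r (u (t k))) x - F (u (t k)) x))"

definition fe_error :: "(real ^ 'd) set \<Rightarrow> real \<Rightarrow> (real \<Rightarrow> ('d::finite) field) \<Rightarrow> (real \<Rightarrow> 'd field) \<Rightarrow>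
    (nat \<Rightarrow> 'd field) \<Rightarrow> (nat \<Rightarrow> 'd field) \<Rightarrow> nat \<Rightarrow> real"
  where "fe_error D dt u v uh vh k =
     L2_norm D (\<lambda>x. uh k x - u (real k * dt) x) + L2_norm D (\<lambda>x. vh k x - v (real k * dt) x)"

definition projected_error :: "(real ^ 'd) set \<Rightarrow> (('d::finite) field \<Rightarrow> 'd field) \<Rightarrow> real \<Rightarrow>
    (real \<Rightarrow> 'd field) \<Rightarrow> (real \<Rightarrow> 'd field) \<Rightarrow> (nat \<Rightarrow> 'd field) \<Rightarrow> (nat \<Rightarrow> 'd field) \<Rightarrow> nat \<Rightarrow> real"
  where "projected_error D r dt u v uh vh k =
     L2_norm D (\<lambda>x. r (u (real k * dt)) x - uh k x) + L2_norm D (\<lambda>x. r (v (real k * dt)) x - vh k x)"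

end

theory Submission
  imports Defs
begin

text \<open>Three facts make the scheme converge.

  First, the force is Lipschitz continuous in \<open>L\<^sup>2\<close> with constant \<open>L / \<epsilon>\<^sup>2\<close>. Tensile force, dilatation and
  dilatational force are all integrals whose integrand is bounded by \<open>k(y - x) (\<phi>(y) + \<phi>(x))\<close> with
  an even integrable kernel \<open>k\<close>, and by the Schur test such an operator has norm at most \<open>2 \<integral>k\<close>
  (\<open>Schur_integral_operator\<close>). Scaling reduces the masses of the kernels to the moments of the
  influence function (\<open>influence_kernel_integral\<close>); the first moment is finite because \<open>1 / |\<xi>|\<close> is
  integrable in dimension at least two. The result is \<open>peridynamic_force_lipschitz\<close>. Together with
  the projection estimate it bounds the error of the force by \<open>C\<^sub>s h\<^sup>2 / \<epsilon>\<^sup>2\<close>.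

  Second, the difference quotients in time are first-order accurate. Pairing the curves with a fixed
  field turns this into Taylor's formula for real functions, and the truncation error is
  tested with itself (\<open>difference_quotient_error\<close>). The constant \<open>1/2\<close> of Taylor's formula is kept.

  Third, the scheme is stable. Subtracting the discrete equations from the exact ones and testing
  with the errors themselves, which are combinations of finite element functions, yields for the
  projected error \<open>e\<^sup>k\<close> the recursion
  \<open>(1 - dt) e\<^sup>k\<^sup>+\<^sup>1 \<le> (1 + dt L / \<epsilon>\<^sup>2) e\<^sup>k + dt s\<^sup>k\<close> (\<open>total_error_step\<close>), and a discrete
  Gronwall inequality finishes the estimate (\<open>stability\<close>). If the computation begins with the
  starting equation, which contains only half of the load, then the first source has the
  additional term \<open>sup |a| / 2\<close>; the factors \<open>1/2\<close> saved above absorb it, at the price of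
  replacing \<open>T\<close> by \<open>max 1 T\<close> in front of the sources.

  The total error exceeds the projected error by at most the projection error \<open>C\<^sub>p h\<^sup>2\<close>. For the
  statement on its order, \<open>C\<^sub>p h\<^sup>2\<close> must be bounded by a multiple of \<open>C\<^sub>s h\<^sup>2 / \<epsilon>\<^sup>2\<close>. This is
  immediate unless \<open>C\<^sub>s = 0\<close>; for \<open>L > 0\<close> the latter means that \<open>u\<close> has norm zero at all times,
  and then so does \<open>v\<close> (\<open>time_derivative_of_null_curve\<close>).\<close>

section \<open>The space of square integrable fields\<close>

lemma L2_spaceD:
  assumes "w \<in> L2_space D"
  shows "w \<in> borel_measurable borel" "\<And>x. x \<notin> D \<Longrightarrow> w x = 0"
    "integrable lborel (\<lambda>x. (norm (w x))\<^sup>2)"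
  using assms by (auto simp: L2_space_def)

lemma L2_space_inner_integrable:
  fixes w z :: "('d::finite) field"
  assumes "w \<in> L2_space D" "z \<in> L2_space D"
  shows "integrable lborel (\<lambda>x. w x \<bullet> z x)"
proof (rule Bochner_Integration.integrable_bound)
  note [measurable] = L2_spaceD(1)[OF assms(1)] L2_spaceD(1)[OF assms(2)]
  show "integrable lborel (\<lambda>x. (norm (w x))\<^sup>2 + (norm (z x))\<^sup>2)"
    using assms by (intro Bochner_Integration.integrable_add L2_spaceD(3))
  show "(\<lambda>x. w x \<bullet> z x) \<in> borel_measurable lborel" by measurable
  have "\<bar>p \<bullet> q\<bar> \<le> (norm p)\<^sup>2 + (norm q)\<^sup>2" for p q :: "real ^ 'd"
    using Cauchy_Schwarz_ineq2[of p q] sum_squares_bound[of "norm p" "norm q"]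
      mult_nonneg_nonneg[of "norm p" "norm q"] by simp
  then show "AE x in lborel. norm (w x \<bullet> z x) \<le> norm ((norm (w x))\<^sup>2 + (norm (z x))\<^sup>2)"
    by (intro AE_I2) simp
qed

lemma L2_inner_altdef:
  assumes "w \<in> L2_space D"
  shows "L2_inner D w z = (LINT x|lborel. w x \<bullet> z x)"
proof -
  have "(\<lambda>x. indicator D x *\<^sub>R (w x \<bullet> z x)) = (\<lambda>x. w x \<bullet> z x)"
    using L2_spaceD(2)[OF assms] by (auto simp: indicator_def fun_eq_iff)
  then show ?thesis by (simp add: L2_inner_def set_lebesgue_integral_def)
qed

lemma L2_space_scaleR:
  assumes "w \<in> L2_space D" shows "(\<lambda>x. s *\<^sub>R w x) \<in> L2_space D"
  using assms unfolding L2_space_def by (auto simp: power_mult_distrib)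

lemma L2_space_add:
  fixes w z :: "('d::finite) field"
  assumes "w \<in> L2_space D" "z \<in> L2_space D"
  shows "(\<lambda>x. w x + z x) \<in> L2_space D"
proof -
  note [measurable] = L2_spaceD(1)[OF assms(1)] L2_spaceD(1)[OF assms(2)]
  have "(norm (w x + z x))\<^sup>2 = (norm (w x))\<^sup>2 + 2 * (w x \<bullet> z x) + (norm (z x))\<^sup>2" for x
    by (simp add: power2_norm_eq_inner algebra_simps inner_commute)
  moreover have "integrable lborel (\<lambda>x. (norm (w x))\<^sup>2 + 2 * (w x \<bullet> z x) + (norm (z x))\<^sup>2)"
    using assms by (intro Bochner_Integration.integrable_add integrable_mult_right
        L2_space_inner_integrable L2_spaceD(3))
  ultimately have "integrable lborel (\<lambda>x. (norm (w x + z x))\<^sup>2)" by simp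
  moreover have "(\<lambda>x. w x + z x) \<in> borel_measurable borel" by measurable
  ultimately show ?thesis
    using L2_spaceD(2)[OF assms(1)] L2_spaceD(2)[OF assms(2)] by (auto simp: L2_space_def)
qed

lemma L2_space_diff:
  assumes "w \<in> L2_space D" "z \<in> L2_space D"
  shows "(\<lambda>x. w x - z x) \<in> L2_space D"
  using L2_space_add[OF assms(1) L2_space_scaleR[OF assms(2), of "-1"]] by simp

lemma L2_inner_commute: "L2_inner D w z = L2_inner D z w"
  by (simp add: L2_inner_def inner_commute)

lemma L2_inner_scaleR_left:
  "L2_inner D (\<lambda>x. s *\<^sub>R w x) z = s * L2_inner D w z"
  by (simp add: L2_inner_def)

lemma L2_inner_scaleR_right:
  "L2_inner D z (\<lambda>x. s *\<^sub>R w x) = s * L2_inner D z w"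
  by (simp add: L2_inner_def)

lemma L2_inner_add_left:
  assumes "w \<in> L2_space D" "w' \<in> L2_space D" "z \<in> L2_space D"
  shows "L2_inner D (\<lambda>x. w x + w' x) z = L2_inner D w z + L2_inner D w' z"
  using assms by (simp add: L2_inner_altdef L2_space_add L2_space_inner_integrable inner_add_left)

lemma L2_inner_diff_left:
  assumes "w \<in> L2_space D" "w' \<in> L2_space D" "z \<in> L2_space D"
  shows "L2_inner D (\<lambda>x. w x - w' x) z = L2_inner D w z - L2_inner D w' z"
  using assms by (simp add: L2_inner_altdef L2_space_diff L2_space_inner_integrable inner_diff_left)

lemma L2_inner_add_right:
  assumes "w \<in> L2_space D" "w' \<in> L2_space D" "z \<in> L2_space D"
  shows "L2_inner D z (\<lambda>x. w x + w' x) = L2_inner D z w + L2_inner D z w'"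
  using L2_inner_add_left[OF assms] by (simp add: L2_inner_commute)

lemma L2_inner_diff_right:
  assumes "w \<in> L2_space D" "w' \<in> L2_space D" "z \<in> L2_space D"
  shows "L2_inner D z (\<lambda>x. w x - w' x) = L2_inner D z w - L2_inner D z w'"
  using L2_inner_diff_left[OF assms] by (simp add: L2_inner_commute)

lemma L2_inner_self_nonneg: "0 \<le> L2_inner D w w"
  unfolding L2_inner_def set_lebesgue_integral_def
  by (intro Bochner_Integration.integral_nonneg) simp

lemma L2_norm_nonneg [simp]: "0 \<le> L2_norm D w"
  by (simp add: L2_norm_def L2_inner_self_nonneg)

lemma L2_norm_power2: "(L2_norm D w)\<^sup>2 = L2_inner D w w"
  by (simp add: L2_norm_def L2_inner_self_nonneg)

lemma L2_norm_scaleR: "L2_norm D (\<lambda>x. s *\<^sub>R w x) = \<bar>s\<bar> * L2_norm D w"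
proof -
  have "L2_inner D (\<lambda>x. s *\<^sub>R w x) (\<lambda>x. s *\<^sub>R w x) = s\<^sup>2 * L2_inner D w w"
    by (simp add: L2_inner_scaleR_left L2_inner_scaleR_right power2_eq_square)
  then show ?thesis by (simp add: L2_norm_def real_sqrt_mult)
qed

lemma L2_norm_minus_commute: "L2_norm D (\<lambda>x. w x - z x) = L2_norm D (\<lambda>x. z x - w x)"
  using L2_norm_scaleR[of D "-1" "\<lambda>x. w x - z x"] by simp

text \<open>For \<open>C > 0\<close> the inequality at the minimum point \<open>t = - B / C\<close> is the claim. For \<open>C = 0\<close> the
  affine function \<open>A + 2 t B\<close> is bounded below only if \<open>B = 0\<close>.\<close>

lemma nonneg_quadratic_discriminant:
  fixes A B C :: real
  assumes quad: "\<And>t. 0 \<le> A + 2 * t * B + t\<^sup>2 * C" and C: "C \<ge> 0"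
  shows "B\<^sup>2 \<le> A * C"
proof (cases "C = 0")
  case True
  have "B = 0"
  proof (rule ccontr)
    assume "B \<noteq> 0"
    then have "2 * (- (A + 1) / (2 * B)) * B = - (A + 1)" by simp
    then show False
      using quad[of "- (A + 1) / (2 * B)"] True by simp
  qed
  then show ?thesis using True by simp
next
  case False
  then have C: "C > 0" using C by linarith
  have "0 \<le> C * (A + 2 * (- B / C) * B + (- B / C)\<^sup>2 * C)"
    using quad[of "- B / C"] C by (intro mult_nonneg_nonneg) auto
  also have "\<dots> = A * C - B\<^sup>2"
    using C by (simp add: field_simps power2_eq_square)
  finally show ?thesis by simp
qed

lemma L2_Cauchy_Schwarz:
  assumes w: "w \<in> L2_space D" and z: "z \<in> L2_space D"
  shows "\<bar>L2_inner D w z\<bar> \<le> L2_norm D w * L2_norm D z"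
proof -
  let ?A = "L2_inner D w w" and ?B = "L2_inner D w z" and ?C = "L2_inner D z z"
  have quad: "0 \<le> ?A + 2 * t * ?B + t\<^sup>2 * ?C" for t
  proof -
    note tz = L2_space_scaleR[OF z, of t]
    have "L2_inner D (\<lambda>x. w x + t *\<^sub>R z x) (\<lambda>x. w x + t *\<^sub>R z x)
        = ?A + t * ?B + (t * L2_inner D z w + t * (t * ?C))"
      using L2_inner_add_left[OF w tz L2_space_add[OF w tz]] L2_inner_add_right[OF w tz w]
        L2_inner_add_right[OF w tz tz]
      by (simp only: L2_inner_scaleR_left L2_inner_scaleR_right)
    also have "\<dots> = ?A + 2 * t * ?B + t\<^sup>2 * ?C"
      using L2_inner_commute[of D z w] by (simp add: power2_eq_square)
    finally show ?thesis
      using L2_inner_self_nonneg[of D "\<lambda>x. w x + t *\<^sub>R z x"] by linarith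
  qed
  have "?B\<^sup>2 \<le> ?A * ?C"
    by (rule nonneg_quadratic_discriminant[OF quad L2_inner_self_nonneg])
  then have "sqrt (?B\<^sup>2) \<le> sqrt (?A * ?C)" by (rule real_sqrt_le_mono)
  then show ?thesis by (simp add: L2_norm_def real_sqrt_mult)
qed

lemma L2_norm_triangle:
  assumes w: "w \<in> L2_space D" and z: "z \<in> L2_space D"
  shows "L2_norm D (\<lambda>x. w x + z x) \<le> L2_norm D w + L2_norm D z"
proof (rule power2_le_imp_le)
  have "(L2_norm D (\<lambda>x. w x + z x))\<^sup>2
      = L2_inner D w w + L2_inner D w z + (L2_inner D z w + L2_inner D z z)"
    unfolding L2_norm_power2
    using L2_inner_add_left[OF w z L2_space_add[OF w z]] L2_inner_add_right[OF w z w]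
        L2_inner_add_right[OF w z z] by simp
  also have "\<dots> \<le> (L2_norm D w + L2_norm D z)\<^sup>2"
    using L2_Cauchy_Schwarz[OF w z] unfolding L2_inner_commute[of D z w]
    by (simp add: power2_sum L2_norm_power2)
  finally show "(L2_norm D (\<lambda>x. w x + z x))\<^sup>2 \<le> (L2_norm D w + L2_norm D z)\<^sup>2" .
qed simp

lemma L2_norm_triangle_diff:
  assumes "w \<in> L2_space D" and "z \<in> L2_space D"
  shows "L2_norm D (\<lambda>x. w x - z x) \<le> L2_norm D w + L2_norm D z"
  using L2_norm_triangle[OF assms(1) L2_space_scaleR[OF assms(2), of "-1"]] L2_norm_scaleR[of D "-1" z] by simp

lemma L2_norm_triangle_three:
  assumes "w1 \<in> L2_space D" "w2 \<in> L2_space D" "w3 \<in> L2_space D"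
  shows "L2_norm D (\<lambda>x. w1 x - w3 x) \<le> L2_norm D (\<lambda>x. w1 x - w2 x) + L2_norm D (\<lambda>x. w2 x - w3 x)"
  using L2_norm_triangle[of "\<lambda>x. w1 x - w2 x" D "\<lambda>x. w2 x - w3 x"] assms by (simp add: L2_space_diff)

text \<open>Duality: \<open>L\<^sup>2\<close> norms can be estimated by testing, so that vector-valued statements reduce to
  scalar ones.\<close>

lemma L2_norm_le_by_testing:
  assumes "L2_inner D w w \<le> B * L2_norm D w" "B \<ge> 0"
  shows "L2_norm D w \<le> B"
proof (rule ccontr)
  assume "\<not> ?thesis"
  then have "B * L2_norm D w < (L2_norm D w)\<^sup>2"
    using assms(2) by (simp add: power2_eq_square mult_strict_right_mono)
  then show False using assms(1) by (simp add: L2_norm_power2)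
qed

lemma L2_norm_eq_integral:
  assumes "w \<in> L2_space D"
  shows "(L2_norm D w)\<^sup>2 = (LINT x|lborel. (norm (w x))\<^sup>2)"
  by (simp add: L2_norm_power2 L2_inner_altdef[OF assms] power2_norm_eq_inner)

section \<open>The Schur test\<close>

lemma nn_integral_lborel_translate:
  fixes f :: "'a::euclidean_space \<Rightarrow> ennreal"
  assumes [measurable]: "f \<in> borel_measurable borel"
  shows "(\<integral>\<^sup>+ y. f (y - x) \<partial>lborel) = (\<integral>\<^sup>+ y. f y \<partial>lborel)"
proof -
  have "(\<integral>\<^sup>+ y. f y \<partial>lborel) = (\<integral>\<^sup>+ y. f y \<partial>distr lborel borel ((+) (- x)))"
    by (simp only: lborel_distr_plus)
  also have "\<dots> = (\<integral>\<^sup>+ y. f (- x + y) \<partial>lborel)"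
    by (rule nn_integral_distr) auto
  finally show ?thesis by simp
qed

lemma ennreal_sum_square_le:
  fixes a b :: ennreal
  shows "(a + b)\<^sup>2 \<le> 2 * (a\<^sup>2 + b\<^sup>2)"
proof (cases a b rule: ennreal2_cases)
  case (real_real r s)
  have "(r + s)\<^sup>2 \<le> 2 * (r\<^sup>2 + s\<^sup>2)"
    using sum_squares_bound[of r s] by (simp add: power2_sum)
  then have "ennreal ((r + s)\<^sup>2) \<le> ennreal (2 * (r\<^sup>2 + s\<^sup>2))" by (rule ennreal_leI)
  also have "\<dots> = 2 * (ennreal r ^ 2 + ennreal s ^ 2)"
    using real_real by (simp add: ennreal_mult ennreal_power)
  also have "ennreal ((r + s)\<^sup>2) = (ennreal r + ennreal s) ^ 2"
    using real_real by (simp add: ennreal_power flip: ennreal_plus)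
  finally show ?thesis using real_real by simp
qed (auto simp: ennreal_mult_top power2_eq_square)

text \<open>The Schur test for a convolution kernel, in the form in which it meets differences
  \<open>u(y) - u(x)\<close>. Cauchy--Schwarz with respect to the measure \<open>k(y - x) dy\<close> costs a factor
  \<open>\<integral>k\<close>; Tonelli and translation invariance give another one, and each of the two terms
  contributes equally because the kernel is even.\<close>

lemma Schur_test:
  fixes k \<phi> :: "'a::euclidean_space \<Rightarrow> ennreal"
  assumes [measurable]: "k \<in> borel_measurable borel" "\<phi> \<in> borel_measurable borel"
    and even: "\<And>z. k (- z) = k z"
  shows "(\<integral>\<^sup>+ x. (\<integral>\<^sup>+ y. k (y - x) * (\<phi> y + \<phi> x) \<partial>lborel)\<^sup>2 \<partial>lborel)
      \<le> 4 * (\<integral>\<^sup>+ z. k z \<partial>lborel)\<^sup>2 * (\<integral>\<^sup>+ x. (\<phi> x)\<^sup>2 \<partial>lborel)"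
proof -
  let ?K = "\<integral>\<^sup>+ z. k z \<partial>lborel" and ?P = "\<integral>\<^sup>+ x. (\<phi> x)\<^sup>2 \<partial>lborel"
  have pointwise: "(\<integral>\<^sup>+ y. k (y - x) * (\<phi> y + \<phi> x) \<partial>lborel)\<^sup>2
      \<le> ?K * (\<integral>\<^sup>+ y. k (y - x) * (2 * ((\<phi> y)\<^sup>2 + (\<phi> x)\<^sup>2)) \<partial>lborel)" for x
  proof -
    let ?M = "density lborel (\<lambda>y. k (y - x))"
    have "(\<integral>\<^sup>+ y. k (y - x) * (\<phi> y + \<phi> x) \<partial>lborel)\<^sup>2 = (\<integral>\<^sup>+ y. 1 * (\<phi> y + \<phi> x) \<partial>?M)\<^sup>2"
      by (simp add: nn_integral_density)
    also have "\<dots> \<le> (\<integral>\<^sup>+ y. 1\<^sup>2 \<partial>?M) * (\<integral>\<^sup>+ y. (\<phi> y + \<phi> x)\<^sup>2 \<partial>?M)"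
      by (rule Cauchy_Schwarz_nn_integral) auto
    also have "(\<integral>\<^sup>+ y. 1\<^sup>2 \<partial>?M) = (\<integral>\<^sup>+ y. k (y - x) * 1\<^sup>2 \<partial>lborel)"
      by (rule nn_integral_density) auto
    also have "\<dots> = ?K"
      by (simp add: nn_integral_lborel_translate)
    also have "(\<integral>\<^sup>+ y. (\<phi> y + \<phi> x)\<^sup>2 \<partial>?M) = (\<integral>\<^sup>+ y. k (y - x) * (\<phi> y + \<phi> x)\<^sup>2 \<partial>lborel)"
      by (simp add: nn_integral_density)
    also have "\<dots> \<le> (\<integral>\<^sup>+ y. k (y - x) * (2 * ((\<phi> y)\<^sup>2 + (\<phi> x)\<^sup>2)) \<partial>lborel)"
      by (intro nn_integral_mono mult_left_mono ennreal_sum_square_le) auto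
    finally show ?thesis by (simp add: mult_left_mono)
  qed
  have swap: "(\<integral>\<^sup>+ x. \<integral>\<^sup>+ y. k (y - x) * (\<phi> y)\<^sup>2 \<partial>lborel \<partial>lborel) = ?K * ?P"
  proof -
    have "(\<integral>\<^sup>+ x. \<integral>\<^sup>+ y. k (y - x) * (\<phi> y)\<^sup>2 \<partial>lborel \<partial>lborel)
        = (\<integral>\<^sup>+ y. \<integral>\<^sup>+ x. k (y - x) * (\<phi> y)\<^sup>2 \<partial>lborel \<partial>lborel)"
      by (rule lborel_pair.Fubini') measurable
    also have "\<dots> = (\<integral>\<^sup>+ y. (\<integral>\<^sup>+ x. k (x - y) \<partial>lborel) * (\<phi> y)\<^sup>2 \<partial>lborel)"
    proof (rule nn_integral_cong)
      fix y
      have "k (y - x) = k (x - y)" for x using even[of "x - y"] by simp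
      then have "(\<integral>\<^sup>+ x. k (y - x) * (\<phi> y)\<^sup>2 \<partial>lborel) = (\<integral>\<^sup>+ x. k (x - y) * (\<phi> y)\<^sup>2 \<partial>lborel)"
        by simp
      also have "\<dots> = (\<integral>\<^sup>+ x. k (x - y) \<partial>lborel) * (\<phi> y)\<^sup>2"
        by (rule nn_integral_multc) measurable
      finally show "(\<integral>\<^sup>+ x. k (y - x) * (\<phi> y)\<^sup>2 \<partial>lborel) = (\<integral>\<^sup>+ x. k (x - y) \<partial>lborel) * (\<phi> y)\<^sup>2" .
    qed
    also have "\<dots> = ?K * ?P"
      by (simp add: nn_integral_lborel_translate nn_integral_cmult)
    finally show ?thesis .
  qed
  have diag: "(\<integral>\<^sup>+ x. \<integral>\<^sup>+ y. k (y - x) * (\<phi> x)\<^sup>2 \<partial>lborel \<partial>lborel) = ?K * ?P"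
    by (simp add: nn_integral_multc nn_integral_lborel_translate nn_integral_cmult)
  have "(\<integral>\<^sup>+ x. (\<integral>\<^sup>+ y. k (y - x) * (\<phi> y + \<phi> x) \<partial>lborel)\<^sup>2 \<partial>lborel)
      \<le> (\<integral>\<^sup>+ x. ?K * (\<integral>\<^sup>+ y. k (y - x) * (2 * ((\<phi> y)\<^sup>2 + (\<phi> x)\<^sup>2)) \<partial>lborel) \<partial>lborel)"
    by (intro nn_integral_mono pointwise)
  also have "\<dots> = ?K * (\<integral>\<^sup>+ x. (\<integral>\<^sup>+ y. k (y - x) * (2 * ((\<phi> y)\<^sup>2 + (\<phi> x)\<^sup>2)) \<partial>lborel) \<partial>lborel)"
    by (rule nn_integral_cmult) measurable
  also have "(\<integral>\<^sup>+ x. (\<integral>\<^sup>+ y. k (y - x) * (2 * ((\<phi> y)\<^sup>2 + (\<phi> x)\<^sup>2)) \<partial>lborel) \<partial>lborel)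
      = (\<integral>\<^sup>+ x. 2 * ((\<integral>\<^sup>+ y. k (y - x) * (\<phi> y)\<^sup>2 \<partial>lborel) + (\<integral>\<^sup>+ y. k (y - x) * (\<phi> x)\<^sup>2 \<partial>lborel)) \<partial>lborel)"
  proof (rule nn_integral_cong)
    fix x
    have "(\<integral>\<^sup>+ y. k (y - x) * (2 * ((\<phi> y)\<^sup>2 + (\<phi> x)\<^sup>2)) \<partial>lborel)
        = (\<integral>\<^sup>+ y. 2 * (k (y - x) * (\<phi> y)\<^sup>2 + k (y - x) * (\<phi> x)\<^sup>2) \<partial>lborel)"
      by (intro nn_integral_cong) (simp add: distrib_left mult.left_commute)
    also have "\<dots> = 2 * (\<integral>\<^sup>+ y. k (y - x) * (\<phi> y)\<^sup>2 + k (y - x) * (\<phi> x)\<^sup>2 \<partial>lborel)"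
      by (rule nn_integral_cmult) measurable
    also have "(\<integral>\<^sup>+ y. k (y - x) * (\<phi> y)\<^sup>2 + k (y - x) * (\<phi> x)\<^sup>2 \<partial>lborel)
        = (\<integral>\<^sup>+ y. k (y - x) * (\<phi> y)\<^sup>2 \<partial>lborel) + (\<integral>\<^sup>+ y. k (y - x) * (\<phi> x)\<^sup>2 \<partial>lborel)"
      by (rule nn_integral_add) measurable
    finally show "(\<integral>\<^sup>+ y. k (y - x) * (2 * ((\<phi> y)\<^sup>2 + (\<phi> x)\<^sup>2)) \<partial>lborel)
        = 2 * ((\<integral>\<^sup>+ y. k (y - x) * (\<phi> y)\<^sup>2 \<partial>lborel) + (\<integral>\<^sup>+ y. k (y - x) * (\<phi> x)\<^sup>2 \<partial>lborel))" .
  qed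
  also have "\<dots> = 2 * (\<integral>\<^sup>+ x. (\<integral>\<^sup>+ y. k (y - x) * (\<phi> y)\<^sup>2 \<partial>lborel) + (\<integral>\<^sup>+ y. k (y - x) * (\<phi> x)\<^sup>2 \<partial>lborel) \<partial>lborel)"
    by (rule nn_integral_cmult) measurable
  also have "(\<integral>\<^sup>+ x. (\<integral>\<^sup>+ y. k (y - x) * (\<phi> y)\<^sup>2 \<partial>lborel) + (\<integral>\<^sup>+ y. k (y - x) * (\<phi> x)\<^sup>2 \<partial>lborel) \<partial>lborel)
      = ?K * ?P + ?K * ?P"
    using swap diag by (subst nn_integral_add) measurable
  also have "?K * (2 * (?K * ?P + ?K * ?P)) = 4 * ?K\<^sup>2 * ?P"
  proof -
    have "?K * (2 * (X + X)) = 4 * ?K * X" for X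
      by (simp add: mult_2[symmetric] mult.left_commute mult.commute mult.assoc)
    then show ?thesis by (simp add: power2_eq_square mult.assoc)
  qed
  finally show ?thesis .
qed

text \<open>The form used for the peridynamic integrals. The Schur test also yields integrability of the
  integrand, for almost every \<open>x\<close> only; this is enough because all norms ignore null sets.\<close>

lemma Schur_integral_operator:
  fixes \<Phi> :: "'a::euclidean_space \<Rightarrow> 'a \<Rightarrow> 'b::euclidean_space" and k \<phi> :: "'a \<Rightarrow> real"
  assumes \<Phi> [measurable]: "(\<lambda>(x, y). \<Phi> x y) \<in> borel_measurable (borel \<Otimes>\<^sub>M borel)"
    and bound: "\<And>x y. norm (\<Phi> x y) \<le> k (y - x) * (\<phi> y + \<phi> x)"
    and k: "integrable lborel k" "\<And>z. 0 \<le> k z" "\<And>z. k (- z) = k z"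
    and \<phi> [measurable]: "\<phi> \<in> borel_measurable borel" and \<phi>': "\<And>x. 0 \<le> \<phi> x" "integrable lborel (\<lambda>x. (\<phi> x)\<^sup>2)"
  shows "(\<lambda>x. LINT y|lborel. \<Phi> x y) \<in> borel_measurable borel"
    and "AE x in lborel. integrable lborel (\<Phi> x)"
    and "integrable lborel (\<lambda>x. (norm (LINT y|lborel. \<Phi> x y))\<^sup>2)"
    and "(LINT x|lborel. (norm (LINT y|lborel. \<Phi> x y))\<^sup>2)
      \<le> (2 * (LINT z|lborel. k z))\<^sup>2 * (LINT x|lborel. (\<phi> x)\<^sup>2)"
proof -
  let ?T = "\<lambda>x. LINT y|lborel. \<Phi> x y"
  let ?N = "\<lambda>x. \<integral>\<^sup>+ y. ennreal (norm (\<Phi> x y)) \<partial>lborel"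
  let ?B = "(2 * (LINT z|lborel. k z))\<^sup>2 * (LINT x|lborel. (\<phi> x)\<^sup>2)"
  have [measurable]: "k \<in> borel_measurable borel"
    using k(1) by (simp add: integrable_iff_bounded)
  have [measurable]: "\<Phi> x \<in> borel_measurable borel" for x
    using measurable_compose[OF measurable_Pair1' \<Phi>, of x] by simp
  have \<Phi>2 [measurable]: "(\<lambda>(x, y). \<Phi> x y) \<in> borel_measurable (borel \<Otimes>\<^sub>M lborel)"
    using \<Phi> by (simp cong: measurable_cong_sets sets_pair_measure_cong)
  show T [measurable]: "?T \<in> borel_measurable borel"
    by (rule lborel.borel_measurable_lebesgue_integral) (use \<Phi>2 in simp)
  have N [measurable]: "?N \<in> borel_measurable borel"
    by (rule lborel.borel_measurable_nn_integral) measurable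
  have "?N x \<le> (\<integral>\<^sup>+ y. ennreal (k (y - x)) * (ennreal (\<phi> y) + ennreal (\<phi> x)) \<partial>lborel)" for x
  proof (rule nn_integral_mono)
    fix y
    have "ennreal (norm (\<Phi> x y)) \<le> ennreal (k (y - x) * (\<phi> y + \<phi> x))"
      by (intro ennreal_leI bound)
    also have "\<dots> = ennreal (k (y - x)) * (ennreal (\<phi> y) + ennreal (\<phi> x))"
      using k \<phi>' by (simp add: ennreal_mult)
    finally show "ennreal (norm (\<Phi> x y)) \<le> ennreal (k (y - x)) * (ennreal (\<phi> y) + ennreal (\<phi> x))" .
  qed
  then have "(\<integral>\<^sup>+ x. (?N x)\<^sup>2 \<partial>lborel)
      \<le> (\<integral>\<^sup>+ x. (\<integral>\<^sup>+ y. ennreal (k (y - x)) * (ennreal (\<phi> y) + ennreal (\<phi> x)) \<partial>lborel)\<^sup>2 \<partial>lborel)"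
    by (rule nn_integral_mono[OF power_mono]) auto
  also have "\<dots> \<le> 4 * (\<integral>\<^sup>+ z. ennreal (k z) \<partial>lborel)\<^sup>2 * (\<integral>\<^sup>+ x. (ennreal (\<phi> x))\<^sup>2 \<partial>lborel)"
    by (rule Schur_test) (use k in auto)
  also have "(\<integral>\<^sup>+ z. ennreal (k z) \<partial>lborel) = ennreal (LINT z|lborel. k z)"
    using k by (intro nn_integral_eq_integral) auto
  also have "(\<integral>\<^sup>+ x. (ennreal (\<phi> x))\<^sup>2 \<partial>lborel) = (\<integral>\<^sup>+ x. ennreal ((\<phi> x)\<^sup>2) \<partial>lborel)"
    using \<phi>' by (simp add: ennreal_power)
  also have "\<dots> = ennreal (LINT x|lborel. (\<phi> x)\<^sup>2)"
    using \<phi>' by (intro nn_integral_eq_integral) auto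
  also have "4 * (ennreal (LINT z|lborel. k z))\<^sup>2 * ennreal (LINT x|lborel. (\<phi> x)\<^sup>2) = ennreal ?B"
  proof -
    have *: "4 * (ennreal K)\<^sup>2 * ennreal P = ennreal ((2 * K)\<^sup>2 * P)" if "K \<ge> 0" "P \<ge> 0" for K P
      using that by (simp add: ennreal_mult ennreal_power power_mult_distrib)
    show ?thesis
      by (intro *) (use k \<phi>' in \<open>auto intro!: Bochner_Integration.integral_nonneg\<close>)
  qed
  finally have N2: "(\<integral>\<^sup>+ x. (?N x)\<^sup>2 \<partial>lborel) \<le> ennreal ?B" .
  have "AE x in lborel. (?N x)\<^sup>2 \<noteq> \<infinity>"
    using N2 by (intro nn_integral_PInf_AE) (auto simp: top_unique)
  then show I: "AE x in lborel. integrable lborel (\<Phi> x)"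
  proof eventually_elim
    case (elim x)
    then have "?N x \<noteq> top"
      by (auto simp: power2_eq_square ennreal_top_mult)
    then show ?case by (simp add: integrable_iff_bounded less_top)
  qed
  have "(\<integral>\<^sup>+ x. ennreal ((norm (?T x))\<^sup>2) \<partial>lborel) \<le> (\<integral>\<^sup>+ x. (?N x)\<^sup>2 \<partial>lborel)"
  proof (rule nn_integral_mono_AE)
    show "AE x in lborel. ennreal ((norm (?T x))\<^sup>2) \<le> (?N x)\<^sup>2"
      using I
    proof eventually_elim
      case (elim x)
      have "ennreal ((norm (?T x))\<^sup>2) = (ennreal (norm (?T x)))\<^sup>2" by (simp add: ennreal_power)
      also have "\<dots> \<le> (?N x)\<^sup>2"
        by (intro power_mono integral_norm_bound_ennreal elim) auto
      finally show ?case .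
    qed
  qed
  then have T2: "(\<integral>\<^sup>+ x. ennreal ((norm (?T x))\<^sup>2) \<partial>lborel) \<le> ennreal ?B"
    using N2 by (rule order_trans)
  then have "(\<integral>\<^sup>+ x. ennreal ((norm (?T x))\<^sup>2) \<partial>lborel) < \<infinity>"
    by (auto simp: less_top[symmetric] top_unique)
  then show int: "integrable lborel (\<lambda>x. (norm (?T x))\<^sup>2)"
    by (intro integrableI_bounded) auto
  have "ennreal (LINT x|lborel. (norm (?T x))\<^sup>2) = (\<integral>\<^sup>+ x. ennreal ((norm (?T x))\<^sup>2) \<partial>lborel)"
    by (rule nn_integral_eq_integral[symmetric, OF int]) simp
  then have "ennreal (LINT x|lborel. (norm (?T x))\<^sup>2) \<le> ennreal ?B"
    using T2 by (simp only:)
  moreover have "0 \<le> ?B"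
    by (intro mult_nonneg_nonneg Bochner_Integration.integral_nonneg) auto
  ultimately show "(LINT x|lborel. (norm (?T x))\<^sup>2) \<le> ?B"
    by (simp only: ennreal_le_iff)
qed

text \<open>Almost everywhere the difference of the two integrals is the integral of the difference, so a
  Lipschitz bound for the integrands becomes one for the operators.\<close>

lemma Schur_integral_operator_diff:
  fixes \<Phi> \<Psi> :: "'a::euclidean_space \<Rightarrow> 'a \<Rightarrow> 'b::euclidean_space" and k \<phi> \<phi>1 \<phi>2 :: "'a \<Rightarrow> real"
  assumes \<Phi> [measurable]: "(\<lambda>(x, y). \<Phi> x y) \<in> borel_measurable (borel \<Otimes>\<^sub>M borel)"
    and \<Psi> [measurable]: "(\<lambda>(x, y). \<Psi> x y) \<in> borel_measurable (borel \<Otimes>\<^sub>M borel)"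
    and bound: "\<And>x y. norm (\<Phi> x y) \<le> k (y - x) * (\<phi>1 y + \<phi>1 x)"
      "\<And>x y. norm (\<Psi> x y) \<le> k (y - x) * (\<phi>2 y + \<phi>2 x)"
      "\<And>x y. norm (\<Phi> x y - \<Psi> x y) \<le> k (y - x) * (\<phi> y + \<phi> x)"
    and k: "integrable lborel k" "\<And>z. 0 \<le> k z" "\<And>z. k (- z) = k z"
    and \<phi>: "\<phi> \<in> borel_measurable borel" "\<And>x. 0 \<le> \<phi> x" "integrable lborel (\<lambda>x. (\<phi> x)\<^sup>2)"
    and \<phi>1: "\<phi>1 \<in> borel_measurable borel" "\<And>x. 0 \<le> \<phi>1 x" "integrable lborel (\<lambda>x. (\<phi>1 x)\<^sup>2)"
    and \<phi>2: "\<phi>2 \<in> borel_measurable borel" "\<And>x. 0 \<le> \<phi>2 x" "integrable lborel (\<lambda>x. (\<phi>2 x)\<^sup>2)"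
  shows "integrable lborel (\<lambda>x. (norm ((LINT y|lborel. \<Phi> x y) - (LINT y|lborel. \<Psi> x y)))\<^sup>2)"
    and "(LINT x|lborel. (norm ((LINT y|lborel. \<Phi> x y) - (LINT y|lborel. \<Psi> x y)))\<^sup>2)
      \<le> (2 * (LINT z|lborel. k z))\<^sup>2 * (LINT x|lborel. (\<phi> x)\<^sup>2)"
proof -
  let ?d = "\<lambda>x. (LINT y|lborel. \<Phi> x y) - (LINT y|lborel. \<Psi> x y)"
  note P = Schur_integral_operator[OF \<Phi> bound(1) k \<phi>1]
  note Q = Schur_integral_operator[OF \<Psi> bound(2) k \<phi>2]
  have "(\<lambda>(x, y). \<Phi> x y - \<Psi> x y) \<in> borel_measurable (borel \<Otimes>\<^sub>M borel)"
    using borel_measurable_diff[OF \<Phi> \<Psi>] by (simp add: case_prod_unfold)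
  note R = Schur_integral_operator[OF this bound(3) k \<phi>]
  note [measurable] = P(1) Q(1) R(1)
  have eq: "AE x in lborel. (norm (?d x))\<^sup>2 = (norm (LINT y|lborel. \<Phi> x y - \<Psi> x y))\<^sup>2"
    using P(2) Q(2) by eventually_elim simp
  show "integrable lborel (\<lambda>x. (norm (?d x))\<^sup>2)"
    using R(3) by (rule integrable_cong_AE_imp) (use eq in auto)
  have "(LINT x|lborel. (norm (?d x))\<^sup>2) = (LINT x|lborel. (norm (LINT y|lborel. \<Phi> x y - \<Psi> x y))\<^sup>2)"
    by (rule integral_cong_AE) (use eq in auto)
  with R(4) show "(LINT x|lborel. (norm (?d x))\<^sup>2) \<le> (2 * (LINT z|lborel. k z))\<^sup>2 * (LINT x|lborel. (\<phi> x)\<^sup>2)"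
    by simp
qed

section \<open>Moments of the influence function\<close>

text \<open>In dimension at least two the singularity \<open>1 / |\<xi>|\<close> is integrable: on the dyadic shell
  \<open>2\<^sup>-\<^sup>n\<^sup>-\<^sup>1 \<le> |\<xi>| < 2\<^sup>-\<^sup>n\<close> it is at most \<open>2\<^sup>n\<^sup>+\<^sup>1\<close>, while the volume of the shell decays at least
  like \<open>4\<^sup>-\<^sup>n\<close>.\<close>

lemma integrable_inverse_norm_ball:
  assumes dim: "DIM('a::euclidean_space) \<ge> 2"
  shows "integrable lborel (\<lambda>\<xi>::'a. indicator (ball 0 1) \<xi> * inverse (norm \<xi>) :: real)"
proof (rule integrableI_bounded)
  let ?f = "\<lambda>\<xi>::'a. indicator (ball 0 1) \<xi> * inverse (norm \<xi>) :: real"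
  let ?w = "measure lborel (ball (0::'a) 1)"
  let ?g = "\<lambda>n::nat. \<lambda>\<xi>::'a. ennreal (2 ^ (n + 1)) * indicator (ball 0 ((1/2) ^ n)) \<xi>"
  show "?f \<in> borel_measurable lborel"
    by (intro borel_measurable_times borel_measurable_indicator borel_measurable_inverse) auto
  have pointwise: "ennreal (norm (?f \<xi>)) \<le> (\<Sum>n. ?g n \<xi>)" for \<xi> :: 'a
  proof (cases "\<xi> = 0 \<or> norm \<xi> \<ge> 1")
    case False
    then have xi: "0 < norm \<xi>" "norm \<xi> < 1" by auto
    obtain m where m: "(1/2) ^ m < norm \<xi>"
      using real_arch_pow_inv[of "norm \<xi>" "1/2"] xi by auto
    define n where "n = (LEAST n. (1/2) ^ n \<le> norm \<xi>)"
    have n: "(1/2) ^ n \<le> norm \<xi>"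
      unfolding n_def by (rule LeastI[of _ m]) (use m in simp)
    have "n \<noteq> 0" using n xi by (intro notI) simp
    then obtain j where j: "n = Suc j" by (cases n) auto
    have "\<not> (1/2) ^ j \<le> norm \<xi>"
      using not_less_Least[of j "\<lambda>n. (1/2) ^ n \<le> norm \<xi>"] j by (simp add: n_def)
    then have "indicator (ball 0 ((1/2) ^ j)) \<xi> = (1::ennreal)" by simp
    moreover have "inverse (norm \<xi>) \<le> 2 ^ (j + 1)"
    proof -
      have "inverse (norm \<xi>) \<le> inverse ((1/2) ^ n)"
        using n by (intro le_imp_inverse_le) auto
      also have "\<dots> = 2 ^ (j + 1)" by (simp add: j power_one_over divide_simps)
      finally show ?thesis .
    qed
    ultimately have "ennreal (norm (?f \<xi>)) \<le> ?g j \<xi>"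
      using xi by (simp add: ennreal_leI)
    also have "\<dots> \<le> (\<Sum>n. ?g n \<xi>)"
    proof -
      have "h j \<le> suminf h" for h :: "nat \<Rightarrow> ennreal"
        using sum_le_suminf[of h "{j}"] by simp
      then show ?thesis .
    qed
    finally show ?thesis .
  qed auto
  have term_bound: "(\<integral>\<^sup>+ \<xi>. ?g n \<xi> \<partial>lborel) \<le> ennreal (2 * ?w * (1/2) ^ n)" for n
  proof -
    have "(\<integral>\<^sup>+ \<xi>. ?g n \<xi> \<partial>lborel) = ennreal (2 ^ (n + 1)) * emeasure lborel (ball (0::'a) ((1/2) ^ n))"
      by (rule nn_integral_cmult_indicator) simp
    also have "emeasure lborel (ball (0::'a) ((1/2) ^ n)) = ennreal (((1/2) ^ n) ^ DIM('a) * ?w)"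
      using emeasure_lborel_ball_finite[of "0::'a" "(1/2) ^ n"]
        content_ball_conv_unit_ball[of "(1/2) ^ n" "0::'a"]
      by (subst emeasure_eq_ennreal_measure) auto
    also have "ennreal (2 ^ (n + 1)) * \<dots> = ennreal (2 ^ (n + 1) * (((1/2) ^ n) ^ DIM('a) * ?w))"
      by (simp add: ennreal_mult)
    also have "\<dots> \<le> ennreal (2 ^ (n + 1) * (((1/2) ^ n)\<^sup>2 * ?w))"
      by (intro ennreal_leI mult_left_mono mult_right_mono power_decreasing dim) (auto simp: power_le_one)
    also have "2 ^ (n + 1) * (((1/2) ^ n)\<^sup>2 * ?w) = 2 * ?w * (1/2) ^ n"
      by (simp add: power2_eq_square power_one_over divide_simps)
    finally show ?thesis .
  qed
  have sm: "summable (\<lambda>n. 2 * ?w * (1/2::real) ^ n)"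
    by (intro summable_mult summable_geometric) simp
  have "(\<integral>\<^sup>+ \<xi>. ennreal (norm (?f \<xi>)) \<partial>lborel) \<le> (\<integral>\<^sup>+ \<xi>. (\<Sum>n. ?g n \<xi>) \<partial>lborel)"
    by (intro nn_integral_mono pointwise)
  also have "\<dots> = (\<Sum>n. \<integral>\<^sup>+ \<xi>. ?g n \<xi> \<partial>lborel)"
    by (intro nn_integral_suminf borel_measurable_times_ennreal borel_measurable_indicator
        borel_measurable_const) auto
  also have "\<dots> \<le> (\<Sum>n. ennreal (2 * ?w * (1/2) ^ n))"
    by (intro suminf_le term_bound) auto
  also have "\<dots> = ennreal (\<Sum>n. 2 * ?w * (1/2) ^ n)"
    by (rule suminf_ennreal2[OF _ sm]) auto
  finally show "(\<integral>\<^sup>+ \<xi>. ennreal (norm (?f \<xi>)) \<partial>lborel) < \<infinity>"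
    by (auto simp: less_top[symmetric] top_unique)
qed

lemma lborel_integral_scaleR:
  fixes f :: "'a::euclidean_space \<Rightarrow> real"
  assumes c: "c > 0" and [measurable]: "f \<in> borel_measurable borel"
  shows "integrable lborel f \<longleftrightarrow> integrable lborel (\<lambda>x. f (c *\<^sub>R x))"
    and "(LINT x|lborel. f x) = c ^ DIM('a) * (LINT x|lborel. f (c *\<^sub>R x))"
proof -
  let ?M = "density (distr lborel borel (\<lambda>x::'a. 0 + c *\<^sub>R x)) (\<lambda>_. ennreal (c ^ DIM('a)))"
  have eq: "lborel = ?M"
    using c lborel_affine[of c "0::'a"] by simp
  have "integrable lborel f \<longleftrightarrow> integrable ?M f"
    by (simp only: eq[symmetric])
  also have "\<dots> \<longleftrightarrow> integrable (distr lborel borel (\<lambda>x::'a. 0 + c *\<^sub>R x)) (\<lambda>x. c ^ DIM('a) *\<^sub>R f x)"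
    using c by (intro integrable_density) auto
  also have "\<dots> \<longleftrightarrow> integrable lborel (\<lambda>x. c ^ DIM('a) *\<^sub>R f (0 + c *\<^sub>R x))"
    by (rule integrable_distr_eq) auto
  also have "\<dots> \<longleftrightarrow> integrable lborel (\<lambda>x. f (c *\<^sub>R x))"
    using c by simp
  finally show "integrable lborel f \<longleftrightarrow> integrable lborel (\<lambda>x. f (c *\<^sub>R x))" .
  have "(LINT x|lborel. f x) = integral\<^sup>L ?M f"
    by (simp only: eq[symmetric])
  also have "\<dots> = (LINT x|distr lborel borel (\<lambda>x::'a. 0 + c *\<^sub>R x). c ^ DIM('a) *\<^sub>R f x)"
    using c by (intro integral_density) auto
  also have "\<dots> = (LINT x|lborel. c ^ DIM('a) *\<^sub>R f (0 + c *\<^sub>R x))"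
    by (rule integral_distr) auto
  finally show "(LINT x|lborel. f x) = c ^ DIM('a) * (LINT x|lborel. f (c *\<^sub>R x))" by simp
qed

text \<open>The kernel \<open>J\<^sup>\<epsilon>(|\<xi>|) |\<xi>|\<^sup>-\<^sup>\<alpha>\<close>. At the origin it vanishes, since \<open>0 powr - \<alpha> = 0\<close>. This agrees
  with the bond integrands, which contain the factor \<open>sgn (y - x)\<close>.\<close>

definition influence_kernel :: "(real \<Rightarrow> real) \<Rightarrow> real \<Rightarrow> real \<Rightarrow> real ^ 'd::finite \<Rightarrow> real" where
  "influence_kernel J \<epsilon> \<alpha> \<xi> = indicator (ball 0 \<epsilon>) \<xi> * (J (norm \<xi> / \<epsilon>) * norm \<xi> powr (- \<alpha>))"

lemma influence_kernel_measurable: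
  assumes "influence_function M J"
  shows "influence_kernel J \<epsilon> \<alpha> \<in> borel_measurable borel"
proof -
  have [measurable]: "J \<in> borel_measurable borel" using assms by (simp add: influence_function_def)
  have "(\<lambda>\<xi>. J (norm \<xi> / \<epsilon>)) \<in> borel_measurable borel" by measurable
  then show ?thesis unfolding influence_kernel_def
    by (intro borel_measurable_times borel_measurable_indicator powr_real_measurable) auto
qed

lemma influence_kernel_nonneg:
  assumes "influence_function M J" "\<epsilon> > 0"
  shows "0 \<le> influence_kernel J \<epsilon> \<alpha> \<xi>"
  using assms by (auto simp: influence_kernel_def influence_function_def indicator_def)

lemma influence_kernel_minus: "influence_kernel J \<epsilon> \<alpha> (- \<xi>) = influence_kernel J \<epsilon> \<alpha> \<xi>"
  by (simp add: influence_kernel_def indicator_def)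

lemma integrable_influence_kernel_unit:
  assumes infl: "influence_function M J" and dim: "CARD('d::finite) \<ge> 2" and \<alpha>: "0 \<le> \<alpha>" "\<alpha> \<le> 1"
  shows "integrable lborel (influence_kernel J 1 \<alpha> :: real ^ 'd \<Rightarrow> real)"
proof (rule Bochner_Integration.integrable_bound)
  show "integrable lborel (\<lambda>\<xi>::real ^ 'd. M * (indicator (ball 0 1) \<xi> * inverse (norm \<xi>)))"
    using dim by (intro integrable_mult_right integrable_inverse_norm_ball) simp
  show "(influence_kernel J 1 \<alpha> :: real ^ 'd \<Rightarrow> real) \<in> borel_measurable lborel"
    using influence_kernel_measurable[OF infl] by simp
  have "norm (influence_kernel J 1 \<alpha> \<xi>) \<le> norm (M * (indicator (ball 0 1) \<xi> * inverse (norm \<xi>)))"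
    for \<xi> :: "real ^ 'd"
  proof (cases "\<xi> \<noteq> 0 \<and> norm \<xi> < 1")
    case True
    then have J: "0 \<le> J (norm \<xi>)" "J (norm \<xi>) \<le> M"
      using infl by (auto simp: influence_function_def)
    have "norm \<xi> powr (- \<alpha>) \<le> norm \<xi> powr (- 1)"
      using True \<alpha> by (intro powr_mono') auto
    also have "\<dots> = inverse (norm \<xi>)"
      using True by (simp add: powr_minus)
    finally have "J (norm \<xi>) * norm \<xi> powr (- \<alpha>) \<le> M * inverse (norm \<xi>)"
      using J by (intro mult_mono) auto
    then show ?thesis
      using True J by (simp add: influence_kernel_def abs_mult)
  qed (auto simp: influence_kernel_def)
  then show "AE \<xi> in lborel. norm (influence_kernel J 1 \<alpha> \<xi>)
      \<le> norm (M * (indicator (ball 0 1) (\<xi>::real ^ 'd) * inverse (norm \<xi>)))"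
    by (intro AE_I2)
qed

lemma unit_ball_volume_pos: "unit_ball_volume TYPE('d::finite) > 0"
  by (simp add: unit_ball_volume_def content_ball_pos)

text \<open>Substituting \<open>\<xi> = \<epsilon> \<eta>\<close> expresses the mass of the kernel at horizon \<open>\<epsilon>\<close> through the
  dimensionless moment of the influence function.\<close>

lemma influence_kernel_integral:
  assumes infl: "influence_function M J" and dim: "CARD('d::finite) \<ge> 2" and \<alpha>: "0 \<le> \<alpha>" "\<alpha> \<le> 1"
    and eps: "\<epsilon> > 0"
  shows "integrable lborel (influence_kernel J \<epsilon> \<alpha> :: real ^ 'd \<Rightarrow> real)"
    and "(LINT \<xi>|lborel. influence_kernel J \<epsilon> \<alpha> (\<xi> :: real ^ 'd))
      = \<epsilon> ^ CARD('d) * \<epsilon> powr (- \<alpha>) * unit_ball_volume TYPE('d) * J_bar TYPE('d) J \<alpha>"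
proof -
  have scale: "influence_kernel J \<epsilon> \<alpha> (\<epsilon> *\<^sub>R \<xi>) = \<epsilon> powr (- \<alpha>) * influence_kernel J 1 \<alpha> \<xi>" for \<xi> :: "real ^ 'd"
    using eps by (simp add: influence_kernel_def indicator_def powr_mult)
  have m: "(influence_kernel J \<epsilon> \<alpha> :: real ^ 'd \<Rightarrow> real) \<in> borel_measurable borel"
    by (rule influence_kernel_measurable[OF infl])
  show "integrable lborel (influence_kernel J \<epsilon> \<alpha> :: real ^ 'd \<Rightarrow> real)"
    unfolding lborel_integral_scaleR(1)[OF eps m] scale
    by (intro integrable_mult_right integrable_influence_kernel_unit[OF infl dim \<alpha>])
  have "J_bar TYPE('d) J \<alpha> = 1 / unit_ball_volume TYPE('d) *
      (LINT \<xi>|lborel. influence_kernel J 1 \<alpha> (\<xi> :: real ^ 'd))"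
    by (simp add: J_bar_def set_lebesgue_integral_def influence_kernel_def)
  then have "(LINT \<xi>|lborel. influence_kernel J 1 \<alpha> (\<xi> :: real ^ 'd))
      = unit_ball_volume TYPE('d) * J_bar TYPE('d) J \<alpha>"
    using unit_ball_volume_pos[where 'd='d] by simp
  then show "(LINT \<xi>|lborel. influence_kernel J \<epsilon> \<alpha> (\<xi> :: real ^ 'd))
      = \<epsilon> ^ CARD('d) * \<epsilon> powr (- \<alpha>) * unit_ball_volume TYPE('d) * J_bar TYPE('d) J \<alpha>"
    unfolding lborel_integral_scaleR(2)[OF eps m] scale by simp
qed

lemma J_bar_nonneg:
  assumes "influence_function M J"
  shows "0 \<le> J_bar TYPE('d::finite) J \<alpha>"
  unfolding J_bar_def set_lebesgue_integral_def
  using assms unit_ball_volume_pos[where 'd='d]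
  by (intro mult_nonneg_nonneg Bochner_Integration.integral_nonneg)
     (auto simp: influence_function_def indicator_def)

section \<open>Lipschitz continuity of the peridynamic force\<close>

locale bond_model =
  fixes D :: "(real ^ 'd::finite) set" and \<omega> :: "real ^ 'd \<Rightarrow> real" and J :: "real \<Rightarrow> real" and M \<epsilon> :: real
  assumes dim: "CARD('d) \<ge> 2"
    and eps: "\<epsilon> > 0"
    and infl: "influence_function M J"
    and \<omega>_measurable [measurable]: "\<omega> \<in> borel_measurable borel"
    and \<omega>_range: "0 \<le> \<omega> x" "\<omega> x \<le> 1"
    and \<omega>_outside: "x \<notin> D \<Longrightarrow> \<omega> x = 0"
begin


lemma J_measurable [measurable]: "J \<in> borel_measurable borel"
  using infl by (simp add: influence_function_def)

lemma J_nonneg: "norm (z :: real ^ 'd) < \<epsilon> \<Longrightarrow> 0 \<le> J (norm z / \<epsilon>)"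
  using infl eps by (auto simp: influence_function_def)

lemma vol_pos: "unit_ball_volume TYPE('d) > 0" by (rule unit_ball_volume_pos)

lemma indicator_ball_eq:
  fixes x y :: "real ^ 'd"
  shows "indicat_real (ball x \<epsilon>) y = (if norm (y - x) < \<epsilon> then 1 else 0)"
  by (simp add: indicator_def dist_norm norm_minus_commute)

text \<open>The bond integrands are of the form \<open>c J(|y - x| / \<epsilon>) |y - x|\<^sup>-\<^sup>\<alpha>\<close> times something bounded by
  \<open>\<phi>(y) + \<phi>(x)\<close>, with \<open>\<alpha> = 0\<close> or \<open>\<alpha> = 1\<close>.\<close>

definition scaled_kernel :: "real \<Rightarrow> real \<Rightarrow> real ^ 'd \<Rightarrow> real" where
  "scaled_kernel c \<alpha> z = c * influence_kernel J \<epsilon> \<alpha> z"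

lemma scaled_kernel:
  assumes "c \<ge> 0" "0 \<le> \<alpha>" "\<alpha> \<le> 1"
  shows "integrable lborel (scaled_kernel c \<alpha>)" "0 \<le> scaled_kernel c \<alpha> z"
    "scaled_kernel c \<alpha> (- z) = scaled_kernel c \<alpha> z"
    "(LINT z|lborel. scaled_kernel c \<alpha> z) = c * (\<epsilon> ^ CARD('d) * \<epsilon> powr (- \<alpha>) * unit_ball_volume TYPE('d) * J_bar TYPE('d) J \<alpha>)"
  using assms influence_kernel_integral[OF infl dim assms(2,3) eps]
    influence_kernel_nonneg[OF infl eps, of \<alpha> z]
  by (simp_all add: scaled_kernel_def[abs_def] influence_kernel_minus)

lemma strain_diff: "strain y x u - strain y x v = strain y x (\<lambda>p. u p - v p)"
  by (simp add: strain_def algebra_simps inner_diff_left inner_add_left)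

text \<open>The weight \<open>|y - x|\<close> cancels the singularity of the strain.\<close>

lemma strain_bound: "norm (y - x) * \<bar>strain y x w\<bar> \<le> norm (w y) + norm (w x)"
proof (cases "y = x")
  case False
  have "\<bar>strain y x w\<bar> \<le> norm ((w y - w x) /\<^sub>R norm (y - x)) * norm (sgn (y - x))"
    unfolding strain_def by (rule Cauchy_Schwarz_ineq2)
  also have "\<dots> = norm (w y - w x) / norm (y - x)"
    using False by (simp add: norm_sgn divide_inverse mult.commute)
  finally have "norm (y - x) * \<bar>strain y x w\<bar> \<le> norm (w y - w x)"
    using False by (simp add: field_simps)
  also have "\<dots> \<le> norm (w y) + norm (w x)" by (rule norm_triangle_ineq4)
  finally show ?thesis .
qed simp

lemma strain_measurable [measurable]:
  assumes [measurable]: "w \<in> borel_measurable borel"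
  shows "(\<lambda>p. strain (snd p) (fst p) w) \<in> borel_measurable (borel \<Otimes>\<^sub>M borel)"
  unfolding strain_def by measurable

end

lemma L2_norm_le_of_integral:
  assumes "w \<in> L2_space D" "(LINT x|lborel. (norm (w x))\<^sup>2) \<le> K\<^sup>2" "0 \<le> K"
  shows "L2_norm D w \<le> K"
  by (rule power2_le_imp_le[OF _ assms(3)]) (simp add: L2_norm_eq_integral[OF assms(1)] assms(2))

context bond_model
begin

abbreviation \<theta> :: "(real ^ 'd \<Rightarrow> real ^ 'd) \<Rightarrow> real ^ 'd \<Rightarrow> real" where
  "\<theta> \<equiv> dilatation \<epsilon> \<omega> J"

definition horizon_volume :: real where "horizon_volume = \<epsilon> ^ CARD('d) * unit_ball_volume TYPE('d)"

lemma horizon_volume_pos: "horizon_volume > 0"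
  using eps vol_pos by (simp add: horizon_volume_def)

lemma scaled_kernel_integral:
  assumes "c \<ge> 0"
  shows "(LINT z|lborel. scaled_kernel (c / horizon_volume) 0 z) = c * J_bar TYPE('d) J 0"
    and "(LINT z|lborel. scaled_kernel (c / horizon_volume) 1 z) = c / \<epsilon> * J_bar TYPE('d) J 1"
proof -
  have "c / horizon_volume \<ge> 0" using assms horizon_volume_pos by simp
  note * = scaled_kernel(4)[OF this]
  show "(LINT z|lborel. scaled_kernel (c / horizon_volume) 0 z) = c * J_bar TYPE('d) J 0"
    using eps vol_pos by (subst *) (auto simp: horizon_volume_def)
  show "(LINT z|lborel. scaled_kernel (c / horizon_volume) 1 z) = c / \<epsilon> * J_bar TYPE('d) J 1"
    using eps vol_pos by (subst *) (auto simp: horizon_volume_def powr_minus divide_simps)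
qed

definition dilatation_integrand :: "(real ^ 'd \<Rightarrow> real ^ 'd) \<Rightarrow> real ^ 'd \<Rightarrow> real ^ 'd \<Rightarrow> real" where
  "dilatation_integrand w x y = 1 / horizon_volume * (indicator (ball x \<epsilon>) y *
     (\<omega> y * J (norm (y - x) / \<epsilon>) * strain y x w * norm (y - x)))"

lemma dilatation_eq: "\<theta> w x = (LINT y|lborel. dilatation_integrand w x y)"
  by (simp add: dilatation_def dilatation_integrand_def horizon_volume_def set_lebesgue_integral_def)

lemma dilatation_integrand_measurable:
  assumes [measurable]: "w \<in> borel_measurable borel"
  shows "(\<lambda>(x, y). dilatation_integrand w x y) \<in> borel_measurable (borel \<Otimes>\<^sub>M borel)"
proof -
  note [measurable] = strain_measurable[OF assms]
  show ?thesis
    unfolding dilatation_integrand_def indicator_ball_eq case_prod_unfold by measurable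
qed

lemma dilatation_integrand_diff:
  "dilatation_integrand u x y - dilatation_integrand v x y = dilatation_integrand (\<lambda>p. u p - v p) x y"
  by (simp add: dilatation_integrand_def strain_diff[symmetric] algebra_simps)

lemma dilatation_integrand_bound:
  "norm (dilatation_integrand w x y) \<le> scaled_kernel (1 / horizon_volume) 0 (y - x) * (norm (w y) + norm (w x))"
proof (cases "norm (y - x) < \<epsilon> \<and> y \<noteq> x")
  case True
  let ?j = "J (norm (y - x) / \<epsilon>)"
  have j: "0 \<le> ?j" using True J_nonneg by blast
  have "norm (dilatation_integrand w x y) = 1 / horizon_volume * (\<omega> y * ?j * (norm (y - x) * \<bar>strain y x w\<bar>))"
    using True horizon_volume_pos \<omega>_range[of y] j
    by (simp add: dilatation_integrand_def indicator_ball_eq abs_mult mult_ac)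
  also have "\<dots> \<le> 1 / horizon_volume * (1 * ?j * (norm (w y) + norm (w x)))"
    using horizon_volume_pos \<omega>_range[of y] j by (intro mult_left_mono mult_mono strain_bound) auto
  also have "\<dots> = scaled_kernel (1 / horizon_volume) 0 (y - x) * (norm (w y) + norm (w x))"
    using True by (simp add: scaled_kernel_def influence_kernel_def)
  finally show ?thesis .
qed (auto simp: dilatation_integrand_def indicator_ball_eq scaled_kernel_def influence_kernel_def)

text \<open>The dilatation is linear in the displacement, and its kernel has mass \<open>J_bar 0\<close>; the factor 2 comes from the
  two values \<open>u(y)\<close> and \<open>u(x)\<close> in the strain.\<close>

lemma dilatation_lipschitz:
  assumes u: "u \<in> L2_space D" and v: "v \<in> L2_space D"
  shows "\<theta> u \<in> borel_measurable borel" "integrable lborel (\<lambda>x. (\<theta> u x)\<^sup>2)"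
    and "integrable lborel (\<lambda>x. (\<theta> u x - \<theta> v x)\<^sup>2)"
    and "(LINT x|lborel. (\<theta> u x - \<theta> v x)\<^sup>2) \<le> (2 * J_bar TYPE('d) J 0 * L2_norm D (\<lambda>x. u x - v x))\<^sup>2"
proof -
  have k: "1 / horizon_volume \<ge> 0" using horizon_volume_pos by simp
  note uv = L2_space_diff[OF u v]
  have norm_props: "(\<lambda>x. norm (w x)) \<in> borel_measurable borel" "\<And>x. 0 \<le> norm (w x)"
    "integrable lborel (\<lambda>x. (norm (w x))\<^sup>2)" if "w \<in> L2_space D" for w
    using L2_spaceD(1,3)[OF that] by auto
  note km = scaled_kernel(1-3)[OF k order_refl zero_le_one]
  note A = Schur_integral_operator[OF dilatation_integrand_measurable[OF L2_spaceD(1)[OF u]]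
      dilatation_integrand_bound km norm_props[OF u]]
  show "\<theta> u \<in> borel_measurable borel" using A(1) by (simp add: dilatation_eq[abs_def])
  show "integrable lborel (\<lambda>x. (\<theta> u x)\<^sup>2)" using A(3) by (simp add: dilatation_eq)
  have d: "norm (dilatation_integrand u x y - dilatation_integrand v x y)
      \<le> scaled_kernel (1 / horizon_volume) 0 (y - x) * (norm (u y - v y) + norm (u x - v x))" for x y
    unfolding dilatation_integrand_diff by (rule dilatation_integrand_bound)
  note B = Schur_integral_operator_diff[OF dilatation_integrand_measurable[OF L2_spaceD(1)[OF u]]
      dilatation_integrand_measurable[OF L2_spaceD(1)[OF v]]
      dilatation_integrand_bound dilatation_integrand_bound d km norm_props[OF uv]
      norm_props[OF u] norm_props[OF v]]
  show "integrable lborel (\<lambda>x. (\<theta> u x - \<theta> v x)\<^sup>2)"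
    using B(1) by (simp add: dilatation_eq)
  show "(LINT x|lborel. (\<theta> u x - \<theta> v x)\<^sup>2) \<le> (2 * J_bar TYPE('d) J 0 * L2_norm D (\<lambda>x. u x - v x))\<^sup>2"
    using B(2) scaled_kernel_integral(1)[of 1] by (simp add: dilatation_eq power_mult_distrib L2_norm_eq_integral[OF uv])
qed

definition dilatational_integrand ::
  "(real \<Rightarrow> real) \<Rightarrow> (real ^ 'd \<Rightarrow> real) \<Rightarrow> real ^ 'd \<Rightarrow> real ^ 'd \<Rightarrow> real ^ 'd" where
  "dilatational_integrand h t x y = (1 / horizon_volume) *\<^sub>R (indicator (ball x \<epsilon>) y *\<^sub>R
     ((\<omega> x * \<omega> y * (J (norm (y - x) / \<epsilon>) / \<epsilon>\<^sup>2) * (h (t y) + h (t x))) *\<^sub>R sgn (y - x)))"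

lemma dilatational_force_eq:
  "dilatational_force \<epsilon> \<omega> J g u x = (LINT y|lborel. dilatational_integrand (deriv g) (\<theta> u) x y)"
  unfolding dilatational_force_def dilatational_integrand_def horizon_volume_def set_lebesgue_integral_def
  by (simp only: integral_scaleR_right)

lemma dilatational_integrand_measurable:
  assumes [measurable]: "h \<in> borel_measurable borel" "t \<in> borel_measurable borel"
  shows "(\<lambda>(x, y). dilatational_integrand h t x y) \<in> borel_measurable (borel \<Otimes>\<^sub>M borel)"
  unfolding dilatational_integrand_def indicator_ball_eq case_prod_unfold by measurable

lemma dilatational_integrand_diff_bound:
  assumes lip: "\<And>p q. \<bar>h p - h q\<bar> \<le> C * \<bar>p - q\<bar>"
  shows "norm (dilatational_integrand h s x y - dilatational_integrand h t x y)
    \<le> scaled_kernel (1 / \<epsilon>\<^sup>2 / horizon_volume) 0 (y - x) * (C * \<bar>s y - t y\<bar> + C * \<bar>s x - t x\<bar>)"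
proof (cases "norm (y - x) < \<epsilon> \<and> y \<noteq> x")
  case True
  let ?j = "J (norm (y - x) / \<epsilon>)"
  let ?h = "(h (s y) - h (t y)) + (h (s x) - h (t x))"
  have j: "0 \<le> ?j" using True J_nonneg by blast
  have C: "C \<ge> 0" using lip[of 1 0] by simp
  have "dilatational_integrand h s x y - dilatational_integrand h t x y
      = (1 / horizon_volume * (\<omega> x * \<omega> y * (?j / \<epsilon>\<^sup>2) * ?h)) *\<^sub>R sgn (y - x)"
  proof -
    have eq: "dilatational_integrand h t x y
        = (1 / horizon_volume * (\<omega> x * \<omega> y * (?j / \<epsilon>\<^sup>2) * (h (t y) + h (t x)))) *\<^sub>R sgn (y - x)" for t
      using True by (simp add: dilatational_integrand_def indicator_ball_eq)
    show ?thesis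
      unfolding eq scaleR_left_diff_distrib[symmetric] right_diff_distrib[symmetric] add_diff_add ..
  qed
  then have "norm (dilatational_integrand h s x y - dilatational_integrand h t x y)
      = 1 / horizon_volume * ((\<omega> x * \<omega> y) * (?j / \<epsilon>\<^sup>2) * \<bar>?h\<bar>)"
    using True horizon_volume_pos \<omega>_range[of y] \<omega>_range[of x] j by (simp add: norm_sgn abs_mult)
  also have "\<dots> \<le> 1 / horizon_volume * (1 * (?j / \<epsilon>\<^sup>2) * (C * \<bar>s y - t y\<bar> + C * \<bar>s x - t x\<bar>))"
  proof (intro mult_left_mono mult_mono)
    show "\<bar>?h\<bar> \<le> C * \<bar>s y - t y\<bar> + C * \<bar>s x - t x\<bar>"
      using lip[of "s y" "t y"] lip[of "s x" "t x"] by linarith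
    show "\<omega> x * \<omega> y \<le> 1"
      using \<omega>_range[of y] \<omega>_range[of x] by (intro mult_le_one) auto
  qed (use horizon_volume_pos \<omega>_range[of y] \<omega>_range[of x] j C in auto)
  also have "\<dots> = scaled_kernel (1 / \<epsilon>\<^sup>2 / horizon_volume) 0 (y - x) * (C * \<bar>s y - t y\<bar> + C * \<bar>s x - t x\<bar>)"
    using True by (simp add: scaled_kernel_def influence_kernel_def)
  finally show ?thesis .
qed (auto simp: dilatational_integrand_def indicator_ball_eq scaled_kernel_def influence_kernel_def)

lemma dilatational_integrand_bound:
  assumes lip: "\<And>p q. \<bar>h p - h q\<bar> \<le> C * \<bar>p - q\<bar>" and zero: "h 0 = 0"
  shows "norm (dilatational_integrand h t x y)
    \<le> scaled_kernel (1 / \<epsilon>\<^sup>2 / horizon_volume) 0 (y - x) * (C * \<bar>t y\<bar> + C * \<bar>t x\<bar>)"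
  using dilatational_integrand_diff_bound[OF lip, of t x y "\<lambda>_. 0"] zero
  by (simp add: dilatational_integrand_def)

text \<open>The dilatation enters at both ends of the bond, so the Schur test applies a second time, now
  to \<open>g' \<circ> \<theta>\<close>. This makes the zeroth moment appear squared and doubles the constant again.\<close>

lemma dilatational_force_lipschitz:
  assumes u: "u \<in> L2_space D" and v: "v \<in> L2_space D"
    and lip: "\<And>p q. \<bar>deriv g p - deriv g q\<bar> \<le> C * \<bar>p - q\<bar>" and zero: "deriv g 0 = 0"
    and meas: "deriv g \<in> borel_measurable borel"
  shows "dilatational_force \<epsilon> \<omega> J g u \<in> L2_space D"
    and "L2_norm D (\<lambda>x. dilatational_force \<epsilon> \<omega> J g u x - dilatational_force \<epsilon> \<omega> J g v x)
      \<le> 4 * (C * (J_bar TYPE('d) J 0)\<^sup>2) / \<epsilon>\<^sup>2 * L2_norm D (\<lambda>x. u x - v x)"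
proof -
  let ?F = "dilatational_force \<epsilon> \<omega> J g"
  have C: "C \<ge> 0" using lip[of 1 0] by simp
  have k: "1 / \<epsilon>\<^sup>2 / horizon_volume \<ge> 0" using horizon_volume_pos by simp
  note km = scaled_kernel(1-3)[OF k order_refl zero_le_one]
  have props: "(\<lambda>x. C * \<bar>\<theta> w x\<bar>) \<in> borel_measurable borel" "\<And>x. 0 \<le> C * \<bar>\<theta> w x\<bar>"
    "integrable lborel (\<lambda>x. (C * \<bar>\<theta> w x\<bar>)\<^sup>2)" if "w \<in> L2_space D" for w
    using C dilatation_lipschitz(1,2)[OF that that] by (auto simp: power_mult_distrib)
  have dprops: "(\<lambda>x. C * \<bar>\<theta> u x - \<theta> v x\<bar>) \<in> borel_measurable borel" "\<And>x. 0 \<le> C * \<bar>\<theta> u x - \<theta> v x\<bar>"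
    "integrable lborel (\<lambda>x. (C * \<bar>\<theta> u x - \<theta> v x\<bar>)\<^sup>2)"
    using C dilatation_lipschitz[OF u v] dilatation_lipschitz(1)[OF v u] by (auto simp: power_mult_distrib)
  have L2: "?F w \<in> L2_space D" if "w \<in> L2_space D" for w
  proof -
    note A = Schur_integral_operator[OF dilatational_integrand_measurable[OF meas dilatation_lipschitz(1)[OF that that]]
        dilatational_integrand_bound[OF lip zero] km props[OF that]]
    have "?F w x = 0" if "x \<notin> D" for x
      using \<omega>_outside[OF that] by (simp add: dilatational_force_def)
    with A(1,3) show ?thesis
      by (simp add: L2_space_def dilatational_force_eq[abs_def])
  qed
  then show "?F u \<in> L2_space D" using u .
  note B = Schur_integral_operator_diff[OF
      dilatational_integrand_measurable[OF meas dilatation_lipschitz(1)[OF u u]]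
      dilatational_integrand_measurable[OF meas dilatation_lipschitz(1)[OF v v]]
      dilatational_integrand_bound[OF lip zero] dilatational_integrand_bound[OF lip zero]
      dilatational_integrand_diff_bound[OF lip] km dprops props[OF u] props[OF v]]
  let ?N = "L2_norm D (\<lambda>x. u x - v x)" and ?j = "J_bar TYPE('d) J 0"
  have "(LINT x|lborel. (norm (?F u x - ?F v x))\<^sup>2)
      \<le> (2 * (1 / \<epsilon>\<^sup>2 * ?j))\<^sup>2 * (LINT x|lborel. (C * \<bar>\<theta> u x - \<theta> v x\<bar>)\<^sup>2)"
    using B(2) scaled_kernel_integral(1)[of "1 / \<epsilon>\<^sup>2"] unfolding dilatational_force_eq by (simp only: zero_le_divide_1_iff zero_le_power2)
  also have "\<dots> = (2 * (1 / \<epsilon>\<^sup>2 * ?j))\<^sup>2 * (C\<^sup>2 * (LINT x|lborel. (\<theta> u x - \<theta> v x)\<^sup>2))"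
    by (simp add: power_mult_distrib)
  also have "\<dots> \<le> (2 * (1 / \<epsilon>\<^sup>2 * ?j))\<^sup>2 * (C\<^sup>2 * (2 * ?j * ?N)\<^sup>2)"
    by (intro mult_left_mono dilatation_lipschitz(4)[OF u v]) auto
  also have "\<dots> = (4 * (C * ?j\<^sup>2) / \<epsilon>\<^sup>2 * ?N)\<^sup>2"
    by (simp add: power_mult_distrib power_divide power2_eq_square)
  finally show "L2_norm D (\<lambda>x. ?F u x - ?F v x) \<le> 4 * (C * ?j\<^sup>2) / \<epsilon>\<^sup>2 * ?N"
    using C by (intro L2_norm_le_of_integral[OF L2_space_diff[OF L2[OF u] L2[OF v]]]) auto
qed

definition tensile_integrand ::
  "(real \<Rightarrow> real) \<Rightarrow> (real ^ 'd \<Rightarrow> real ^ 'd) \<Rightarrow> real ^ 'd \<Rightarrow> real ^ 'd \<Rightarrow> real ^ 'd" where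
  "tensile_integrand h w x y = (2 / \<epsilon> / horizon_volume) *\<^sub>R (indicator (ball x \<epsilon>) y *\<^sub>R
     ((\<omega> x * \<omega> y * (J (norm (y - x) / \<epsilon>) / sqrt (norm (y - x))) *
       h (sqrt (norm (y - x)) * strain y x w)) *\<^sub>R sgn (y - x)))"

lemma tensile_force_eq:
  "tensile_force \<epsilon> \<omega> J f u x = (LINT y|lborel. tensile_integrand (deriv f) u x y)"
proof -
  have "2 / \<epsilon> / horizon_volume = 2 / (\<epsilon> ^ (CARD('d) + 1) * unit_ball_volume TYPE('d))"
    by (simp add: horizon_volume_def mult_ac)
  then show ?thesis
    unfolding tensile_force_def tensile_integrand_def set_lebesgue_integral_def
    by (simp only: integral_scaleR_right)
qed

lemma tensile_integrand_measurable:
  assumes [measurable]: "h \<in> borel_measurable borel" "w \<in> borel_measurable borel"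
  shows "(\<lambda>(x, y). tensile_integrand h w x y) \<in> borel_measurable (borel \<Otimes>\<^sub>M borel)"
proof -
  note [measurable] = strain_measurable[OF assms(2)]
  show ?thesis
    unfolding tensile_integrand_def indicator_ball_eq case_prod_unfold by measurable
qed

text \<open>The weights \<open>\<surd>|y - x|\<close> inside and outside of \<open>f'\<close> cancel against the Lipschitz bound, and one
  power of \<open>|y - x|\<close> remains from the strain; hence the first moment of the influence function.\<close>

lemma tensile_integrand_diff_bound:
  assumes lip: "\<And>p q. \<bar>h p - h q\<bar> \<le> C * \<bar>p - q\<bar>"
  shows "norm (tensile_integrand h u x y - tensile_integrand h v x y)
    \<le> scaled_kernel (2 / \<epsilon> / horizon_volume) 1 (y - x) * (C * norm (u y - v y) + C * norm (u x - v x))"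
proof (cases "norm (y - x) < \<epsilon> \<and> y \<noteq> x")
  case True
  let ?n = "norm (y - x)"
  let ?j = "J (?n / \<epsilon>)"
  let ?s = "strain y x (\<lambda>p. u p - v p)"
  let ?h = "h (sqrt ?n * strain y x u) - h (sqrt ?n * strain y x v)"
  have n: "?n > 0" using True by simp
  have j: "0 \<le> ?j" using True J_nonneg by blast
  have C: "C \<ge> 0" using lip[of 1 0] by simp
  have "tensile_integrand h u x y - tensile_integrand h v x y
      = (2 / \<epsilon> / horizon_volume * (\<omega> x * \<omega> y * (?j / sqrt ?n) * ?h)) *\<^sub>R sgn (y - x)"
  proof -
    have "tensile_integrand h w x y
        = (2 / \<epsilon> / horizon_volume * (\<omega> x * \<omega> y * (?j / sqrt ?n) * h (sqrt ?n * strain y x w))) *\<^sub>R sgn (y - x)" for w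
      using True by (simp add: tensile_integrand_def indicator_ball_eq)
    then show ?thesis
      by (simp only: scaleR_left_diff_distrib[symmetric] right_diff_distrib[symmetric])
  qed
  then have "norm (tensile_integrand h u x y - tensile_integrand h v x y)
      = 2 / \<epsilon> / horizon_volume * ((\<omega> x * \<omega> y) * ((?j / sqrt ?n) * \<bar>?h\<bar>))"
    using True horizon_volume_pos eps \<omega>_range[of y] \<omega>_range[of x] j by (simp add: norm_sgn abs_mult)
  also have "\<dots> \<le> 2 / \<epsilon> / horizon_volume * (1 * (?j / ?n * (C * (norm (u y - v y) + norm (u x - v x)))))"
  proof (rule mult_left_mono, rule mult_mono)
    have "\<bar>?h\<bar> \<le> C * \<bar>sqrt ?n * strain y x u - sqrt ?n * strain y x v\<bar>" by (rule lip)
    also have "\<dots> = C * (sqrt ?n * \<bar>?s\<bar>)"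
      by (simp add: strain_diff[symmetric] abs_mult flip: right_diff_distrib)
    finally have "?j / sqrt ?n * \<bar>?h\<bar> \<le> ?j / sqrt ?n * (C * (sqrt ?n * \<bar>?s\<bar>))"
      using j by (intro mult_left_mono) auto
    also have "\<dots> = ?j / ?n * (C * (?n * \<bar>?s\<bar>))"
      using n by simp
    also have "\<dots> \<le> ?j / ?n * (C * (norm (u y - v y) + norm (u x - v x)))"
      using j C by (intro mult_left_mono strain_bound) auto
    finally show "?j / sqrt ?n * \<bar>?h\<bar> \<le> ?j / ?n * (C * (norm (u y - v y) + norm (u x - v x)))" .
    show "\<omega> x * \<omega> y \<le> 1"
      using \<omega>_range[of y] \<omega>_range[of x] by (intro mult_le_one) auto
  qed (use horizon_volume_pos eps \<omega>_range[of y] \<omega>_range[of x] j C in auto)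
  also have "\<dots> = scaled_kernel (2 / \<epsilon> / horizon_volume) 1 (y - x) * (C * norm (u y - v y) + C * norm (u x - v x))"
    using True by (simp add: scaled_kernel_def influence_kernel_def powr_minus divide_inverse distrib_left)
  finally show ?thesis .
qed (auto simp: tensile_integrand_def indicator_ball_eq scaled_kernel_def influence_kernel_def)

lemma tensile_integrand_bound:
  assumes lip: "\<And>p q. \<bar>h p - h q\<bar> \<le> C * \<bar>p - q\<bar>" and zero: "h 0 = 0"
  shows "norm (tensile_integrand h w x y)
    \<le> scaled_kernel (2 / \<epsilon> / horizon_volume) 1 (y - x) * (C * norm (w y) + C * norm (w x))"
  using tensile_integrand_diff_bound[OF lip, of w x y "\<lambda>_. 0"] zero
  by (simp add: tensile_integrand_def strain_def)

lemma tensile_force_lipschitz: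
  assumes u: "u \<in> L2_space D" and v: "v \<in> L2_space D"
    and lip: "\<And>p q. \<bar>deriv f p - deriv f q\<bar> \<le> C * \<bar>p - q\<bar>" and zero: "deriv f 0 = 0"
    and meas: "deriv f \<in> borel_measurable borel"
  shows "tensile_force \<epsilon> \<omega> J f u \<in> L2_space D"
    and "L2_norm D (\<lambda>x. tensile_force \<epsilon> \<omega> J f u x - tensile_force \<epsilon> \<omega> J f v x)
      \<le> 4 * (C * J_bar TYPE('d) J 1) / \<epsilon>\<^sup>2 * L2_norm D (\<lambda>x. u x - v x)"
proof -
  let ?F = "tensile_force \<epsilon> \<omega> J f"
  have C: "C \<ge> 0" using lip[of 1 0] by simp
  have k: "2 / \<epsilon> / horizon_volume \<ge> 0" using horizon_volume_pos eps by simp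
  note km = scaled_kernel(1-3)[OF k zero_le_one order_refl]
  have props: "(\<lambda>x. C * norm (w x)) \<in> borel_measurable borel" "\<And>x. 0 \<le> C * norm (w x)"
    "integrable lborel (\<lambda>x. (C * norm (w x))\<^sup>2)" if "w \<in> L2_space D" for w
    using C L2_spaceD(1,3)[OF that] by (auto simp: power_mult_distrib)
  note uv = L2_space_diff[OF u v]
  have L2: "?F w \<in> L2_space D" if "w \<in> L2_space D" for w
  proof -
    note A = Schur_integral_operator[OF tensile_integrand_measurable[OF meas L2_spaceD(1)[OF that]]
        tensile_integrand_bound[OF lip zero] km props[OF that]]
    have "?F w x = 0" if "x \<notin> D" for x
      using \<omega>_outside[OF that] by (simp add: tensile_force_def)
    with A(1,3) show ?thesis
      by (simp add: L2_space_def tensile_force_eq[abs_def])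
  qed
  then show "?F u \<in> L2_space D" using u .
  note B = Schur_integral_operator_diff[OF
      tensile_integrand_measurable[OF meas L2_spaceD(1)[OF u]]
      tensile_integrand_measurable[OF meas L2_spaceD(1)[OF v]]
      tensile_integrand_bound[OF lip zero] tensile_integrand_bound[OF lip zero]
      tensile_integrand_diff_bound[OF lip] km props[OF uv] props[OF u] props[OF v]]
  let ?N = "L2_norm D (\<lambda>x. u x - v x)" and ?j = "J_bar TYPE('d) J 1"
  have "(LINT x|lborel. (norm (?F u x - ?F v x))\<^sup>2)
      \<le> (2 * (2 / \<epsilon> / \<epsilon> * ?j))\<^sup>2 * (LINT x|lborel. (C * norm (u x - v x))\<^sup>2)"
  proof -
    have "0 \<le> 2 / \<epsilon>" using eps by simp
    show ?thesis
      using B(2) unfolding tensile_force_eq scaled_kernel_integral(2)[OF \<open>0 \<le> 2 / \<epsilon>\<close>] .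
  qed
  also have "(LINT x|lborel. (C * norm (u x - v x))\<^sup>2) = C\<^sup>2 * ?N\<^sup>2"
    by (simp add: power_mult_distrib L2_norm_eq_integral[OF uv])
  also have "(2 * (2 / \<epsilon> / \<epsilon> * ?j))\<^sup>2 * (C\<^sup>2 * ?N\<^sup>2) = (4 * (C * ?j) / \<epsilon>\<^sup>2 * ?N)\<^sup>2"
    by (simp add: power_mult_distrib power_divide power2_eq_square)
  finally show "L2_norm D (\<lambda>x. ?F u x - ?F v x) \<le> 4 * (C * ?j) / \<epsilon>\<^sup>2 * ?N"
    using C J_bar_nonneg[OF infl, where 'd='d]
    by (intro L2_norm_le_of_integral[OF L2_space_diff[OF L2[OF u] L2[OF v]]]) auto
qed

end

text \<open>The second derivative is bounded by assumption, hence \<open>f'\<close> is Lipschitz; the well at 0 is a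
  minimum, hence \<open>f'(0) = 0\<close>, so that the force vanishes for the zero displacement.\<close>

lemma convex_concave_potential_deriv:
  assumes "convex_concave_potential f"
  shows "\<bar>deriv f p - deriv f q\<bar> \<le> potential_const 2 f * \<bar>p - q\<bar>"
    and "deriv f 0 = 0" and "deriv f \<in> borel_measurable borel"
proof -
  have diff: "(deriv ^^ i) f differentiable (at r)" if "i < 4" for i r
    using assms that by (auto simp: convex_concave_potential_def)
  have bdd: "bounded (range ((deriv ^^ i) f))" if "i \<le> 4" for i
    using assms that by (auto simp: convex_concave_potential_def)
  have f0: "f differentiable (at r)" for r using diff[of 0] by simp
  have f1: "(deriv f has_real_derivative deriv (deriv f) r) (at r)" for r
    using diff[of 1 r] by (auto simp: DERIV_deriv_iff_real_differentiable)
  have bound: "\<bar>deriv (deriv f) r\<bar> \<le> potential_const 2 f" for r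
  proof -
    obtain B where B: "\<And>r. norm ((deriv ^^ 2) f r) \<le> B"
      using bdd[of 2] by (auto simp: bounded_iff)
    have "bdd_above (range (\<lambda>r. \<bar>(deriv ^^ 2) f r\<bar>))"
      using B by (intro bdd_aboveI[of _ B]) auto
    then have "\<bar>(deriv ^^ 2) f r\<bar> \<le> (SUP r. \<bar>(deriv ^^ 2) f r\<bar>)"
      by (rule cSUP_upper[rotated]) simp
    then show ?thesis by (simp add: potential_const_def numeral_2_eq_2)
  qed
  have "norm (deriv f p - deriv f q) \<le> potential_const 2 f * norm (p - q)"
  proof (rule field_differentiable_bound)
    show "convex (UNIV :: real set)" by simp
    show "(deriv f has_real_derivative deriv (deriv f) z) (at z within UNIV)" for z
      by (rule f1)
    show "norm (deriv (deriv f) z) \<le> potential_const 2 f" for z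
      using bound by simp
  qed auto
  then show "\<bar>deriv f p - deriv f q\<bar> \<le> potential_const 2 f * \<bar>p - q\<bar>" by simp
  have "(f has_real_derivative deriv f 0) (at 0)"
    using f0 by (simp add: DERIV_deriv_iff_real_differentiable)
  then show "deriv f 0 = 0"
    by (rule DERIV_local_min[of _ _ _ 1]) (use assms in \<open>auto simp: convex_concave_potential_def\<close>)
  have "continuous_on UNIV (deriv f)"
    using f1 DERIV_isCont continuous_at_imp_continuous_on by blast
  then show "deriv f \<in> borel_measurable borel"
    by (rule borel_measurable_continuous_onI)
qed

lemma quadratic_potential_deriv:
  assumes "quadratic_potential g"
  shows "\<bar>deriv g p - deriv g q\<bar> \<le> deriv (deriv g) 0 * \<bar>p - q\<bar>"
    and "deriv g 0 = 0" and "deriv g \<in> borel_measurable borel"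
proof -
  obtain \<beta> where \<beta>: "\<beta> > 0" "g = (\<lambda>r. \<beta> * r\<^sup>2 / 2)"
    using assms by (auto simp: quadratic_potential_def)
  have g1: "deriv g = (\<lambda>r. \<beta> * r)"
  proof
    show "deriv g r = \<beta> * r" for r
      unfolding \<beta> by (rule DERIV_imp_deriv) (auto intro!: derivative_eq_intros)
  qed
  have g2: "deriv (deriv g) 0 = \<beta>"
    unfolding g1 by (rule DERIV_imp_deriv) (auto intro!: derivative_eq_intros)
  show "\<bar>deriv g p - deriv g q\<bar> \<le> deriv (deriv g) 0 * \<bar>p - q\<bar>"
    using \<beta>(1) by (simp only: g1 g2) (simp add: abs_mult flip: right_diff_distrib)
  show "deriv g 0 = 0" "deriv g \<in> borel_measurable borel" by (simp_all add: g1)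
qed

lemma (in bond_model) peridynamic_force_lipschitz:
  assumes f: "convex_concave_potential f"
    and g: "quadratic_potential g \<or> convex_concave_potential g"
    and u: "u \<in> L2_space D" and v: "v \<in> L2_space D"
  shows "peridynamic_force \<epsilon> \<omega> J f g u \<in> L2_space D"
    and "L2_norm D (\<lambda>x. peridynamic_force \<epsilon> \<omega> J f g u x - peridynamic_force \<epsilon> \<omega> J f g v x)
      \<le> lipschitz_const TYPE('d) J f g / \<epsilon>\<^sup>2 * L2_norm D (\<lambda>x. u x - v x)"
    and "lipschitz_const TYPE('d) J f g \<ge> 0"
proof -
  let ?C = "if quadratic_potential g then deriv (deriv g) 0 else potential_const 2 g"
  let ?N = "L2_norm D (\<lambda>x. u x - v x)"
  let ?T = "tensile_force \<epsilon> \<omega> J f" and ?E = "dilatational_force \<epsilon> \<omega> J g"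
  have g': "\<bar>deriv g p - deriv g q\<bar> \<le> ?C * \<bar>p - q\<bar>"
    "deriv g 0 = 0" "deriv g \<in> borel_measurable borel" for p q
    using g quadratic_potential_deriv[of g] convex_concave_potential_deriv[of g] by auto
  note f' = convex_concave_potential_deriv[OF f]
  note Tu = tensile_force_lipschitz(1)[OF u u f'] and Tv = tensile_force_lipschitz(1)[OF v v f']
    and Eu = dilatational_force_lipschitz(1)[OF u u g'] and Ev = dilatational_force_lipschitz(1)[OF v v g']
  show "peridynamic_force \<epsilon> \<omega> J f g u \<in> L2_space D"
    using L2_space_add[OF Tu Eu] by (simp add: peridynamic_force_def[abs_def])
  have "(\<lambda>x. peridynamic_force \<epsilon> \<omega> J f g u x - peridynamic_force \<epsilon> \<omega> J f g v x)
      = (\<lambda>x. (?T u x - ?T v x) + (?E u x - ?E v x))"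
    by (simp add: peridynamic_force_def algebra_simps)
  then have "L2_norm D (\<lambda>x. peridynamic_force \<epsilon> \<omega> J f g u x - peridynamic_force \<epsilon> \<omega> J f g v x)
      \<le> L2_norm D (\<lambda>x. ?T u x - ?T v x) + L2_norm D (\<lambda>x. ?E u x - ?E v x)"
    using L2_norm_triangle[OF L2_space_diff[OF Tu Tv] L2_space_diff[OF Eu Ev]] by simp
  also have "\<dots> \<le> 4 * (potential_const 2 f * J_bar TYPE('d) J 1) / \<epsilon>\<^sup>2 * ?N
      + 4 * (?C * (J_bar TYPE('d) J 0)\<^sup>2) / \<epsilon>\<^sup>2 * ?N"
    by (intro add_mono tensile_force_lipschitz(2)[OF u v f'] dilatational_force_lipschitz(2)[OF u v g'])
  also have "\<dots> = lipschitz_const TYPE('d) J f g / \<epsilon>\<^sup>2 * ?N"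
    by (simp only: lipschitz_const_def) (simp add: add_divide_distrib algebra_simps)
  finally show "L2_norm D (\<lambda>x. peridynamic_force \<epsilon> \<omega> J f g u x - peridynamic_force \<epsilon> \<omega> J f g v x)
      \<le> lipschitz_const TYPE('d) J f g / \<epsilon>\<^sup>2 * ?N" .
  have "?C \<ge> 0" "potential_const 2 f \<ge> 0"
    using g'(1)[of 1 0] f'(1)[of 1 0] by auto
  then show "lipschitz_const TYPE('d) J f g \<ge> 0"
    unfolding lipschitz_const_def using J_bar_nonneg[OF infl]
    by (intro mult_nonneg_nonneg add_nonneg_nonneg) auto
qed

lemma bond_model_of_assumptions:
  fixes D :: "(real ^ 'd::finite) set"
  assumes "CARD('d) \<ge> 2" "\<epsilon> > 0" "influence_function M J" "boundary_function D \<omega>"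
  shows "bond_model D \<omega> J M \<epsilon>"
  using assms by (intro bond_model.intro) (auto simp: boundary_function_def intro: borel_measurable_continuous_onI)

section \<open>Sobolev norms\<close>

lemma partials_Nil [simp]: "partials [] \<phi> = \<phi>"
  and partials_Cons [simp]: "partials (i # is) \<phi> = partials is (partial i \<phi>)"
  by (simp_all add: partials_def)

lemma partials_zero_outside:
  assumes "closed K" "\<And>x. x \<notin> K \<Longrightarrow> \<phi> x = 0" "x \<notin> K"
  shows "partials is \<phi> x = 0"
  using assms(2,3)
proof (induction "is" arbitrary: \<phi> x)
  case (Cons i "is")
  have "partial i \<phi> y = 0" if "y \<notin> K" for y
  proof -
    have "(\<phi> has_derivative (\<lambda>_. 0)) (at y)"
      by (rule has_derivative_transform_within_open[of "\<lambda>_. 0" _ _ _ "- K"])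
        (use that Cons.prems(1) assms(1) in \<open>auto simp: has_derivative_const\<close>)
    then show ?thesis by (simp add: partial_def frechet_derivative_at[symmetric])
  qed
  then show ?case using Cons by simp
qed simp

text \<open>Testing with a smooth compactly supported function is linear in the tested field because
  such a function is bounded with support of finite measure.\<close>

lemma test_function_integrable:
  fixes \<phi> :: "real ^ 'd::finite \<Rightarrow> real" and w :: "'d field"
  assumes \<phi>: "test_function D \<phi>" and w: "w \<in> L2_space D"
  shows "integrable lborel (\<lambda>x. partials is \<phi> x *\<^sub>R w x)"
proof -
  obtain K where K: "compact K" "\<And>x. x \<notin> K \<Longrightarrow> \<phi> x = 0"
    using \<phi> by (auto simp: test_function_def)
  let ?p = "partials is \<phi>"
  have cont: "continuous_on UNIV ?p"
    using \<phi> by (auto simp: test_function_def intro!: continuous_at_imp_continuous_on differentiable_imp_continuous_within)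
  then have [measurable]: "?p \<in> borel_measurable borel" by (rule borel_measurable_continuous_onI)
  note [measurable] = L2_spaceD(1)[OF w] borel_compact[OF K(1)]
  have "bounded (?p ` K)"
    using K(1) cont by (intro compact_imp_bounded compact_continuous_image) (auto intro: continuous_on_subset)
  then obtain B where B: "\<And>x. x \<in> K \<Longrightarrow> \<bar>?p x\<bar> \<le> B" by (auto simp: bounded_iff)
  have zero: "?p x = 0" if "x \<notin> K" for x
    using partials_zero_outside[of K \<phi> x "is"] K that compact_imp_closed by auto
  show ?thesis
  proof (rule Bochner_Integration.integrable_bound)
    show "integrable lborel (\<lambda>x. \<bar>B\<bar> * (indicator K x + (norm (w x))\<^sup>2))"
      using K(1) L2_spaceD(3)[OF w]
      by (intro integrable_mult_right Bochner_Integration.integrable_add integrable_real_indicator)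
        (use emeasure_bounded_finite[OF compact_imp_bounded[OF K(1)]] in auto)
    show "(\<lambda>x. ?p x *\<^sub>R w x) \<in> borel_measurable lborel" by measurable
    have "norm (?p x *\<^sub>R w x) \<le> norm (\<bar>B\<bar> * (indicator K x + (norm (w x))\<^sup>2))" for x
    proof (cases "x \<in> K")
      case True
      have "norm (w x) \<le> 1 + (norm (w x))\<^sup>2"
        using sum_squares_bound[of "norm (w x)" 1] norm_ge_zero[of "w x"]
        unfolding power_one mult_1_right by linarith
      then have "\<bar>?p x\<bar> * norm (w x) \<le> \<bar>B\<bar> * (1 + (norm (w x))\<^sup>2)"
        using B[OF True] by (intro mult_mono) auto
      then show ?thesis using True by (simp add: abs_mult)
    qed (simp add: zero)
    then show "AE x in lborel. norm (?p x *\<^sub>R w x) \<le> norm (\<bar>B\<bar> * (indicator K x + (norm (w x))\<^sup>2))"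
      by (intro AE_I2)
  qed
qed

lemma test_integral_eq:
  fixes w :: "'d::finite field"
  assumes "w \<in> L2_space D"
  shows "(LINT x:D|lborel. p x *\<^sub>R w x) = (LINT x|lborel. p x *\<^sub>R w x)"
proof -
  have "(\<lambda>x. indicator D x *\<^sub>R (p x *\<^sub>R w x)) = (\<lambda>x. p x *\<^sub>R w x)"
    using L2_spaceD(2)[OF assms] by (auto simp: indicator_def fun_eq_iff)
  then show ?thesis by (simp add: set_lebesgue_integral_def)
qed

lemma weak_derivative_add:
  assumes L2: "w \<in> L2_space D" "w' \<in> L2_space D" "z \<in> L2_space D" "z' \<in> L2_space D"
    and "weak_derivative D is w z" "weak_derivative D is w' z'"
  shows "weak_derivative D is (\<lambda>x. w x + w' x) (\<lambda>x. z x + z' x)"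
  unfolding weak_derivative_def
proof (intro allI impI)
  fix \<phi> :: "real ^ 'a \<Rightarrow> real"
  assume \<phi>: "test_function D \<phi>"
  have I: "(LINT x:D|lborel. partials js \<phi> x *\<^sub>R (p x + q x))
      = (LINT x:D|lborel. partials js \<phi> x *\<^sub>R p x) + (LINT x:D|lborel. partials js \<phi> x *\<^sub>R q x)"
    if "p \<in> L2_space D" "q \<in> L2_space D" for js p q
  proof -
    have "(LINT x:D|lborel. partials js \<phi> x *\<^sub>R (p x + q x))
        = (LINT x|lborel. partials js \<phi> x *\<^sub>R p x + partials js \<phi> x *\<^sub>R q x)"
      unfolding test_integral_eq[OF L2_space_add[OF that]] by (simp only: scaleR_add_right)
    also have "\<dots> = (LINT x|lborel. partials js \<phi> x *\<^sub>R p x) + (LINT x|lborel. partials js \<phi> x *\<^sub>R q x)"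
      by (intro Bochner_Integration.integral_add test_function_integrable[OF \<phi>] that)
    finally show ?thesis by (simp only: that test_integral_eq)
  qed
  show "(LINT x:D|lborel. partials is \<phi> x *\<^sub>R (w x + w' x))
      = (- 1) ^ length is *\<^sub>R (LINT x:D|lborel. \<phi> x *\<^sub>R (z x + z' x))"
    unfolding I[OF L2(1,2)] I[OF L2(3,4), of "[]", unfolded partials_Nil]
    using assms(5,6) \<phi> by (simp add: weak_derivative_def scaleR_add_right)
qed

lemma weak_derivative_scaleR:
  assumes "weak_derivative D is w z"
  shows "weak_derivative D is (\<lambda>x. s *\<^sub>R w x) (\<lambda>x. s *\<^sub>R z x)"
proof -
  have I: "(LINT x:D|lborel. p x *\<^sub>R s *\<^sub>R w x) = s *\<^sub>R (LINT x:D|lborel. p x *\<^sub>R w x)" for p w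
  proof -
    have "(\<lambda>x. indicator D x *\<^sub>R p x *\<^sub>R s *\<^sub>R w x) = (\<lambda>x. s *\<^sub>R indicator D x *\<^sub>R p x *\<^sub>R w x)"
      by (simp add: mult_ac)
    then show ?thesis unfolding set_lebesgue_integral_def by (simp only: integral_scaleR_right)
  qed
  show ?thesis
    unfolding weak_derivative_def I
  proof (intro allI impI)
    fix \<phi> :: "real ^ 'a \<Rightarrow> real"
    assume "test_function D \<phi>"
    then have "(LINT x:D|lborel. partials is \<phi> x *\<^sub>R w x) = (- 1) ^ length is *\<^sub>R (LINT x:D|lborel. \<phi> x *\<^sub>R z x)"
      using assms by (simp add: weak_derivative_def)
    then show "s *\<^sub>R (LINT x:D|lborel. partials is \<phi> x *\<^sub>R w x)
        = (- 1) ^ length is *\<^sub>R s *\<^sub>R (LINT x:D|lborel. \<phi> x *\<^sub>R z x)"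
      by (simp only: scaleR_left_commute)
  qed
qed

text \<open>The families of weak derivatives over which the norm of order \<open>m\<close> takes its infimum. The
  norm is well behaved only if such a family exists, which holds in \<open>H\<^sup>m\<close>.\<close>

definition weak_gradients :: "nat \<Rightarrow> (real ^ 'd) set \<Rightarrow> ('d::finite) field \<Rightarrow> ('d list \<Rightarrow> 'd field) set" where
  "weak_gradients m D w = {G. \<forall>is. length is = m \<longrightarrow> G is \<in> L2_space D \<and> weak_derivative D is w (G is)}"

definition gradient_norm :: "nat \<Rightarrow> (real ^ 'd) set \<Rightarrow> ('d::finite list \<Rightarrow> 'd field) \<Rightarrow> real" where
  "gradient_norm m D G = L2_set (\<lambda>is. L2_norm D (G is)) {is. length is = m}"

lemma weak_norm_altdef: "weak_norm m D w = Inf (gradient_norm m D ` weak_gradients m D w)"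
  unfolding weak_norm_def gradient_norm_def weak_gradients_def L2_set_def
  by (rule arg_cong[of _ _ Inf]) auto

lemma gradient_norm_nonneg: "0 \<le> gradient_norm m D G"
  by (simp add: gradient_norm_def)

lemma weak_norm_le: "G \<in> weak_gradients m D w \<Longrightarrow> weak_norm m D w \<le> gradient_norm m D G"
  unfolding weak_norm_altdef
  by (intro cInf_lower bdd_belowI[of _ 0]) (auto simp: gradient_norm_nonneg)

lemma weak_norm_ge:
  assumes "weak_gradients m D w \<noteq> {}" "\<And>G. G \<in> weak_gradients m D w \<Longrightarrow> B \<le> gradient_norm m D G"
  shows "B \<le> weak_norm m D w"
  unfolding weak_norm_altdef using assms by (intro cInf_greatest) auto

lemma weak_gradients_add:
  assumes "w \<in> L2_space D" "w' \<in> L2_space D" "G \<in> weak_gradients m D w" "G' \<in> weak_gradients m D w'"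
  shows "(\<lambda>is x. G is x + G' is x) \<in> weak_gradients m D (\<lambda>x. w x + w' x)"
  using assms by (auto simp: weak_gradients_def L2_space_add intro!: weak_derivative_add)

lemma weak_gradients_scaleR:
  assumes "G \<in> weak_gradients m D w"
  shows "(\<lambda>is x. s *\<^sub>R G is x) \<in> weak_gradients m D (\<lambda>x. s *\<^sub>R w x)"
  using assms by (auto simp: weak_gradients_def L2_space_scaleR intro!: weak_derivative_scaleR)

lemma weak_norm_triangle:
  assumes w: "w \<in> L2_space D" "w' \<in> L2_space D"
    and ne: "weak_gradients m D w \<noteq> {}" "weak_gradients m D w' \<noteq> {}"
  shows "weak_norm m D (\<lambda>x. w x + w' x) \<le> weak_norm m D w + weak_norm m D w'"
proof -
  have *: "weak_norm m D (\<lambda>x. w x + w' x) \<le> gradient_norm m D G + gradient_norm m D G'"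
    if G: "G \<in> weak_gradients m D w" "G' \<in> weak_gradients m D w'" for G G'
  proof -
    have "weak_norm m D (\<lambda>x. w x + w' x) \<le> gradient_norm m D (\<lambda>is x. G is x + G' is x)"
      by (intro weak_norm_le weak_gradients_add w G)
    also have "\<dots> \<le> L2_set (\<lambda>is. L2_norm D (G is) + L2_norm D (G' is)) {is. length is = m}"
      unfolding gradient_norm_def
      using G by (intro L2_set_mono L2_norm_triangle) (auto simp: weak_gradients_def)
    also have "\<dots> \<le> gradient_norm m D G + gradient_norm m D G'"
      unfolding gradient_norm_def by (rule L2_set_triangle_ineq)
    finally show ?thesis .
  qed
  have "weak_norm m D (\<lambda>x. w x + w' x) - gradient_norm m D G \<le> weak_norm m D w'"
    if "G \<in> weak_gradients m D w" for G
  proof (rule weak_norm_ge[OF ne(2)])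
    fix G' assume "G' \<in> weak_gradients m D w'"
    from *[OF that this] show "weak_norm m D (\<lambda>x. w x + w' x) - gradient_norm m D G \<le> gradient_norm m D G'"
      by simp
  qed
  then have "weak_norm m D (\<lambda>x. w x + w' x) - weak_norm m D w' \<le> weak_norm m D w"
    by (intro weak_norm_ge[OF ne(1)]) (auto simp: algebra_simps)
  then show ?thesis by simp
qed

lemma weak_norm_scaleR_le:
  assumes "weak_gradients m D w \<noteq> {}"
  shows "weak_norm m D (\<lambda>x. s *\<^sub>R w x) \<le> \<bar>s\<bar> * weak_norm m D w"
proof (cases "s = 0")
  case True
  obtain G where G: "G \<in> weak_gradients m D w" using assms by blast
  have "weak_norm m D (\<lambda>x. s *\<^sub>R w x) \<le> gradient_norm m D (\<lambda>is x. s *\<^sub>R G is x)"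
    by (intro weak_norm_le weak_gradients_scaleR G)
  also have "\<dots> = 0" using True by (simp add: gradient_norm_def L2_norm_def L2_inner_def L2_set_def)
  finally show ?thesis using True by simp
next
  case False
  have "weak_norm m D (\<lambda>x. s *\<^sub>R w x) / \<bar>s\<bar> \<le> weak_norm m D w"
  proof (rule weak_norm_ge[OF assms])
    fix G assume G: "G \<in> weak_gradients m D w"
    have "weak_norm m D (\<lambda>x. s *\<^sub>R w x) \<le> gradient_norm m D (\<lambda>is x. s *\<^sub>R G is x)"
      by (intro weak_norm_le weak_gradients_scaleR G)
    also have "\<dots> = \<bar>s\<bar> * gradient_norm m D G"
      by (simp add: gradient_norm_def L2_norm_scaleR L2_set_right_distrib)
    finally show "weak_norm m D (\<lambda>x. s *\<^sub>R w x) / \<bar>s\<bar> \<le> gradient_norm m D G"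
      using False by (simp add: pos_divide_le_eq mult.commute)
  qed
  then show ?thesis using False by (simp add: pos_divide_le_eq mult.commute)
qed

text \<open>The space on which the \<open>H\<^sup>2\<close> norm is a seminorm dominating the \<open>L\<^sup>2\<close> norm.\<close>

definition H2_fields :: "(real ^ 'd) set \<Rightarrow> ('d::finite) field set" where
  "H2_fields D = {w \<in> L2_space D. weak_gradients 1 D w \<noteq> {} \<and> weak_gradients 2 D w \<noteq> {}}"

lemma W_space_subset: "W_space D \<subseteq> H2_fields D"
proof
  fix w :: "'a field" assume "w \<in> W_space D"
  then have w: "w \<in> L2_space D" "\<forall>is. length is \<le> 2 \<longrightarrow> (\<exists>z\<in>L2_space D. weak_derivative D is w z)"
    by (auto simp: W_space_def Sobolev_space_def)
  then obtain G where "\<And>is. length is \<le> 2 \<Longrightarrow> G is \<in> L2_space D \<and> weak_derivative D is w (G is)"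
    by metis
  then have "G \<in> weak_gradients 1 D w" "G \<in> weak_gradients 2 D w"
    by (auto simp: weak_gradients_def)
  then show "w \<in> H2_fields D" using w(1) by (auto simp: H2_fields_def)
qed

lemma H2_fields_L2: "w \<in> H2_fields D \<Longrightarrow> w \<in> L2_space D"
  by (simp add: H2_fields_def)

lemma H2_fields_add:
  assumes "w \<in> H2_fields D" "z \<in> H2_fields D"
  shows "(\<lambda>x. w x + z x) \<in> H2_fields D"
proof -
  have w: "w \<in> L2_space D" and z: "z \<in> L2_space D" using assms by (auto simp: H2_fields_def)
  have "weak_gradients m D (\<lambda>x. w x + z x) \<noteq> {}"
    if "weak_gradients m D w \<noteq> {}" "weak_gradients m D z \<noteq> {}" for m
    using weak_gradients_add[OF w z] that by blast
  then show ?thesis using assms by (auto simp: H2_fields_def L2_space_add)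
qed

lemma H2_fields_scaleR:
  assumes "w \<in> H2_fields D"
  shows "(\<lambda>x. s *\<^sub>R w x) \<in> H2_fields D"
proof -
  have "weak_gradients m D (\<lambda>x. s *\<^sub>R w x) \<noteq> {}" if "weak_gradients m D w \<noteq> {}" for m
    using weak_gradients_scaleR[of _ m D w s] that by blast
  then show ?thesis using assms by (auto simp: H2_fields_def L2_space_scaleR)
qed

lemma H2_fields_diff:
  assumes "w \<in> H2_fields D" "z \<in> H2_fields D"
  shows "(\<lambda>x. w x - z x) \<in> H2_fields D"
  using H2_fields_add[OF assms(1) H2_fields_scaleR[OF assms(2), of "-1"]] by simp

lemma H2_norm_triangle:
  assumes "w \<in> H2_fields D" "z \<in> H2_fields D"
  shows "H2_norm D (\<lambda>x. w x + z x) \<le> H2_norm D w + H2_norm D z"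
  using assms L2_norm_triangle[of w D z] weak_norm_triangle[of w D z 1] weak_norm_triangle[of w D z 2]
  by (simp add: H2_norm_def H2_fields_def)

lemma H2_norm_scaleR_le:
  assumes "w \<in> H2_fields D"
  shows "H2_norm D (\<lambda>x. s *\<^sub>R w x) \<le> \<bar>s\<bar> * H2_norm D w"
  using assms weak_norm_scaleR_le[of 1 D w s] weak_norm_scaleR_le[of 2 D w s]
  by (simp add: H2_norm_def H2_fields_def L2_norm_scaleR distrib_left)

text \<open>Weak norms are nonnegative because weak derivatives exist here; without them the infimum of the empty set
  would be an unspecified real number.\<close>

lemma H2_norm_ge_L2_norm:
  assumes "w \<in> H2_fields D"
  shows "L2_norm D w \<le> H2_norm D w"
  using assms weak_norm_ge[OF _ gradient_norm_nonneg, of 1 D w] weak_norm_ge[OF _ gradient_norm_nonneg, of 2 D w]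
  by (simp add: H2_norm_def H2_fields_def)

lemma H2_norm_nonneg:
  assumes "w \<in> H2_fields D"
  shows "0 \<le> H2_norm D w"
  using H2_norm_ge_L2_norm[OF assms] L2_norm_nonneg[of D w] by linarith

section \<open>Curves in the energy space\<close>

lemma H2_norm_minus_commute:
  assumes "w \<in> H2_fields D" "z \<in> H2_fields D"
  shows "H2_norm D (\<lambda>x. w x - z x) = H2_norm D (\<lambda>x. z x - w x)"
  using H2_norm_scaleR_le[OF H2_fields_diff[OF assms], of "-1"]
    H2_norm_scaleR_le[OF H2_fields_diff[OF assms(2,1)], of "-1"] by simp

lemma H2_norm_diff_ineq:
  assumes "w \<in> H2_fields D" "z \<in> H2_fields D"
  shows "\<bar>H2_norm D w - H2_norm D z\<bar> \<le> H2_norm D (\<lambda>x. w x - z x)"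
  using H2_norm_triangle[OF H2_fields_diff[OF assms] assms(2)]
    H2_norm_triangle[OF H2_fields_diff[OF assms(2,1)] assms(1)] H2_norm_minus_commute[OF assms]
  by simp

lemma time_derivative_imp_continuous:
  assumes w: "\<And>t. t \<in> {0..T} \<Longrightarrow> w t \<in> H2_fields D" and z: "\<And>t. t \<in> {0..T} \<Longrightarrow> z t \<in> H2_fields D"
    and deriv: "has_time_derivative D T w z"
  shows "time_continuous D T w"
  unfolding time_continuous_def
proof
  fix t assume t: "t \<in> {0..T}"
  let ?F = "at t within {0..T}"
  let ?q = "\<lambda>s x. (w s x - w t x) /\<^sub>R (s - t) - z t x"
  have lim: "((\<lambda>s. \<bar>s - t\<bar> * H2_norm D (?q s) + \<bar>s - t\<bar> * H2_norm D (z t)) \<longlongrightarrow> 0) ?F"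
  proof -
    have "((\<lambda>s. H2_norm D (?q s)) \<longlongrightarrow> 0) ?F"
      using deriv t by (simp add: has_time_derivative_def)
    moreover have "((\<lambda>s. \<bar>s - t\<bar>) \<longlongrightarrow> \<bar>t - t\<bar>) ?F" by (intro tendsto_intros)
    ultimately have "((\<lambda>s. \<bar>s - t\<bar> * H2_norm D (?q s) + \<bar>s - t\<bar> * H2_norm D (z t))
        \<longlongrightarrow> \<bar>t - t\<bar> * 0 + \<bar>t - t\<bar> * H2_norm D (z t)) ?F"
      by (intro tendsto_intros)
    then show ?thesis by simp
  qed
  have "norm (H2_norm D (\<lambda>x. w s x - w t x)) \<le> \<bar>s - t\<bar> * H2_norm D (?q s) + \<bar>s - t\<bar> * H2_norm D (z t)"
    if s: "s \<in> {0..T}" "s \<noteq> t" for s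
  proof -
    have q: "?q s \<in> H2_fields D"
      using w[OF s(1)] w[OF t] z[OF t] by (intro H2_fields_diff H2_fields_scaleR)
    have "(\<lambda>x. w s x - w t x) = (\<lambda>x. (s - t) *\<^sub>R ?q s x + (s - t) *\<^sub>R z t x)"
      using s by (simp add: scaleR_diff_right)
    then have "H2_norm D (\<lambda>x. w s x - w t x)
        \<le> H2_norm D (\<lambda>x. (s - t) *\<^sub>R ?q s x) + H2_norm D (\<lambda>x. (s - t) *\<^sub>R z t x)"
      using H2_norm_triangle[OF H2_fields_scaleR[OF q] H2_fields_scaleR[OF z[OF t]], of "s - t" "s - t"] by simp
    also have "\<dots> \<le> \<bar>s - t\<bar> * H2_norm D (?q s) + \<bar>s - t\<bar> * H2_norm D (z t)"
      by (intro add_mono H2_norm_scaleR_le q z t)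
    finally show ?thesis
      using H2_norm_nonneg[OF H2_fields_diff[OF w[OF s(1)] w[OF t]]] by simp
  qed
  then show "((\<lambda>s. H2_norm D (\<lambda>x. w s x - w t x)) \<longlongrightarrow> 0) ?F"
    by (intro Lim_null_comparison[OF _ lim]) (auto simp: eventually_at_filter)
qed

text \<open>Continuity on a compact interval makes the suprema over time genuine upper bounds.\<close>

lemma time_continuous_bdd_above:
  assumes w: "\<And>t. t \<in> {0..T} \<Longrightarrow> w t \<in> H2_fields D" and cont: "time_continuous D T w"
  shows "bdd_above ((\<lambda>t. H2_norm D (w t)) ` {0..T})" "bdd_above ((\<lambda>t. L2_norm D (w t)) ` {0..T})"
proof -
  have "continuous_on {0..T} (\<lambda>t. H2_norm D (w t))"
    unfolding continuous_on_def
  proof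
    fix t assume t: "t \<in> {0..T}"
    have "((\<lambda>s. H2_norm D (\<lambda>x. w s x - w t x)) \<longlongrightarrow> 0) (at t within {0..T})"
      using cont t by (simp add: time_continuous_def)
    moreover have "\<forall>\<^sub>F s in at t within {0..T}.
        norm (H2_norm D (w s) - H2_norm D (w t)) \<le> H2_norm D (\<lambda>x. w s x - w t x)"
      using H2_norm_diff_ineq[OF w w[OF t]] by (auto simp: eventually_at_filter)
    ultimately have "((\<lambda>s. H2_norm D (w s) - H2_norm D (w t)) \<longlongrightarrow> 0) (at t within {0..T})"
      by (rule Lim_null_comparison[rotated])
    then show "((\<lambda>s. H2_norm D (w s)) \<longlongrightarrow> H2_norm D (w t)) (at t within {0..T})"
      by (rule LIM_zero_cancel)
  qed
  then have "bounded ((\<lambda>t. H2_norm D (w t)) ` {0..T})"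
    by (intro compact_imp_bounded compact_continuous_image) auto
  then show bdd: "bdd_above ((\<lambda>t. H2_norm D (w t)) ` {0..T})"
    by (rule bounded_imp_bdd_above)
  then obtain B where "\<And>t. t \<in> {0..T} \<Longrightarrow> H2_norm D (w t) \<le> B" unfolding bdd_above_def by blast
  then have "L2_norm D (w t) \<le> B" if "t \<in> {0..T}" for t
    using H2_norm_ge_L2_norm[OF w[OF that]] that by (meson order_trans)
  then show "bdd_above ((\<lambda>t. L2_norm D (w t)) ` {0..T})" by (intro bdd_aboveI[of _ B]) auto
qed

lemma time_derivative_L2_inner:
  assumes w: "\<And>t. t \<in> {0..T} \<Longrightarrow> w t \<in> H2_fields D" and z: "\<And>t. t \<in> {0..T} \<Longrightarrow> z t \<in> H2_fields D"
    and deriv: "has_time_derivative D T w z" and y: "y \<in> L2_space D" and t: "t \<in> {0..T}"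
  shows "((\<lambda>s. L2_inner D (w s) y) has_real_derivative L2_inner D (z t) y) (at t within {0..T})"
  unfolding has_field_derivative_iff
proof (rule LIM_zero_cancel)
  let ?F = "at t within {0..T}"
  let ?q = "\<lambda>s x. (w s x - w t x) /\<^sub>R (s - t) - z t x"
  have "((\<lambda>s. H2_norm D (?q s)) \<longlongrightarrow> 0) ?F"
    using deriv t by (simp add: has_time_derivative_def)
  then have lim: "((\<lambda>s. H2_norm D (?q s) * L2_norm D y) \<longlongrightarrow> 0) ?F"
    by (rule tendsto_mult_left_zero)
  have "norm ((L2_inner D (w s) y - L2_inner D (w t) y) / (s - t) - L2_inner D (z t) y)
      \<le> H2_norm D (?q s) * L2_norm D y" if s: "s \<in> {0..T}" "s \<noteq> t" for s
  proof -
    have q: "?q s \<in> H2_fields D"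
      using w[OF s(1)] w[OF t] z[OF t] by (intro H2_fields_diff H2_fields_scaleR)
    note L2 = w[OF s(1), THEN H2_fields_L2] w[OF t, THEN H2_fields_L2] z[OF t, THEN H2_fields_L2]
    have "L2_inner D (?q s) y = L2_inner D (\<lambda>x. (w s x - w t x) /\<^sub>R (s - t)) y - L2_inner D (z t) y"
      by (intro L2_inner_diff_left L2_space_scaleR L2_space_diff L2 y)
    also have "\<dots> = (L2_inner D (w s) y - L2_inner D (w t) y) / (s - t) - L2_inner D (z t) y"
      by (simp add: L2_inner_scaleR_left L2_inner_diff_left[OF L2(1,2) y] divide_inverse mult.commute)
    finally have "norm ((L2_inner D (w s) y - L2_inner D (w t) y) / (s - t) - L2_inner D (z t) y)
        = \<bar>L2_inner D (?q s) y\<bar>" by simp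
    also have "\<dots> \<le> L2_norm D (?q s) * L2_norm D y"
      by (rule L2_Cauchy_Schwarz[OF H2_fields_L2[OF q] y])
    also have "\<dots> \<le> H2_norm D (?q s) * L2_norm D y"
      by (intro mult_right_mono H2_norm_ge_L2_norm q) simp
    finally show ?thesis .
  qed
  then show "((\<lambda>s. (L2_inner D (w s) y - L2_inner D (w t) y) / (s - t) - L2_inner D (z t) y) \<longlongrightarrow> 0) ?F"
    by (intro Lim_null_comparison[OF _ lim]) (auto simp: eventually_at_filter)
qed

text \<open>First-order Taylor formula at either end point of the interval, with the sharp constant
  \<open>1/2\<close>.\<close>

lemma difference_quotient_error_real:
  fixes \<phi> \<phi>' \<phi>'' :: "real \<Rightarrow> real"
  assumes d1: "\<And>t. t \<in> {0..T} \<Longrightarrow> (\<phi> has_real_derivative \<phi>' t) (at t within {0..T})"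
    and d2: "\<And>t. t \<in> {0..T} \<Longrightarrow> (\<phi>' has_real_derivative \<phi>'' t) (at t within {0..T})"
    and K: "\<And>t. t \<in> {0..T} \<Longrightarrow> \<bar>\<phi>'' t\<bar> \<le> K"
    and t: "0 \<le> t0" "t0 < t1" "t1 \<le> T" and s: "s = t0 \<or> s = t1"
  shows "\<bar>\<phi>' s - (\<phi> t1 - \<phi> t0) / (t1 - t0)\<bar> \<le> (t1 - t0) / 2 * K"
proof -
  \<comment> \<open>The sign for which \<open>\<sigma> K (\<tau> - s)\<^sup>2 / 2\<close> is nondecreasing in \<open>\<tau>\<close> on the interval.\<close>
  define \<sigma> :: real where "\<sigma> = (if s = t0 then 1 else -1)"
  have lip: "norm (\<phi>' \<tau> - \<phi>' s) \<le> K * norm (\<tau> - s)" if "\<tau> \<in> {0..T}" for \<tau>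
    by (rule field_differentiable_bound[of "{0..T}" _ "\<phi>''"]) (use d2 K that s t in auto)
  let ?f = "\<lambda>\<tau>. \<phi> \<tau> - \<tau> * \<phi>' s"
  let ?g = "\<lambda>\<tau>. \<sigma> * K * (\<tau> - s)\<^sup>2 / 2"
  have "norm (?f t1 - ?f t0) \<le> ?g t1 - ?g t0"
  proof (rule differentiable_bound_general)
    show "t0 < t1" by (rule t)
    have "continuous_on {0..T} \<phi>"
      by (rule DERIV_continuous_on[OF d1])
    then have "continuous_on {t0..t1} \<phi>"
      using t by (elim continuous_on_subset) auto
    then show "continuous_on {t0..t1} ?f" by (intro continuous_intros)
    show "continuous_on {t0..t1} ?g" by (intro continuous_intros) auto
    fix \<tau> assume \<tau>: "t0 < \<tau>" "\<tau> < t1"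
    then have in_T: "\<tau> \<in> {0..T}" using t by auto
    have "(\<phi> has_real_derivative \<phi>' \<tau>) (at \<tau> within {t0<..<t1})"
      by (rule has_field_derivative_subset[OF d1[OF in_T]]) (use t in auto)
    then have "(\<phi> has_real_derivative \<phi>' \<tau>) (at \<tau>)"
      using at_within_open[of \<tau> "{t0<..<t1}"] \<tau> by simp
    then have "(?f has_real_derivative \<phi>' \<tau> - \<phi>' s) (at \<tau>)"
      by (auto intro!: derivative_eq_intros)
    then show "(?f has_vector_derivative \<phi>' \<tau> - \<phi>' s) (at \<tau>)"
      by (simp add: has_real_derivative_iff_has_vector_derivative)
    have "(?g has_real_derivative \<sigma> * K * (\<tau> - s)) (at \<tau>)"
      by (auto intro!: derivative_eq_intros)
    then show "(?g has_vector_derivative \<sigma> * K * (\<tau> - s)) (at \<tau>)"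
      by (simp add: has_real_derivative_iff_has_vector_derivative)
    have "\<bar>\<tau> - s\<bar> = \<sigma> * (\<tau> - s)" using s \<tau> by (auto simp: \<sigma>_def)
    then show "norm (\<phi>' \<tau> - \<phi>' s) \<le> \<sigma> * K * (\<tau> - s)"
      using lip[OF in_T] by (simp add: mult_ac)
  qed
  also have "?g t1 - ?g t0 = K * (t1 - t0)\<^sup>2 / 2"
    using s t by (auto simp: \<sigma>_def power2_commute)
  also have "?f t1 - ?f t0 = - ((t1 - t0) * (\<phi>' s - (\<phi> t1 - \<phi> t0) / (t1 - t0)))"
    using t by (simp add: field_simps)
  finally have "(t1 - t0) * \<bar>\<phi>' s - (\<phi> t1 - \<phi> t0) / (t1 - t0)\<bar> \<le> (t1 - t0) * ((t1 - t0) / 2 * K)"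
    using t by (simp add: abs_mult power2_eq_square mult.commute)
  then show ?thesis by (rule mult_left_le_imp_le) (use t in simp)
qed

text \<open>The truncation error of a difference quotient in \<open>L\<^sup>2\<close>, by testing the error with itself.\<close>

lemma difference_quotient_error:
  assumes w: "\<And>t. t \<in> {0..T} \<Longrightarrow> w t \<in> H2_fields D" and w1: "\<And>t. t \<in> {0..T} \<Longrightarrow> w1 t \<in> H2_fields D"
    and w2: "\<And>t. t \<in> {0..T} \<Longrightarrow> w2 t \<in> H2_fields D"
    and d1: "has_time_derivative D T w w1" and d2: "has_time_derivative D T w1 w2"
    and K: "\<And>t. t \<in> {0..T} \<Longrightarrow> L2_norm D (w2 t) \<le> K"
    and t: "0 \<le> t0" "t0 < t1" "t1 \<le> T" and s: "s = t0 \<or> s = t1"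
  shows "L2_norm D (\<lambda>x. w1 s x - (w t1 x - w t0 x) /\<^sub>R (t1 - t0)) \<le> (t1 - t0) / 2 * K"
proof -
  let ?e = "\<lambda>x. w1 s x - (w t1 x - w t0 x) /\<^sub>R (t1 - t0)"
  have times: "t0 \<in> {0..T}" "t1 \<in> {0..T}" "s \<in> {0..T}" using t s by auto
  note L2 = w[OF times(1), THEN H2_fields_L2] w[OF times(2), THEN H2_fields_L2] w1[OF times(3), THEN H2_fields_L2]
  have e: "?e \<in> L2_space D" by (intro L2_space_diff L2_space_scaleR L2)
  have K0: "K \<ge> 0" using K[OF times(1)] L2_norm_nonneg[of D "w2 t0"] by linarith
  have "L2_inner D ?e ?e = L2_inner D (w1 s) ?e - L2_inner D (\<lambda>x. (w t1 x - w t0 x) /\<^sub>R (t1 - t0)) ?e"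
    by (intro L2_inner_diff_left L2_space_scaleR L2_space_diff L2 e)
  also have "\<dots> = L2_inner D (w1 s) ?e - (L2_inner D (w t1) ?e - L2_inner D (w t0) ?e) / (t1 - t0)"
    by (simp only: L2_inner_scaleR_left L2_inner_diff_left[OF L2(2,1) e] divide_inverse mult.commute[of "inverse _"])
  also have "\<dots> \<le> \<bar>\<dots>\<bar>" by (rule abs_ge_self)
  also have "\<dots> \<le> (t1 - t0) / 2 * (K * L2_norm D ?e)"
  proof (rule difference_quotient_error_real[where \<phi> = "\<lambda>s. L2_inner D (w s) ?e"
        and \<phi>' = "\<lambda>s. L2_inner D (w1 s) ?e" and \<phi>'' = "\<lambda>s. L2_inner D (w2 s) ?e", OF _ _ _ t s])
    fix t assume t: "t \<in> {0..T}"
    show "((\<lambda>s. L2_inner D (w s) ?e) has_real_derivative L2_inner D (w1 t) ?e) (at t within {0..T})"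
      by (rule time_derivative_L2_inner[OF w w1 d1 e t])
    show "((\<lambda>s. L2_inner D (w1 s) ?e) has_real_derivative L2_inner D (w2 t) ?e) (at t within {0..T})"
      by (rule time_derivative_L2_inner[OF w1 w2 d2 e t])
    have "\<bar>L2_inner D (w2 t) ?e\<bar> \<le> L2_norm D (w2 t) * L2_norm D ?e"
      by (rule L2_Cauchy_Schwarz[OF H2_fields_L2[OF w2[OF t]] e])
    also have "\<dots> \<le> K * L2_norm D ?e"
      by (intro mult_right_mono K t) simp
    finally show "\<bar>L2_inner D (w2 t) ?e\<bar> \<le> K * L2_norm D ?e" .
  qed
  finally have "L2_inner D ?e ?e \<le> (t1 - t0) / 2 * K * L2_norm D ?e" by (simp only: mult.assoc)
  then show ?thesis
    using K0 t by (intro L2_norm_le_by_testing) auto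
qed

text \<open>A curve with vanishing norm has vanishing velocity: all its difference quotients have norm
  zero, and they converge to the velocity.\<close>

lemma time_derivative_of_null_curve:
  assumes w: "\<And>t. t \<in> {0..T} \<Longrightarrow> w t \<in> H2_fields D" and z: "\<And>t. t \<in> {0..T} \<Longrightarrow> z t \<in> H2_fields D"
    and deriv: "has_time_derivative D T w z" and null: "\<And>t. t \<in> {0..T} \<Longrightarrow> H2_norm D (w t) = 0"
    and T: "T > 0" and t: "t \<in> {0..T}"
  shows "H2_norm D (z t) = 0"
proof -
  let ?F = "at t within {0..T}"
  let ?p = "\<lambda>s x. (w s x - w t x) /\<^sub>R (s - t)"
  let ?q = "\<lambda>s x. ?p s x - z t x"
  have lim: "((\<lambda>s. H2_norm D (?q s)) \<longlongrightarrow> 0) ?F"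
    using deriv t by (simp add: has_time_derivative_def)
  have "H2_norm D (z t) \<le> H2_norm D (?q s)" if s: "s \<in> {0..T}" for s
  proof -
    have d: "(\<lambda>x. w s x - w t x) \<in> H2_fields D" by (intro H2_fields_diff w s t)
    have p: "?p s \<in> H2_fields D" by (intro H2_fields_scaleR d)
    have "H2_norm D (\<lambda>x. w s x - w t x) \<le> H2_norm D (w s) + H2_norm D (\<lambda>x. (-1) *\<^sub>R w t x)"
      using H2_norm_triangle[OF w[OF s] H2_fields_scaleR[OF w[OF t]], of "-1"] by simp
    also have "\<dots> \<le> 0" using H2_norm_scaleR_le[OF w[OF t], of "-1"] null[OF s] null[OF t] by simp
    finally have d0: "H2_norm D (\<lambda>x. w s x - w t x) = 0"
      using H2_norm_nonneg[OF d] by simp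
    have "H2_norm D (?p s) \<le> \<bar>inverse (s - t)\<bar> * H2_norm D (\<lambda>x. w s x - w t x)"
      by (rule H2_norm_scaleR_le[OF d])
    then have p0: "H2_norm D (?p s) \<le> 0" unfolding d0 by simp
    have "\<bar>H2_norm D (?p s) - H2_norm D (z t)\<bar> \<le> H2_norm D (?q s)"
      by (rule H2_norm_diff_ineq[OF p z[OF t]])
    then show ?thesis using p0 H2_norm_nonneg[OF p] by linarith
  qed
  then have ev: "\<forall>\<^sub>F s in ?F. H2_norm D (z t) \<le> H2_norm D (?q s)"
    by (auto simp: eventually_at_filter)
  have "t islimpt {0..T}"
  proof (rule connected_imp_perfect)
    show "{0..T} \<noteq> {a}" for a
    proof
      assume "{0..T} = {a}"
      moreover have "0 \<in> {0..T}" "T \<in> {0..T}" using T by auto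
      ultimately show False using T by auto
    qed
  qed (use t in auto)
  then have "?F \<noteq> bot" by (simp add: trivial_limit_within)
  from tendsto_lowerbound[OF lim ev this] show ?thesis
    using H2_norm_nonneg[OF z[OF t]] by simp
qed

section \<open>Testing against the finite element space\<close>

lemma L2_inner_divideR_diff_left:
  assumes "p \<in> L2_space D" "q \<in> L2_space D" "z \<in> L2_space D"
  shows "L2_inner D (\<lambda>x. (p x - q x) /\<^sub>R s) z = (L2_inner D p z - L2_inner D q z) / s"
  by (simp add: L2_inner_scaleR_left L2_inner_diff_left[OF assms] divide_inverse mult.commute)

text \<open>The scheme only determines inner products with elements of \<open>V\<close>, whereas the error estimates
  test with combinations of such elements. The double orthogonal complement contains these
  combinations.\<close>

definition double_orthogonal :: "(real ^ 'd) set \<Rightarrow> ('d::finite) field set \<Rightarrow> 'd field set" where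
  "double_orthogonal D V = {x \<in> L2_space D.
     \<forall>q\<in>L2_space D. (\<forall>z\<in>V. L2_inner D q z = 0) \<longrightarrow> L2_inner D q x = 0}"

lemma double_orthogonal_L2: "x \<in> double_orthogonal D V \<Longrightarrow> x \<in> L2_space D"
  by (simp add: double_orthogonal_def)

lemma double_orthogonal_base: "V \<subseteq> L2_space D \<Longrightarrow> x \<in> V \<Longrightarrow> x \<in> double_orthogonal D V"
  by (auto simp: double_orthogonal_def)

lemma double_orthogonal_diff:
  assumes "x \<in> double_orthogonal D V" "y \<in> double_orthogonal D V"
  shows "(\<lambda>p. x p - y p) \<in> double_orthogonal D V"
  using assms by (auto simp: double_orthogonal_def L2_space_diff L2_inner_diff_right)

lemma double_orthogonal_scaleR:
  assumes "x \<in> double_orthogonal D V"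
  shows "(\<lambda>p. s *\<^sub>R x p) \<in> double_orthogonal D V"
  using assms by (auto simp: double_orthogonal_def L2_space_scaleR L2_inner_scaleR_right)

text \<open>If \<open>x\<close> looks like \<open>y\<close> to the test space that \<open>x\<close> itself belongs to, then \<open>x\<close> is the orthogonal
  projection of \<open>y\<close>, so its norm does not exceed that of \<open>y\<close>.\<close>

lemma L2_norm_le_if_same_tests:
  assumes x: "x \<in> double_orthogonal D V" and y: "y \<in> L2_space D" and V: "V \<subseteq> L2_space D"
    and eq: "\<And>z. z \<in> V \<Longrightarrow> L2_inner D x z = L2_inner D y z"
  shows "L2_norm D x \<le> L2_norm D y"
proof (rule L2_norm_le_by_testing)
  note xL2 = double_orthogonal_L2[OF x]
  have "L2_inner D (\<lambda>p. x p - y p) z = 0" if "z \<in> V" for z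
    using eq[OF that] L2_inner_diff_left[OF xL2 y, of z] that V by auto
  then have "L2_inner D (\<lambda>p. x p - y p) x = 0"
    using x L2_space_diff[OF xL2 y] by (auto simp: double_orthogonal_def)
  then have "L2_inner D x x = L2_inner D y x"
    using L2_inner_diff_left[OF xL2 y xL2] by simp
  also have "\<dots> \<le> L2_norm D y * L2_norm D x"
    using L2_Cauchy_Schwarz[OF y xL2] by linarith
  finally show "L2_inner D x x \<le> L2_norm D y * L2_norm D x" .
qed simp

text \<open>The difference of two consecutive position equations, divided by \<open>dt\<close>, has the left-hand side of
  the velocity equation as its right-hand side.\<close>

lemma central_difference_of_scheme:
  assumes V: "V \<subseteq> L2_space D" and dt: "dt > 0" and k: "k \<ge> 1"
    and uh: "uh (k - 1) \<in> L2_space D" "uh k \<in> L2_space D" "uh (k + 1) \<in> L2_space D"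
    and vh: "vh k \<in> L2_space D" "vh (k + 1) \<in> L2_space D"
    and pos: "position_eq D V dt uh vh (k - 1)" "position_eq D V dt uh vh k"
    and vel: "velocity_eq D V F bh dt uh vh k"
  shows "central_difference_eq D V F bh dt uh k"
  unfolding central_difference_eq_def
proof
  fix z assume z: "z \<in> V"
  then have zL2: "z \<in> L2_space D" using V by auto
  let ?i = "\<lambda>w. L2_inner D w z"
  have p1: "(?i (uh k) - ?i (uh (k - 1))) / dt = ?i (vh k)"
    using pos(1) z k L2_inner_divideR_diff_left[OF uh(2,1) zL2, of dt] by (simp add: position_eq_def)
  have p2: "(?i (uh (k + 1)) - ?i (uh k)) / dt = ?i (vh (k + 1))"
    using pos(2) z L2_inner_divideR_diff_left[OF uh(3,2) zL2, of dt] by (simp add: position_eq_def)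
  have v: "(?i (vh (k + 1)) - ?i (vh k)) / dt = ?i (F (uh k)) + ?i (bh k)"
    using vel z L2_inner_divideR_diff_left[OF vh(2,1) zL2, of dt] by (simp add: velocity_eq_def)
  have "?i (\<lambda>x. (uh (k + 1) x - 2 *\<^sub>R uh k x + uh (k - 1) x) /\<^sub>R dt\<^sup>2)
      = inverse (dt\<^sup>2) * (?i (uh (k + 1)) - 2 * ?i (uh k) + ?i (uh (k - 1)))"
    by (simp only: L2_inner_scaleR_left L2_inner_add_left[OF L2_space_diff[OF uh(3) L2_space_scaleR[OF uh(2)]] uh(1) zL2]
        L2_inner_diff_left[OF uh(3) L2_space_scaleR[OF uh(2)] zL2])
  also have "\<dots> = ((?i (uh (k + 1)) - ?i (uh k)) / dt - (?i (uh k) - ?i (uh (k - 1))) / dt) / dt"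
    using dt by (simp add: field_simps power2_eq_square)
  also have "\<dots> = ?i (F (uh k)) + ?i (bh k)"
    unfolding p1 p2 v ..
  finally show "?i (\<lambda>x. (uh (k + 1) x - 2 *\<^sub>R uh k x + uh (k - 1) x) /\<^sub>R dt\<^sup>2) = ?i (F (uh k)) + ?i (bh k)" .
qed

section \<open>Stability\<close>

text \<open>Discrete Gronwall inequality for an implicit recursion with sources \<open>s k\<close>. The growth factor
  of one step, \<open>(1 + \<Lambda> dt) / (1 - dt) = 1 + dt (1 + \<Lambda>) / (1 - dt)\<close>, is at most the exponential
  of its excess over 1.\<close>

lemma implicit_discrete_Gronwall:
  fixes e s :: "nat \<Rightarrow> real"
  assumes dt: "0 < dt" "dt < 1" and \<Lambda>: "\<Lambda> \<ge> 0" and s: "\<And>k. s k \<ge> 0" and e0: "e 0 \<ge> 0"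
    and step: "\<And>k. k < n \<Longrightarrow> (1 - dt) * e (k + 1) \<le> (1 + \<Lambda> * dt) * e k + dt * s k"
  shows "e n \<le> exp (real n * dt * (1 + \<Lambda>) * (1 / (1 - dt))) * (e 0 + dt / (1 - dt) * (\<Sum>k<n. s k))"
proof -
  define q where "q = (1 + \<Lambda> * dt) / (1 - dt)"
  have q1: "q \<ge> 1"
    using dt mult_nonneg_nonneg[OF \<Lambda>, of dt] by (simp add: q_def)
  have "k \<le> n \<Longrightarrow> e k \<le> q ^ k * (e 0 + dt / (1 - dt) * (\<Sum>i<k. s i))" for k
  proof (induction k)
    case (Suc k)
    let ?S = "\<Sum>i<k. s i"
    have "e (Suc k) \<le> q * e k + dt / (1 - dt) * s k"
    proof -
      have "(1 - dt) * e (Suc k) \<le> (1 - dt) * (q * e k + dt / (1 - dt) * s k)"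
        using step[of k] Suc.prems dt by (simp add: q_def distrib_left)
      then show ?thesis by (rule mult_left_le_imp_le) (use dt in simp)
    qed
    also have "\<dots> \<le> q * (q ^ k * (e 0 + dt / (1 - dt) * ?S)) + q ^ Suc k * (dt / (1 - dt) * s k)"
    proof (intro add_mono mult_left_mono)
      show "e k \<le> q ^ k * (e 0 + dt / (1 - dt) * ?S)" using Suc by simp
      show "dt / (1 - dt) * s k \<le> q ^ Suc k * (dt / (1 - dt) * s k)"
        using mult_right_mono[OF one_le_power[OF q1, of "Suc k"], of "dt / (1 - dt) * s k"] dt s[of k]
        by (simp del: power_Suc)
    qed (use q1 in auto)
    also have "\<dots> = q ^ Suc k * (e 0 + dt / (1 - dt) * (\<Sum>i<Suc k. s i))"
      by (simp add: algebra_simps)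
    finally show ?case .
  qed simp
  then have "e n \<le> q ^ n * (e 0 + dt / (1 - dt) * (\<Sum>k<n. s k))" by simp
  also have "\<dots> \<le> exp (real n * dt * (1 + \<Lambda>) * (1 / (1 - dt))) * (e 0 + dt / (1 - dt) * (\<Sum>k<n. s k))"
  proof (rule mult_right_mono)
    have "q = 1 + dt * (1 + \<Lambda>) * (1 / (1 - dt))"
      using dt by (simp add: q_def field_simps)
    also have "\<dots> \<le> exp (dt * (1 + \<Lambda>) * (1 / (1 - dt)))" by (rule exp_ge_add_one_self)
    finally have "q ^ n \<le> exp (dt * (1 + \<Lambda>) * (1 / (1 - dt))) ^ n"
      using q1 by (intro power_mono) auto
    also have "\<dots> = exp (real n * dt * (1 + \<Lambda>) * (1 / (1 - dt)))"
      by (simp add: exp_of_nat_mult[symmetric] mult.assoc)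
    finally show "q ^ n \<le> exp (real n * dt * (1 + \<Lambda>) * (1 / (1 - dt)))" .
    show "0 \<le> e 0 + dt / (1 - dt) * (\<Sum>k<n. s k)"
      using e0 dt s by (intro add_nonneg_nonneg mult_nonneg_nonneg sum_nonneg) auto
  qed
  finally show ?thesis .
qed

text \<open>What the stability argument needs to know about the model: \<open>\<Lambda>\<close> is the Lipschitz constant of the
  force, \<open>A\<close> a bound for the acceleration; \<open>A\<close> and \<open>B\<close> measure the truncation errors of the difference
  quotients, and \<open>S\<close> the error of the force that is caused by projecting the exact displacement.\<close>

locale scheme_error =
  fixes D :: "(real ^ 'd::finite) set" and V :: "'d field set" and F r :: "'d field \<Rightarrow> 'd field"
    and \<Lambda> T dt A B S :: real and u v a b :: "real \<Rightarrow> 'd field" and uh vh :: "nat \<Rightarrow> 'd field"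
  assumes V: "V \<subseteq> L2_space D"
    and proj: "L2_projection D V r"
    and F_L2: "\<And>w. w \<in> L2_space D \<Longrightarrow> F w \<in> L2_space D"
    and F_lip: "\<And>w z. w \<in> L2_space D \<Longrightarrow> z \<in> L2_space D \<Longrightarrow>
      L2_norm D (\<lambda>x. F w x - F z x) \<le> \<Lambda> * L2_norm D (\<lambda>x. w x - z x)"
    and \<Lambda>: "\<Lambda> \<ge> 0" and dt: "0 < dt" "dt < 1"
    and L2: "\<And>t. t \<in> {0..T} \<Longrightarrow> u t \<in> L2_space D" "\<And>t. t \<in> {0..T} \<Longrightarrow> v t \<in> L2_space D"
      "\<And>t. t \<in> {0..T} \<Longrightarrow> a t \<in> L2_space D" "\<And>t. t \<in> {0..T} \<Longrightarrow> b t \<in> L2_space D"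
    and exact: "\<And>t. t \<in> {0..T} \<Longrightarrow> AE x in lborel. x \<in> D \<longrightarrow> a t x = F (u t) x + b t x"
    and A: "\<And>t. t \<in> {0..T} \<Longrightarrow> L2_norm D (a t) \<le> A" and AB: "A \<ge> 0" "B \<ge> 0" "S \<ge> 0"
    and trunc_u: "\<And>k. real (k + 1) * dt \<le> T \<Longrightarrow>
      L2_norm D (\<lambda>x. v (real (k + 1) * dt) x - (u (real (k + 1) * dt) x - u (real k * dt) x) /\<^sub>R dt) \<le> dt / 2 * A"
    and trunc_v: "\<And>k. real (k + 1) * dt \<le> T \<Longrightarrow>
      L2_norm D (\<lambda>x. a (real k * dt) x - (v (real (k + 1) * dt) x - v (real k * dt) x) /\<^sub>R dt) \<le> dt / 2 * B"
    and trunc_F: "\<And>t. t \<in> {0..T} \<Longrightarrow> L2_norm D (\<lambda>x. F (r (u t)) x - F (u t) x) \<le> S"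
    and sol: "fe_solution D V F (\<lambda>k. r (b (real k * dt))) T dt (r (u 0)) (r (v 0)) uh vh"
begin

abbreviation eu :: "nat \<Rightarrow> 'd field" where "eu k x \<equiv> r (u (real k * dt)) x - uh k x"
abbreviation ev :: "nat \<Rightarrow> 'd field" where "ev k x \<equiv> r (v (real k * dt)) x - vh k x"

lemma time_in: "real k * dt \<le> T \<Longrightarrow> real k * dt \<in> {0..T}"
  using dt by simp

lemma earlier_time: "real (k + 1) * dt \<le> T \<Longrightarrow> real k * dt \<le> T"
  using dt by (simp add: algebra_simps)

lemma solution_in_V: "real k * dt \<le> T \<Longrightarrow> uh k \<in> V" "real k * dt \<le> T \<Longrightarrow> vh k \<in> V"
  using sol by (auto simp: fe_solution_def)

lemma projection_in_V: "w \<in> L2_space D \<Longrightarrow> r w \<in> V"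
  and projection_tests: "w \<in> L2_space D \<Longrightarrow> z \<in> V \<Longrightarrow> L2_inner D (r w) z = L2_inner D w z"
  using proj by (auto simp: L2_projection_def)

lemma error_double_orthogonal:
  assumes "real k * dt \<le> T"
  shows "eu k \<in> double_orthogonal D V" "ev k \<in> double_orthogonal D V"
  by (intro double_orthogonal_diff double_orthogonal_base[OF V] projection_in_V solution_in_V
      L2(1,2) time_in assms)+

lemma error_tests:
  assumes "real k * dt \<le> T" "z \<in> V"
  shows "L2_inner D (eu k) z = L2_inner D (u (real k * dt)) z - L2_inner D (uh k) z"
    and "L2_inner D (ev k) z = L2_inner D (v (real k * dt)) z - L2_inner D (vh k) z"
proof -
  have z: "z \<in> L2_space D" using assms V by auto
  note t = L2(1,2)[OF time_in[OF assms(1)]]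
  have "r (u (real k * dt)) \<in> L2_space D" "r (v (real k * dt)) \<in> L2_space D"
    "uh k \<in> L2_space D" "vh k \<in> L2_space D"
    using V projection_in_V t solution_in_V[OF assms(1)] by auto
  then show "L2_inner D (eu k) z = L2_inner D (u (real k * dt)) z - L2_inner D (uh k) z"
    "L2_inner D (ev k) z = L2_inner D (v (real k * dt)) z - L2_inner D (vh k) z"
    using z by (simp_all add: L2_inner_diff_left projection_tests t assms(2))
qed

text \<open>Subtracting the discrete position equation from the exact one leaves the truncation error of
  the difference quotient of \<open>u\<close>.\<close>

lemma position_error_step:
  assumes k: "real (k + 1) * dt \<le> T"
  shows "L2_norm D (eu (k + 1)) \<le> L2_norm D (eu k) + dt * L2_norm D (ev (k + 1)) + dt * (dt / 2 * A)"
proof -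
  note k0 = earlier_time[OF k]
  let ?u0 = "u (real k * dt)" and ?u1 = "u (real (k + 1) * dt)" and ?v1 = "v (real (k + 1) * dt)"
  let ?q = "\<lambda>x. (?u1 x - ?u0 x) /\<^sub>R dt"
  let ?\<tau> = "\<lambda>x. ?v1 x - ?q x"
  let ?x = "\<lambda>x. (eu (k + 1) x - eu k x) - dt *\<^sub>R ev (k + 1) x"
  note eL = error_double_orthogonal[OF k0] error_double_orthogonal[OF k]
  note e2 = eL[THEN double_orthogonal_L2]
  note tL = L2(1)[OF time_in[OF k0]] L2(1)[OF time_in[OF k]] L2(2)[OF time_in[OF k]]
  have q: "?q \<in> L2_space D" by (intro L2_space_scaleR L2_space_diff tL)
  have \<tau>: "?\<tau> \<in> L2_space D" by (intro L2_space_diff tL q)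
  have x: "?x \<in> double_orthogonal D V" by (intro double_orthogonal_diff double_orthogonal_scaleR eL)
  have "L2_norm D ?x \<le> L2_norm D (\<lambda>x. (- dt) *\<^sub>R ?\<tau> x)"
  proof (rule L2_norm_le_if_same_tests[OF x L2_space_scaleR[OF \<tau>] V])
    fix z assume z: "z \<in> V"
    then have zL2: "z \<in> L2_space D" using V by auto
    have uhL2: "uh (k + 1) \<in> L2_space D" "uh k \<in> L2_space D"
      using V solution_in_V k k0 by auto
    have pos: "(L2_inner D (uh (k + 1)) z - L2_inner D (uh k) z) / dt = L2_inner D (vh (k + 1)) z"
    proof -
      have "position_eq D V dt uh vh k" using sol k by (simp only: fe_solution_def)
      then show ?thesis
        using z L2_inner_divideR_diff_left[OF uhL2 zL2, of dt] by (simp add: position_eq_def)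
    qed
    have "L2_inner D ?x z = L2_inner D (eu (k + 1)) z - L2_inner D (eu k) z - dt * L2_inner D (ev (k + 1)) z"
      by (simp only: L2_inner_diff_left[OF L2_space_diff[OF e2(3,1)] L2_space_scaleR[OF e2(4)] zL2]
          L2_inner_diff_left[OF e2(3,1) zL2] L2_inner_scaleR_left)
    also have "\<dots> = L2_inner D ?u1 z - L2_inner D ?u0 z - dt * L2_inner D ?v1 z"
      unfolding error_tests[OF k z] error_tests[OF k0 z] pos[symmetric]
      using dt by (simp add: field_simps)
    also have "\<dots> = - dt * (L2_inner D ?v1 z - (L2_inner D ?u1 z - L2_inner D ?u0 z) / dt)"
      using dt by (simp add: field_simps)
    also have "\<dots> = L2_inner D (\<lambda>x. (- dt) *\<^sub>R ?\<tau> x) z"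
      by (simp only: L2_inner_scaleR_left L2_inner_diff_left[OF tL(3) q zL2]
          L2_inner_diff_left[OF tL(2,1) zL2] divide_inverse mult.commute[of "inverse dt"])
    finally show "L2_inner D ?x z = L2_inner D (\<lambda>x. (- dt) *\<^sub>R ?\<tau> x) z" .
  qed
  also have "\<dots> \<le> dt * (dt / 2 * A)"
    unfolding L2_norm_scaleR using trunc_u[OF k] dt by simp
  finally have xn: "L2_norm D ?x \<le> dt * (dt / 2 * A)" .
  have "eu (k + 1) = (\<lambda>x. ?x x + (eu k x + dt *\<^sub>R ev (k + 1) x))" by simp
  then have "L2_norm D (eu (k + 1)) = L2_norm D (\<lambda>x. ?x x + (eu k x + dt *\<^sub>R ev (k + 1) x))" by simp
  also have "\<dots> \<le> L2_norm D ?x + L2_norm D (\<lambda>x. eu k x + dt *\<^sub>R ev (k + 1) x)"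
    by (intro L2_norm_triangle L2_space_add L2_space_scaleR e2 double_orthogonal_L2[OF x])
  also have "L2_norm D (\<lambda>x. eu k x + dt *\<^sub>R ev (k + 1) x) \<le> L2_norm D (eu k) + L2_norm D (\<lambda>x. dt *\<^sub>R ev (k + 1) x)"
    by (intro L2_norm_triangle L2_space_scaleR e2)
  also have "L2_norm D (\<lambda>x. dt *\<^sub>R ev (k + 1) x) = dt * L2_norm D (ev (k + 1))"
    unfolding L2_norm_scaleR using dt by simp
  finally show ?thesis using xn by simp
qed

text \<open>The velocity equation with the load weighted by \<open>\<eta>\<close>: the regular step has \<open>\<eta> = 1\<close>, and the
  starting step has \<open>\<eta> = 1 / 2\<close>. The missing part \<open>1 - \<eta>\<close> of the load shows up as the same part of
  the exact acceleration.\<close>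

lemma velocity_error_step:
  assumes k: "real (k + 1) * dt \<le> T" and \<eta>: "0 \<le> \<eta>" "\<eta> \<le> 1"
    and vel: "\<And>z. z \<in> V \<Longrightarrow> (L2_inner D (vh (k + 1)) z - L2_inner D (vh k) z) / dt
      = \<eta> * (L2_inner D (F (uh k)) z + L2_inner D (r (b (real k * dt))) z)"
  shows "L2_norm D (ev (k + 1)) \<le> L2_norm D (ev k)
    + dt * ((1 - \<eta>) * A + dt / 2 * B + (S + \<Lambda> * L2_norm D (eu k)))"
proof -
  note k0 = earlier_time[OF k]
  let ?t0 = "real k * dt"
  let ?v0 = "v ?t0" and ?v1 = "v (real (k + 1) * dt)" and ?a0 = "a ?t0" and ?b0 = "b ?t0" and ?u0 = "u ?t0"
  let ?q = "\<lambda>x. (?v1 x - ?v0 x) /\<^sub>R dt"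
  let ?\<tau> = "\<lambda>x. ?a0 x - ?q x"
  let ?G = "\<lambda>x. F ?u0 x - F (uh k) x"
  let ?x = "\<lambda>x. ev (k + 1) x - ev k x"
  let ?y = "\<lambda>x. ((1 - \<eta>) *\<^sub>R ?a0 x - ?\<tau> x) + \<eta> *\<^sub>R ?G x"
  note eL = error_double_orthogonal[OF k0] error_double_orthogonal[OF k]
  note e2 = eL[THEN double_orthogonal_L2]
  note vL = L2(2)[OF time_in[OF k0]] L2(2)[OF time_in[OF k]]
  note aL = L2(3)[OF time_in[OF k0]] and bL = L2(4)[OF time_in[OF k0]] and uL = L2(1)[OF time_in[OF k0]]
  have uhL: "uh k \<in> L2_space D" and ruL: "r ?u0 \<in> L2_space D"
    using V solution_in_V[OF k0] projection_in_V[OF uL] by auto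
  have q: "?q \<in> L2_space D" by (intro L2_space_scaleR L2_space_diff vL)
  have \<tau>: "?\<tau> \<in> L2_space D" by (intro L2_space_diff aL q)
  have G: "?G \<in> L2_space D" by (intro L2_space_diff F_L2 uhL uL)
  have y: "?y \<in> L2_space D" by (intro L2_space_add L2_space_diff L2_space_scaleR aL \<tau> G)
  have x: "?x \<in> double_orthogonal D V" by (intro double_orthogonal_diff eL)
  have "L2_norm D ?x \<le> L2_norm D (\<lambda>x. dt *\<^sub>R ?y x)"
  proof (rule L2_norm_le_if_same_tests[OF x L2_space_scaleR[OF y] V])
    fix z assume z: "z \<in> V"
    then have zL2: "z \<in> L2_space D" using V by auto
    let ?i = "\<lambda>w. L2_inner D w z"
    \<comment> \<open>The equation of motion holds almost everywhere in \<open>D\<close>, and \<open>z\<close> vanishes outside of \<open>D\<close>.\<close>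
    have acc: "?i ?a0 = ?i (F ?u0) + ?i ?b0"
    proof -
      have [measurable]: "?a0 \<in> borel_measurable borel" "F ?u0 \<in> borel_measurable borel"
        "?b0 \<in> borel_measurable borel" "z \<in> borel_measurable borel"
        using L2_spaceD(1) aL F_L2[OF uL] bL zL2 by auto
      have "AE x in lborel. ?a0 x \<bullet> z x = (F ?u0 x + ?b0 x) \<bullet> z x"
        using exact[OF time_in[OF k0]]
      proof eventually_elim
        case (elim x)
        then show ?case using L2_spaceD(2)[OF zL2, of x] by (cases "x \<in> D") auto
      qed
      then have "(LINT x|lborel. ?a0 x \<bullet> z x) = (LINT x|lborel. (F ?u0 x + ?b0 x) \<bullet> z x)"
        by (intro integral_cong_AE) auto
      then have "?i ?a0 = ?i (\<lambda>x. F ?u0 x + ?b0 x)"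
        by (simp only: L2_inner_altdef[OF aL] L2_inner_altdef[OF L2_space_add[OF F_L2[OF uL] bL]])
      then show ?thesis by (simp only: L2_inner_add_left[OF F_L2[OF uL] bL zL2])
    qed
    have vh: "?i (vh (k + 1)) - ?i (vh k) = dt * (\<eta> * (?i (F (uh k)) + ?i ?b0))"
      using vel[OF z] dt projection_tests[OF bL z] by (simp add: field_simps)
    have "?i ?x = (?i ?v1 - ?i ?v0) - (?i (vh (k + 1)) - ?i (vh k))"
      unfolding L2_inner_diff_left[OF e2(4,2) zL2] error_tests[OF k z] error_tests[OF k0 z] by simp
    also have "\<dots> = dt * ((1 - \<eta>) * ?i ?a0 - (?i ?a0 - (?i ?v1 - ?i ?v0) / dt) + \<eta> * (?i (F ?u0) - ?i (F (uh k))))"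
    proof -
      have "X - dt * (\<eta> * (p + q)) = dt * ((1 - \<eta>) * (f + q) - (f + q - X / dt) + \<eta> * (f - p))" for X p q f
        using dt by (simp add: field_simps)
      then show ?thesis unfolding vh acc .
    qed
    also have "\<dots> = ?i (\<lambda>x. dt *\<^sub>R ?y x)"
      by (simp only: L2_inner_scaleR_left
          L2_inner_add_left[OF L2_space_diff[OF L2_space_scaleR[OF aL] \<tau>] L2_space_scaleR[OF G] zL2]
          L2_inner_diff_left[OF L2_space_scaleR[OF aL] \<tau> zL2] L2_inner_diff_left[OF aL q zL2]
          L2_inner_diff_left[OF F_L2[OF uL] F_L2[OF uhL] zL2]
          L2_inner_diff_left[OF vL(2,1) zL2] divide_inverse mult.commute[of "inverse dt"])
    finally show "?i ?x = ?i (\<lambda>x. dt *\<^sub>R ?y x)" .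
  qed
  also have "\<dots> = dt * L2_norm D ?y" unfolding L2_norm_scaleR using dt by simp
  also have "\<dots> \<le> dt * ((1 - \<eta>) * A + dt / 2 * B + (S + \<Lambda> * L2_norm D (eu k)))"
  proof (rule mult_left_mono)
    have "L2_norm D ?G \<le> L2_norm D (\<lambda>x. F ?u0 x - F (r ?u0) x) + L2_norm D (\<lambda>x. F (r ?u0) x - F (uh k) x)"
      by (intro L2_norm_triangle_three F_L2 uL ruL uhL)
    also have "\<dots> \<le> S + \<Lambda> * L2_norm D (eu k)"
      using trunc_F[OF time_in[OF k0]] F_lip[OF ruL uhL] L2_norm_minus_commute[of D "F ?u0" "F (r ?u0)"]
      by simp
    finally have G_le: "L2_norm D ?G \<le> S + \<Lambda> * L2_norm D (eu k)" .
    have "L2_norm D ?y \<le> L2_norm D (\<lambda>x. (1 - \<eta>) *\<^sub>R ?a0 x - ?\<tau> x) + L2_norm D (\<lambda>x. \<eta> *\<^sub>R ?G x)"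
      by (intro L2_norm_triangle L2_space_diff L2_space_scaleR aL \<tau> G)
    also have "\<dots> \<le> (L2_norm D (\<lambda>x. (1 - \<eta>) *\<^sub>R ?a0 x) + L2_norm D ?\<tau>) + L2_norm D (\<lambda>x. \<eta> *\<^sub>R ?G x)"
      by (intro add_right_mono L2_norm_triangle_diff L2_space_scaleR aL \<tau>)
    also have "\<dots> = ((1 - \<eta>) * L2_norm D ?a0 + L2_norm D ?\<tau>) + \<eta> * L2_norm D ?G"
      unfolding L2_norm_scaleR using \<eta> by simp
    also have "\<dots> \<le> ((1 - \<eta>) * A + dt / 2 * B) + 1 * (S + \<Lambda> * L2_norm D (eu k))"
      using \<eta> A[OF time_in[OF k0]] trunc_v[OF k] G_le
      by (intro add_mono mult_mono[of \<eta> 1] mult_left_mono) auto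
    finally show "L2_norm D ?y \<le> (1 - \<eta>) * A + dt / 2 * B + (S + \<Lambda> * L2_norm D (eu k))" by simp
  qed (use dt in simp)
  finally have xn: "L2_norm D ?x \<le> dt * ((1 - \<eta>) * A + dt / 2 * B + (S + \<Lambda> * L2_norm D (eu k)))" .
  have "L2_norm D (ev (k + 1)) = L2_norm D (\<lambda>x. ?x x + ev k x)" by simp
  also have "\<dots> \<le> L2_norm D ?x + L2_norm D (ev k)"
    by (intro L2_norm_triangle e2 double_orthogonal_L2[OF x])
  finally show ?thesis using xn by linarith
qed

definition total_error :: "nat \<Rightarrow> real" where
  "total_error k = projected_error D r dt u v uh vh k"

lemma total_error_eq: "total_error k = L2_norm D (eu k) + L2_norm D (ev k)"
  by (simp add: total_error_def projected_error_def)

text \<open>A bound for the part of the initial acceleration that the halved load of the starting equation leaves out.\<close>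

definition starting_load :: real where
  "starting_load = (if velocity_eq D V F (\<lambda>k. r (b (real k * dt))) dt uh vh 0 then 0 else A / 2)"

lemma velocity_tests:
  assumes k: "real (k + 1) * dt \<le> T"
    and vel: "velocity_eq D V F (\<lambda>k. r (b (real k * dt))) dt uh vh k" and z: "z \<in> V"
  shows "(L2_inner D (vh (k + 1)) z - L2_inner D (vh k) z) / dt
      = 1 * (L2_inner D (F (uh k)) z + L2_inner D (r (b (real k * dt))) z)"
proof -
  have "vh (k + 1) \<in> L2_space D" "vh k \<in> L2_space D" "z \<in> L2_space D"
    using V z solution_in_V(2)[OF k] solution_in_V(2)[OF earlier_time[OF k]] by auto
  from L2_inner_divideR_diff_left[OF this, of dt] show ?thesis
    using vel z by (simp add: velocity_eq_def)
qed

lemma starting_tests: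
  assumes k: "dt \<le> T"
    and start: "starting_eq D V F (\<lambda>k. r (b (real k * dt))) dt uh vh" and z: "z \<in> V"
  shows "(L2_inner D (vh (0 + 1)) z - L2_inner D (vh 0) z) / dt
      = 1 / 2 * (L2_inner D (F (uh 0)) z + L2_inner D (r (b (real 0 * dt))) z)"
proof -
  let ?i = "\<lambda>w. L2_inner D w z"
  have uhL2: "uh 1 \<in> L2_space D" "uh 0 \<in> L2_space D" and zL2: "z \<in> L2_space D"
    using V z solution_in_V(1)[of 1] solution_in_V(1)[of 0] k dt by auto
  have "position_eq D V dt uh vh 0" using sol k by (auto simp: fe_solution_def)
  then have pos: "(?i (uh 1) - ?i (uh 0)) / dt = ?i (vh 1)"
    using z L2_inner_divideR_diff_left[OF uhL2 zL2, of dt] by (simp add: position_eq_def)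
  have "(?i (uh 1) - ?i (uh 0)) / dt\<^sup>2 = 1 / 2 * ?i (F (uh 0)) + 1 / dt * ?i (vh 0) + 1 / 2 * ?i (r (b (real 0 * dt)))"
    using start z L2_inner_divideR_diff_left[OF uhL2 zL2, of "dt\<^sup>2"] unfolding starting_eq_def by simp
  moreover have "(?i (uh 1) - ?i (uh 0)) / dt\<^sup>2 = ?i (vh 1) / dt"
    unfolding pos[symmetric] by (simp add: power2_eq_square)
  ultimately have "?i (vh 1) / dt = 1 / 2 * ?i (F (uh 0)) + 1 / dt * ?i (vh 0) + 1 / 2 * ?i (r (b (real 0 * dt)))"
    by (simp only:)
  moreover have "X - Y / dt = 1 / 2 * (p + q)" if "X = 1 / 2 * p + 1 / dt * Y + 1 / 2 * q" for X Y p q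
    using that by simp
  ultimately have "?i (vh 1) / dt - ?i (vh 0) / dt = 1 / 2 * (?i (F (uh 0)) + ?i (r (b (real 0 * dt))))"
    by blast
  then show ?thesis by (simp only: diff_divide_distrib add_0)
qed

text \<open>The term \<open>dt * L2_norm D (ev (k + 1))\<close> from the position equation is moved to the left, which is where the
  factor \<open>1 - dt\<close> comes from.\<close>

lemma total_error_step:
  assumes k: "real (k + 1) * dt \<le> T"
  shows "(1 - dt) * total_error (k + 1) \<le> (1 + \<Lambda> * dt) * total_error k
    + dt * (dt / 2 * A + dt / 2 * B + S + (if k = 0 then starting_load else 0))"
proof -
  let ?s = "if k = 0 then starting_load else 0"
  have v: "L2_norm D (ev (k + 1)) \<le> L2_norm D (ev k)
    + dt * (?s + dt / 2 * B + (S + \<Lambda> * L2_norm D (eu k)))"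
  proof (cases "velocity_eq D V F (\<lambda>k. r (b (real k * dt))) dt uh vh k")
    case True
    have "?s = (1 - 1) * A" using True by (auto simp: starting_load_def)
    then show ?thesis
      using velocity_error_step[OF k _ _ velocity_tests[OF k True]] by simp
  next
    case False
    have "\<forall>k\<ge>1. real (k + 1) * dt \<le> T \<longrightarrow> velocity_eq D V F (\<lambda>k. r (b (real k * dt))) dt uh vh k"
      using sol unfolding fe_solution_def by blast
    with False k have k0: "k = 0" by (cases k) auto
    have dtT: "dt \<le> T" using k k0 by simp
    moreover have "dt \<le> T \<longrightarrow> starting_eq D V F (\<lambda>k. r (b (real k * dt))) dt uh vh \<or>
        velocity_eq D V F (\<lambda>k. r (b (real k * dt))) dt uh vh 0"
      using sol unfolding fe_solution_def by blast
    ultimately have "starting_eq D V F (\<lambda>k. r (b (real k * dt))) dt uh vh"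
      using False k0 by blast
    note start = dtT this
    have load: "starting_load = A / 2" using False k0 by (simp add: starting_load_def)
    show ?thesis
      using velocity_error_step[of 0 "1 / 2", OF _ _ _ starting_tests[OF start]] k k0 by (simp add: load)
  qed
  have nonneg: "0 \<le> dt * (\<Lambda> * L2_norm D (ev k))" using dt \<Lambda> by simp
  have "(1 - dt) * total_error (k + 1)
      \<le> L2_norm D (eu (k + 1)) + L2_norm D (ev (k + 1)) - dt * L2_norm D (ev (k + 1))"
    using dt by (simp add: total_error_eq algebra_simps)
  also have "\<dots> \<le> L2_norm D (eu k) + dt * (dt / 2 * A) + L2_norm D (ev k)
      + dt * (?s + dt / 2 * B + (S + \<Lambda> * L2_norm D (eu k)))"
    using position_error_step[OF k] v by linarith
  also have "\<dots> \<le> \<dots> + dt * (\<Lambda> * L2_norm D (ev k))" using nonneg by simp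
  also have "\<dots> = (1 + \<Lambda> * dt) * total_error k + dt * (dt / 2 * A + dt / 2 * B + S + ?s)"
    unfolding total_error_eq by (simp add: algebra_simps)
  finally show ?thesis .
qed

text \<open>The sharp constants \<open>1/2\<close> of the truncation errors leave enough room for the extra
  source \<open>A / 2\<close> of the starting step, which acts once and therefore is not weighted by \<open>T\<close>.\<close>

theorem stability:
  assumes n: "real n * dt \<le> T"
  shows "total_error n \<le> exp (T * (1 + \<Lambda>) * (1 / (1 - dt))) *
    (total_error 0 +
      ((if velocity_eq D V F (\<lambda>k. r (b (real k * dt))) dt uh vh 0 then T else max 1 T) / (1 - dt)) *
      ((A + B) * dt + S))"
proof -
  let ?vel = "velocity_eq D V F (\<lambda>k. r (b (real k * dt))) dt uh vh 0"
  let ?m = "if ?vel then T else max 1 T"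
  let ?\<tau> = "dt / 2 * A + dt / 2 * B + S"
  let ?s = "\<lambda>k. ?\<tau> + (if k = 0 then starting_load else 0)"
  have T: "T \<ge> 0"
  proof -
    have "0 \<le> real n * dt" using dt by simp
    then show ?thesis using n by linarith
  qed
  have load: "0 \<le> starting_load" "starting_load \<le> A / 2" using AB by (auto simp: starting_load_def)
  have e0: "0 \<le> total_error 0" by (simp add: total_error_eq)
  have \<tau>0: "0 \<le> ?\<tau>" using AB dt by (intro add_nonneg_nonneg mult_nonneg_nonneg) auto
  have s0: "0 \<le> ?s k" for k using \<tau>0 load by auto
  have "total_error n \<le> exp (real n * dt * (1 + \<Lambda>) * (1 / (1 - dt))) *
      (total_error 0 + dt / (1 - dt) * (\<Sum>k<n. ?s k))"
  proof (rule implicit_discrete_Gronwall[OF dt \<Lambda>])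
    fix k assume "k < n"
    then have "real (k + 1) * dt \<le> real n * dt" using dt by (intro mult_right_mono) auto
    then have "real (k + 1) * dt \<le> T" using n by linarith
    from total_error_step[OF this]
    show "(1 - dt) * total_error (k + 1) \<le> (1 + \<Lambda> * dt) * total_error k + dt * ?s k" .
  next
    show "0 \<le> ?s k" for k by (rule s0)
  qed (rule e0)
  also have "\<dots> \<le> exp (T * (1 + \<Lambda>) * (1 / (1 - dt))) * (total_error 0 + ?m / (1 - dt) * ((A + B) * dt + S))"
  proof (rule mult_mono)
    show "exp (real n * dt * (1 + \<Lambda>) * (1 / (1 - dt))) \<le> exp (T * (1 + \<Lambda>) * (1 / (1 - dt)))"
      using n \<Lambda> dt by (subst exp_le_cancel_iff) (intro mult_right_mono, auto)
    have sum: "(\<Sum>k<n. ?s k) \<le> real n * ?\<tau> + starting_load"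
      using load by (simp add: sum.distrib sum.delta)
    have "dt * (\<Sum>k<n. ?s k) \<le> dt * (real n * ?\<tau> + starting_load)"
      using dt by (intro mult_left_mono sum) auto
    also have "\<dots> = (real n * dt) * ?\<tau> + dt * starting_load" by (simp add: algebra_simps)
    also have "\<dots> \<le> T * ?\<tau> + dt * starting_load"
      using n \<tau>0 by (intro add_right_mono mult_right_mono) auto
    also have "\<dots> \<le> ?m * ((A + B) * dt + S)"
    proof (cases ?vel)
      case True
      have "0 \<le> (A + B) * dt" using AB dt by simp
      moreover have "?\<tau> = (A + B) * dt / 2 + S" by (simp add: algebra_simps)
      ultimately have "?\<tau> \<le> (A + B) * dt + S" by simp
      then have "T * ?\<tau> \<le> T * ((A + B) * dt + S)"
        using T by (rule mult_left_mono)
      then show ?thesis using True by (simp add: starting_load_def)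
    next
      case False
      let ?M = "max 1 T"
      have "T * ?\<tau> \<le> ?M * ?\<tau>" using \<tau>0 by (intro mult_right_mono) auto
      moreover have "dt * starting_load \<le> ?M * (dt / 2 * A)"
        using AB dt mult_right_mono[of 1 ?M "dt / 2 * A"] False by (simp add: starting_load_def)
      moreover have "?M * ?\<tau> + ?M * (dt / 2 * A) \<le> ?M * ((A + B) * dt + S)"
      proof -
        have "?\<tau> + dt / 2 * A \<le> (A + B) * dt + S"
          using AB dt mult_nonneg_nonneg[of dt B] by (simp add: algebra_simps)
        then have "?M * (?\<tau> + dt / 2 * A) \<le> ?M * ((A + B) * dt + S)"
          by (intro mult_left_mono) auto
        then show ?thesis by (simp only: distrib_left)
      qed
      ultimately have "T * ?\<tau> + dt * starting_load \<le> ?M * ((A + B) * dt + S)" by linarith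
      then show ?thesis using False by simp
    qed
    finally have "dt * (\<Sum>k<n. ?s k) / (1 - dt) \<le> ?m * ((A + B) * dt + S) / (1 - dt)"
      using dt by (intro divide_right_mono) auto
    then show "total_error 0 + dt / (1 - dt) * (\<Sum>k<n. ?s k)
        \<le> total_error 0 + ?m / (1 - dt) * ((A + B) * dt + S)" by simp
    show "0 \<le> total_error 0 + dt / (1 - dt) * (\<Sum>k<n. ?s k)"
      using e0 dt sum_nonneg[of "{..<n}" ?s, OF s0] by simp
  qed simp
  finally show ?thesis .
qed

end

section \<open>The error estimate\<close>

lemma fe_space_L2: "fe_space D \<T> \<subseteq> L2_space D"
  by (auto simp: fe_space_def H10_space_def Sobolev_space_def)

lemma C2_curve_fields:
  assumes "C2_curve D T w w1 w2" "t \<in> {0..T}"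
  shows "w t \<in> W_space D" "w t \<in> H2_fields D" "w1 t \<in> H2_fields D" "w2 t \<in> H2_fields D"
  using assms W_space_subset[of D] by (auto simp: C2_curve_def)

lemma (in scheme_error) consistency:
  assumes k: "real (k + 1) * dt \<le> T"
  shows "L2_norm D (\<lambda>x. v (real (k + 1) * dt) x - (u (real (k + 1) * dt) x - u (real k * dt) x) /\<^sub>R dt) +
       L2_norm D (\<lambda>x. a (real k * dt) x - (v (real (k + 1) * dt) x - v (real k * dt) x) /\<^sub>R dt) +
       L2_norm D (\<lambda>x. F (r (u (real k * dt))) x - F (u (real k * dt)) x) \<le> (A + B) * dt + S"
proof -
  have "0 \<le> (A + B) * dt" using AB dt by simp
  moreover have "dt / 2 * A + dt / 2 * B = (A + B) * dt / 2" by (simp add: algebra_simps)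
  ultimately have "dt / 2 * A + dt / 2 * B + S \<le> (A + B) * dt + S" by simp
  then show ?thesis
    using trunc_u[OF k] trunc_v[OF k] trunc_F[OF time_in[OF earlier_time[OF k]]] by linarith
qed

lemma (in scheme_error) fe_error_le:
  assumes k: "real k * dt \<le> T"
  shows "fe_error D dt u v uh vh k \<le> total_error k
    + (L2_norm D (\<lambda>x. u (real k * dt) x - r (u (real k * dt)) x)
      + L2_norm D (\<lambda>x. v (real k * dt) x - r (v (real k * dt)) x))"
proof -
  let ?t = "real k * dt"
  have *: "L2_norm D (\<lambda>x. wh x - w x) \<le> L2_norm D (\<lambda>x. r w x - wh x) + L2_norm D (\<lambda>x. w x - r w x)"
    if "w \<in> L2_space D" "wh \<in> V" for w wh
  proof -
    have "wh \<in> L2_space D" "r w \<in> L2_space D" using that V projection_in_V by auto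
    from L2_norm_triangle_three[OF this that(1)] show ?thesis
      using L2_norm_minus_commute[of D wh "r w"] L2_norm_minus_commute[of D w "r w"] by simp
  qed
  show ?thesis
    using *[OF L2(1)[OF time_in[OF k]] solution_in_V(1)[OF k]]
      *[OF L2(2)[OF time_in[OF k]] solution_in_V(2)[OF k]]
    unfolding fe_error_def total_error_eq by linarith
qed

theorem theorem4p1:
  fixes D :: "(real ^ 'd::finite) set"
    and \<omega> :: "real ^ 'd \<Rightarrow> real" and J f g :: "real \<Rightarrow> real"
    and \<epsilon> T M \<kappa> c L C\<^sub>p C\<^sub>t C\<^sub>s :: real
    and F :: "'d field \<Rightarrow> 'd field"
    and u v a j b :: "real \<Rightarrow> 'd field" and u\<^sub>0 v\<^sub>0 :: "'d field"
    and meshes :: "(real ^ 'd) set set set"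
    and r :: "(real ^ 'd) set set \<Rightarrow> 'd field \<Rightarrow> 'd field"
  assumes dim: "CARD('d) \<in> {2, 3}"
    and dom: "open D" "C1_boundary D"
    and horizon: "\<epsilon> > 0"
    and infl: "influence_function M J"
    and bdry: "boundary_function D \<omega>"
    and pot_f: "convex_concave_potential f"
    and pot_g: "quadratic_potential g \<or> convex_concave_potential g"
    and F_def: "F = peridynamic_force \<epsilon> \<omega> J f g"
    and L_def: "L = lipschitz_const TYPE('d) J f g"
    and T: "T > 0"
    and body: "\<And>t. t \<in> {0..T} \<Longrightarrow> b t \<in> L2_space D"
    and u_C2: "C2_curve D T u v a"
    and v_C2: "C2_curve D T v a j"
    and exact: "\<And>t. t \<in> {0..T} \<Longrightarrow> AE x in lborel. x \<in> D \<longrightarrow> a t x = F (u t) x + b t x"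
    and init: "u 0 = u\<^sub>0" "v 0 = v\<^sub>0"
    and mesh: "\<kappa> > 0" "\<And>\<T>. \<T> \<in> meshes \<Longrightarrow> conforming_mesh D \<T> \<and> shape_regular \<kappa> \<T>"
    and proj: "\<And>\<T>. \<T> \<in> meshes \<Longrightarrow> L2_projection D (fe_space D \<T>) (r \<T>)"
    and proj_estimate: "c > 0" "\<And>\<T> w. \<T> \<in> meshes \<Longrightarrow> w \<in> W_space D \<Longrightarrow>
           L2_norm D (\<lambda>x. w x - r \<T> w x) \<le> c * (mesh_size \<T>)\<^sup>2 * H2_norm D w"
    and Cp_def: "C\<^sub>p = c * ((SUP t\<in>{0..T}. H2_norm D (u t)) + (SUP t\<in>{0..T}. H2_norm D (v t)))"
    and Ct_def: "C\<^sub>t = (SUP t\<in>{0..T}. L2_norm D (a t)) + (SUP t\<in>{0..T}. L2_norm D (j t))"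
    and Cs_def: "C\<^sub>s = L * c * (SUP t\<in>{0..T}. H2_norm D (u t))"
  shows
    "(\<forall>\<T>\<in>meshes. \<forall>dt uh vh. 0 < dt \<and> dt < 1 \<and>
        fe_solution D (fe_space D \<T>) F (\<lambda>k. r \<T> (b (real k * dt))) T dt (r \<T> u\<^sub>0) (r \<T> v\<^sub>0) uh vh \<longrightarrow>
        (\<forall>k\<ge>1. real (k + 1) * dt \<le> T \<longrightarrow>
           central_difference_eq D (fe_space D \<T>) F (\<lambda>k. r \<T> (b (real k * dt))) dt uh k) \<and>
        (dt \<le> T \<longrightarrow>
           consistency_error D F (r \<T>) T dt u v a \<le> C\<^sub>t * dt + C\<^sub>s * ((mesh_size \<T>)\<^sup>2 / \<epsilon>\<^sup>2)) \<and>
        (SUP k\<in>{k. real k \<le> T / dt}. fe_error D dt u v uh vh k) \<le>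
           C\<^sub>p * (mesh_size \<T>)\<^sup>2 +
           exp (T * (1 + L / \<epsilon>\<^sup>2) * (1 / (1 - dt))) *
             (projected_error D (r \<T>) dt u v uh vh 0 +
              ((if velocity_eq D (fe_space D \<T>) F (\<lambda>k. r \<T> (b (real k * dt))) dt uh vh 0
                then T else max 1 T) / (1 - dt)) *
                (C\<^sub>t * dt + C\<^sub>s * ((mesh_size \<T>)\<^sup>2 / \<epsilon>\<^sup>2)))) \<and>
     (L > 0 \<longrightarrow> (\<forall>\<delta>. 0 < \<delta> \<and> \<delta> < 1 \<longrightarrow> (\<exists>C. \<forall>\<T>\<in>meshes. \<forall>dt uh vh. 0 < dt \<and> dt \<le> \<delta> \<and>
        fe_solution D (fe_space D \<T>) F (\<lambda>k. r \<T> (b (real k * dt))) T dt (r \<T> u\<^sub>0) (r \<T> v\<^sub>0) uh vh \<and>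
        projected_error D (r \<T>) dt u v uh vh 0 = 0 \<longrightarrow>
        (\<forall>k. real k \<le> T / dt \<longrightarrow>
           fe_error D dt u v uh vh k \<le> C * (C\<^sub>t * dt + C\<^sub>s * ((mesh_size \<T>)\<^sup>2 / \<epsilon>\<^sup>2))))))"
proof -
  define \<Lambda> where "\<Lambda> = L / \<epsilon>\<^sup>2"
  define U where "U = (SUP t\<in>{0..T}. H2_norm D (u t))"
  define V where "V = (SUP t\<in>{0..T}. H2_norm D (v t))"
  define A where "A = (SUP t\<in>{0..T}. L2_norm D (a t))"
  define B where "B = (SUP t\<in>{0..T}. L2_norm D (j t))"
  have constants: "C\<^sub>p = c * (U + V)" "C\<^sub>t = A + B" "C\<^sub>s = L * c * U"
    by (simp_all add: Cp_def Ct_def Cs_def U_def V_def A_def B_def)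
  have "CARD('d) \<ge> 2" using dim by auto
  then interpret bond_model D \<omega> J M \<epsilon>
    using horizon infl bdry by (intro bond_model_of_assumptions) auto
  have F_L2: "F w \<in> L2_space D" if "w \<in> L2_space D" for w
    unfolding F_def by (rule peridynamic_force_lipschitz(1)[OF pot_f pot_g that that])
  have F_lip: "L2_norm D (\<lambda>x. F w x - F z x) \<le> \<Lambda> * L2_norm D (\<lambda>x. w x - z x)"
    if "w \<in> L2_space D" "z \<in> L2_space D" for w z
    unfolding F_def \<Lambda>_def L_def by (rule peridynamic_force_lipschitz(2)[OF pot_f pot_g that])
  have zero_field: "(\<lambda>x. 0) \<in> L2_space D" by (simp add: L2_space_def)
  have L: "L \<ge> 0"
    unfolding L_def by (rule peridynamic_force_lipschitz(3)[OF pot_f pot_g zero_field zero_field])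
  then have \<Lambda>: "\<Lambda> \<ge> 0" by (simp add: \<Lambda>_def)

  note fields_u = C2_curve_fields[OF u_C2] and fields_v = C2_curve_fields[OF v_C2]
  have der: "has_time_derivative D T u v" "has_time_derivative D T v a" "has_time_derivative D T a j"
    and cont: "time_continuous D T j"
    using u_C2 v_C2 by (auto simp: C2_curve_def)
  have bdd_u: "H2_norm D (u t) \<le> U" and bdd_v: "H2_norm D (v t) \<le> V"
    and bdd_a: "L2_norm D (a t) \<le> A" and bdd_j: "L2_norm D (j t) \<le> B" if "t \<in> {0..T}" for t
    unfolding U_def V_def A_def B_def
    by (intro cSUP_upper that time_continuous_bdd_above time_derivative_imp_continuous[OF _ _ der(1)]
        time_derivative_imp_continuous[OF _ _ der(2)] time_derivative_imp_continuous[OF _ _ der(3)]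
        cont fields_u fields_v; assumption)+
  have zero_in: "0 \<in> {0..T}" using T by simp
  have nonneg: "0 \<le> U" "0 \<le> V" "0 \<le> A" "0 \<le> B"
    using bdd_u[OF zero_in] bdd_v[OF zero_in] bdd_a[OF zero_in] bdd_j[OF zero_in]
      H2_norm_nonneg[OF fields_u(2)[OF zero_in]] H2_norm_nonneg[OF fields_v(2)[OF zero_in]]
      L2_norm_nonneg[of D "a 0"] L2_norm_nonneg[of D "j 0"] by linarith+

  \<comment> \<open>The consistency error of the force: its Lipschitz constant times the projection error.\<close>
  define S where "S \<T> = C\<^sub>s * ((mesh_size \<T>)\<^sup>2 / \<epsilon>\<^sup>2)" for \<T> :: "(real ^ 'd) set set"
  have S0: "0 \<le> S \<T>" for \<T>
    unfolding S_def constants using L proj_estimate(1) nonneg by simp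
  have scheme: "scheme_error D (fe_space D \<T>) F (r \<T>) \<Lambda> T dt A B (S \<T>) u v a b uh vh"
    if \<T>: "\<T> \<in> meshes" and dt: "0 < dt" "dt < 1"
      and sol: "fe_solution D (fe_space D \<T>) F (\<lambda>k. r \<T> (b (real k * dt))) T dt (r \<T> u\<^sub>0) (r \<T> v\<^sub>0) uh vh"
    for \<T> dt uh vh
  proof
    show "L2_norm D (\<lambda>x. F (r \<T> (u t)) x - F (u t) x) \<le> S \<T>" if t: "t \<in> {0..T}" for t
    proof -
      have uL: "u t \<in> L2_space D" using fields_u(2)[OF t] by (rule H2_fields_L2)
      then have rL: "r \<T> (u t) \<in> L2_space D"
        using proj[OF \<T>] fe_space_L2[of D \<T>] by (auto simp: L2_projection_def)
      have "L2_norm D (\<lambda>x. F (r \<T> (u t)) x - F (u t) x) \<le> \<Lambda> * L2_norm D (\<lambda>x. u t x - r \<T> (u t) x)"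
        using F_lip[OF rL uL] L2_norm_minus_commute[of D "u t" "r \<T> (u t)"] by simp
      also have "\<dots> \<le> \<Lambda> * (c * (mesh_size \<T>)\<^sup>2 * U)"
      proof (rule mult_left_mono[OF _ \<Lambda>])
        have "L2_norm D (\<lambda>x. u t x - r \<T> (u t) x) \<le> c * (mesh_size \<T>)\<^sup>2 * H2_norm D (u t)"
          by (rule proj_estimate(2)[OF \<T> fields_u(1)[OF t]])
        also have "\<dots> \<le> c * (mesh_size \<T>)\<^sup>2 * U"
          using proj_estimate(1) by (intro mult_left_mono bdd_u t) auto
        finally show "L2_norm D (\<lambda>x. u t x - r \<T> (u t) x) \<le> c * (mesh_size \<T>)\<^sup>2 * U" .
      qed
      also have "\<dots> = S \<T>" by (simp add: S_def constants \<Lambda>_def)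
      finally show ?thesis .
    qed
    fix k assume k: "real (k + 1) * dt \<le> T"
    have t: "0 \<le> real k * dt" "real k * dt < real (k + 1) * dt" "real (k + 1) * dt \<le> T"
      and diff: "real (k + 1) * dt - real k * dt = dt"
      using dt k by (simp_all add: algebra_simps)
    show "L2_norm D (\<lambda>x. v (real (k + 1) * dt) x - (u (real (k + 1) * dt) x - u (real k * dt) x) /\<^sub>R dt) \<le> dt / 2 * A"
      using difference_quotient_error[OF fields_u(2-4) der(1,2) bdd_a t, of "real (k + 1) * dt"]
      unfolding diff by simp
    show "L2_norm D (\<lambda>x. a (real k * dt) x - (v (real (k + 1) * dt) x - v (real k * dt) x) /\<^sub>R dt) \<le> dt / 2 * B"
      using difference_quotient_error[OF fields_v(2-4) der(2,3) bdd_j t, of "real k * dt"]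
      unfolding diff by simp
  qed (use fe_space_L2 proj[OF \<T>] F_L2 F_lip \<Lambda> dt fields_u(2-4)[THEN H2_fields_L2] body exact bdd_a nonneg S0 sol init in auto)

  define m where "m \<T> dt uh vh = (if velocity_eq D (fe_space D \<T>) F (\<lambda>k. r \<T> (b (real k * dt))) dt uh vh 0
      then T else max 1 T)" for \<T> dt uh vh
  define \<tau> where "\<tau> \<T> dt = C\<^sub>t * dt + C\<^sub>s * ((mesh_size \<T>)\<^sup>2 / \<epsilon>\<^sup>2)" for \<T> :: "(real ^ 'd) set set" and dt
  have \<tau>_eq: "\<tau> \<T> dt = (A + B) * dt + S \<T>" for \<T> dt
    by (simp add: \<tau>_def S_def constants)
  have error: "fe_error D dt u v uh vh k \<le> C\<^sub>p * (mesh_size \<T>)\<^sup>2 +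
      exp (T * (1 + L / \<epsilon>\<^sup>2) * (1 / (1 - dt))) *
        (projected_error D (r \<T>) dt u v uh vh 0 + m \<T> dt uh vh / (1 - dt) * \<tau> \<T> dt)"
    if \<T>: "\<T> \<in> meshes" and dt: "0 < dt" "dt < 1"
      and sol: "fe_solution D (fe_space D \<T>) F (\<lambda>k. r \<T> (b (real k * dt))) T dt (r \<T> u\<^sub>0) (r \<T> v\<^sub>0) uh vh"
      and k: "real k \<le> T / dt"
    for \<T> dt uh vh k
  proof -
    interpret scheme_error D "fe_space D \<T>" F "r \<T>" \<Lambda> T dt A B "S \<T>" u v a b uh vh
      by (rule scheme[OF that(1-4)])
    have kT: "real k * dt \<le> T" using k dt by (simp add: pos_le_divide_eq)
    note t = time_in[OF kT]
    have "L2_norm D (\<lambda>x. u (real k * dt) x - r \<T> (u (real k * dt)) x)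
        + L2_norm D (\<lambda>x. v (real k * dt) x - r \<T> (v (real k * dt)) x)
        \<le> c * (mesh_size \<T>)\<^sup>2 * H2_norm D (u (real k * dt)) + c * (mesh_size \<T>)\<^sup>2 * H2_norm D (v (real k * dt))"
      by (intro add_mono proj_estimate(2)[OF \<T>] fields_u(1)[OF t] fields_v(1)[OF t])
    also have "\<dots> \<le> c * (mesh_size \<T>)\<^sup>2 * U + c * (mesh_size \<T>)\<^sup>2 * V"
      using proj_estimate(1) by (intro add_mono mult_left_mono bdd_u[OF t] bdd_v[OF t]) auto
    also have "\<dots> = C\<^sub>p * (mesh_size \<T>)\<^sup>2" by (simp add: constants algebra_simps)
    finally have "fe_error D dt u v uh vh k \<le> C\<^sub>p * (mesh_size \<T>)\<^sup>2 + total_error k"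
      using fe_error_le[OF kT] by linarith
    with stability[OF kT] show ?thesis
      unfolding total_error_def \<tau>_eq m_def \<Lambda>_def by linarith
  qed

  have part1: "(\<forall>k\<ge>1. real (k + 1) * dt \<le> T \<longrightarrow>
           central_difference_eq D (fe_space D \<T>) F (\<lambda>k. r \<T> (b (real k * dt))) dt uh k) \<and>
        (dt \<le> T \<longrightarrow> consistency_error D F (r \<T>) T dt u v a \<le> \<tau> \<T> dt) \<and>
        (SUP k\<in>{k. real k \<le> T / dt}. fe_error D dt u v uh vh k) \<le> C\<^sub>p * (mesh_size \<T>)\<^sup>2 +
           exp (T * (1 + L / \<epsilon>\<^sup>2) * (1 / (1 - dt))) *
             (projected_error D (r \<T>) dt u v uh vh 0 + m \<T> dt uh vh / (1 - dt) * \<tau> \<T> dt)"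
    if \<T>: "\<T> \<in> meshes" and dt: "0 < dt" "dt < 1"
      and sol: "fe_solution D (fe_space D \<T>) F (\<lambda>k. r \<T> (b (real k * dt))) T dt (r \<T> u\<^sub>0) (r \<T> v\<^sub>0) uh vh"
    for \<T> dt uh vh
  proof (intro conjI allI impI)
    note bound = error[OF \<T> dt sol]
    interpret scheme_error D "fe_space D \<T>" F "r \<T>" \<Lambda> T dt A B "S \<T>" u v a b uh vh
      by (rule scheme[OF that(1-4)])
    show "central_difference_eq D (fe_space D \<T>) F (\<lambda>k. r \<T> (b (real k * dt))) dt uh k"
      if k: "k \<ge> 1" "real (k + 1) * dt \<le> T" for k
    proof -
      have k1: "real k * dt \<le> T" using earlier_time[OF k(2)] .
      have k2: "real (k - 1) * dt \<le> T" using earlier_time[of "k - 1"] k(1) k1 by simp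
      have pos: "position_eq D (fe_space D \<T>) dt uh vh i" if "real (i + 1) * dt \<le> T" for i
        using sol that unfolding fe_solution_def by blast
      have "velocity_eq D (fe_space D \<T>) F (\<lambda>k. r \<T> (b (real k * dt))) dt uh vh k"
        using sol k unfolding fe_solution_def by blast
      then show ?thesis
        using V solution_in_V(1)[OF k2] solution_in_V[OF k1] solution_in_V[OF k(2)] pos[OF k(2)]
          pos[of "k - 1"] k k1 dt
        by (intro central_difference_of_scheme) auto
    qed
    show "consistency_error D F (r \<T>) T dt u v a \<le> \<tau> \<T> dt" if "dt \<le> T"
    proof -
      have "0 \<in> {k::nat. real (k + 1) * dt \<le> T}" using that by simp
      then have "{k::nat. real (k + 1) * dt \<le> T} \<noteq> {}" by blast
      then show ?thesis
        unfolding consistency_error_def Let_def \<tau>_eq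
        by (rule cSUP_least) (use consistency in blast)
    qed
    have "0 \<in> {k::nat. real k \<le> T / dt}" using T dt by simp
    then have "{k::nat. real k \<le> T / dt} \<noteq> {}" by blast
    then show "(SUP k\<in>{k. real k \<le> T / dt}. fe_error D dt u v uh vh k) \<le> C\<^sub>p * (mesh_size \<T>)\<^sup>2 +
           exp (T * (1 + L / \<epsilon>\<^sup>2) * (1 / (1 - dt))) *
             (projected_error D (r \<T>) dt u v uh vh 0 + m \<T> dt uh vh / (1 - dt) * \<tau> \<T> dt)"
      by (rule cSUP_least) (use bound in blast)
  qed

  have part2: "\<exists>C. \<forall>\<T>\<in>meshes. \<forall>dt uh vh. 0 < dt \<and> dt \<le> \<delta> \<and>
        fe_solution D (fe_space D \<T>) F (\<lambda>k. r \<T> (b (real k * dt))) T dt (r \<T> u\<^sub>0) (r \<T> v\<^sub>0) uh vh \<and>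
        projected_error D (r \<T>) dt u v uh vh 0 = 0 \<longrightarrow>
        (\<forall>k. real k \<le> T / dt \<longrightarrow> fe_error D dt u v uh vh k \<le> C * \<tau> \<T> dt)"
    if Lpos: "L > 0" and \<delta>: "0 < \<delta>" "\<delta> < 1" for \<delta>
  proof -
    \<comment> \<open>The projection error \<open>C\<^sub>p h\<^sup>2\<close> is proportional to \<open>C\<^sub>s h\<^sup>2 / \<epsilon>\<^sup>2\<close> if \<open>U > 0\<close>. If \<open>U = 0\<close>, the
      solution is the zero curve, hence so is its velocity, and there is no projection error.\<close>
    obtain P where P: "P \<ge> 0" "\<And>\<T>. C\<^sub>p * (mesh_size \<T>)\<^sup>2 \<le> P * S \<T>"
    proof (cases "U = 0")
      case True
      have null: "H2_norm D (u t) = 0" if "t \<in> {0..T}" for t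
        using bdd_u[OF that] H2_norm_nonneg[OF fields_u(2)[OF that]] True by simp
      have "H2_norm D (v t) = 0" if "t \<in> {0..T}" for t
        by (rule time_derivative_of_null_curve[OF fields_u(2,3) der(1) null T that])
      then have "V = 0" unfolding V_def using T by simp
      then show ?thesis using True by (intro that[of 0]) (simp_all add: constants)
    next
      case False
      then have Cs: "C\<^sub>s > 0" using nonneg Lpos proj_estimate(1) by (simp add: constants)
      have Cp: "C\<^sub>p \<ge> 0" using nonneg proj_estimate(1) by (simp add: constants)
      show ?thesis
        using Cs Cp horizon by (intro that[of "C\<^sub>p * \<epsilon>\<^sup>2 / C\<^sub>s"]) (simp_all add: S_def)
    qed
    define E where "E = exp (T * (1 + L / \<epsilon>\<^sup>2) * (1 / (1 - \<delta>)))"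
    show ?thesis
    proof (intro exI[of _ "P + E * (max 1 T / (1 - \<delta>))"] ballI allI impI, elim conjE)
      fix \<T> dt uh vh k
      assume \<T>: "\<T> \<in> meshes" and k: "real k \<le> T / dt" and dt: "0 < dt" "dt \<le> \<delta>"
        and sol: "fe_solution D (fe_space D \<T>) F (\<lambda>k. r \<T> (b (real k * dt))) T dt (r \<T> u\<^sub>0) (r \<T> v\<^sub>0) uh vh"
        and e0: "projected_error D (r \<T>) dt u v uh vh 0 = 0"
      have dt1: "dt < 1" using dt \<delta> by simp
      have S_le: "S \<T> \<le> \<tau> \<T> dt" and \<tau>0: "0 \<le> \<tau> \<T> dt"
        using nonneg dt S0[of \<T>] by (simp_all add: \<tau>_eq)
      have "fe_error D dt u v uh vh k \<le> C\<^sub>p * (mesh_size \<T>)\<^sup>2 +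
          exp (T * (1 + L / \<epsilon>\<^sup>2) * (1 / (1 - dt))) * (m \<T> dt uh vh / (1 - dt) * \<tau> \<T> dt)"
        using error[OF \<T> dt(1) dt1 sol k] e0 by simp
      also have "\<dots> \<le> P * \<tau> \<T> dt + E * (max 1 T / (1 - \<delta>) * \<tau> \<T> dt)"
      proof (rule add_mono)
        show "C\<^sub>p * (mesh_size \<T>)\<^sup>2 \<le> P * \<tau> \<T> dt"
          using P(2)[of \<T>] mult_left_mono[OF S_le P(1)] by linarith
        have exp_le: "exp (T * (1 + L / \<epsilon>\<^sup>2) * (1 / (1 - dt))) \<le> E"
          unfolding E_def exp_le_cancel_iff
          using T L dt \<delta> by (intro mult_left_mono divide_left_mono) auto
        have source_le: "m \<T> dt uh vh / (1 - dt) * \<tau> \<T> dt \<le> max 1 T / (1 - \<delta>) * \<tau> \<T> dt"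
          using T dt \<delta> \<tau>0 by (intro mult_right_mono frac_le) (auto simp: m_def)
        have source_nonneg: "0 \<le> m \<T> dt uh vh / (1 - dt) * \<tau> \<T> dt"
          using T dt1 \<tau>0 by (auto simp: m_def)
        have "0 \<le> E" by (simp add: E_def)
        from mult_mono[OF exp_le source_le this source_nonneg]
        show "exp (T * (1 + L / \<epsilon>\<^sup>2) * (1 / (1 - dt))) * (m \<T> dt uh vh / (1 - dt) * \<tau> \<T> dt)
            \<le> E * (max 1 T / (1 - \<delta>) * \<tau> \<T> dt)" .
      qed
      also have "\<dots> = (P + E * (max 1 T / (1 - \<delta>))) * \<tau> \<T> dt" by (simp add: distrib_right mult.assoc)
      finally show "fe_error D dt u v uh vh k \<le> (P + E * (max 1 T / (1 - \<delta>))) * \<tau> \<T> dt" .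
    qed
  qed
  show ?thesis
    using part1 part2 unfolding \<tau>_def m_def by (intro conjI ballI allI impI) blast+
qed

end
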